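(* On $S^3$, the round metric $g_S$ is not a local minimizer for $\tilde{\mathcal F}_{1/3}$; that is, there is a path of metrics $g_s$ on $S^3$ with $g_1=g_S$ and $\tilde{\mathcal F}_{1/3}[g_s]<\tilde{\mathcal F}_{1/3}[g_S]$ for $s<1$. Furthermore, there are non-trivial transverse-traceless elements $h\in H^1_{1/3}$ (of $(S^3,g_S)$) which are not integrable.
   Context: For a metric on a closed 3-manifold $M$, $\tilde{\mathcal F}_{1/3}[g]=\mathrm{Vol}(g)^{1/3}\big(\int_M|Ric_g|^2dV_g+\frac13\int_MR_g^2dV_g\big)$. The gradient $\nabla\tilde{\mathcal F}_{1/3}$ is defined by $\frac{d}{ds}\tilde{\mathcal F}_{1/3}[g_s]=\int\langle\nabla\tilde{\mathcal F}_{1/3}(g_s),g_s'\rangle dV_{g_s}$; $g$ is critical if the gradient vanishes at $g$. The round metric is critical. $(\nabla\tilde{\mathcal F}_{1/3})'_gh$ denotes the linearization of the gradient at $g$. A critical $g$ is a local minimizer if $\tilde{\mathcal F}_{1/3}[\tilde g]\ge\tilde{\mathcal F}_{1/3}[g]$ for all $\tilde g$ in some $C^{2,\alpha}$-neighborhood of $g$. With $n=3$, let $\beta_gh=\delta_gh-\frac1nd(tr_gh)$, $(\delta_gh)_j=\nabla^ih_{ij}$, $(\mathcal K_g\omega)_{ij}=\nabla_i\omega_j+\nabla_j\omega_i-\frac2n(\nabla^k\omega_k)g_{ij}$. Then $H^1_{1/3}$ is the space of $h\in C^{4,\alpha}(S^2(T^*M))$ with $\int tr_gh\,dV_g=0$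 and $(\nabla\tilde{\mathcal F}_{1/3})'_gh+\frac12\mathcal K_g\beta_g\mathcal K_g\beta_gh=0$. A tensor $h$ is transverse-traceless if $\delta_gh=0$ and $tr_gh=0$. A non-zero $h\in H^1_{1/3}$ is integrable if there exists a path $g_s$ of critical metrics for $\tilde{\mathcal F}_{1/3}$ with $g_0=g$ and $(g_s)'|_{s=0}=h$. *)

theory Defs
  imports "HOL-Analysis.Analysis"
begin

section \<open>The three-sphere and its left-invariant frame\<close>

abbreviation S3 :: "(real^4) set" where
  "S3 \<equiv> sphere 0 1"

definition tangent :: "real^4 \<Rightarrow> (real^4) set" where
  "tangent x = {v. x \<bullet> v = 0}"

text \<open>Reading a point \<open>(a, b, c, d)\<close> as the quaternion \<open>a + b i + c j + d k\<close>, the fields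
  \<open>frame 1\<close>, \<open>frame 2\<close>, \<open>frame 3\<close> are \<open>x i\<close>, \<open>x j\<close>, \<open>x k\<close>.  They trivialize the tangent bundle of
  the three-sphere, and all tensor calculus below is done in this (non-holonomic) frame.\<close>

definition frame :: "3 \<Rightarrow> real^4 \<Rightarrow> real^4" where
  "frame i x =
     (if i = 1 then vector [- (x$2), x$1, x$4, - (x$3)]
      else if i = 2 then vector [- (x$3), - (x$4), x$1, x$2]
      else vector [- (x$4), x$3, - (x$2), x$1])"

text \<open>The curve below is the integral curve of \<open>frame i\<close> through \<open>x\<close>, and it stays on the sphere;
  so \<open>fderiv i f x\<close> is the derivative of \<open>f\<close> along \<open>frame i\<close> and depends only on \<open>f\<close> on \<open>S3\<close>.\<close>

definition flow :: "3 \<Rightarrow> real \<Rightarrow> real^4 \<Rightarrow> real^4" where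
  "flow i t x = cos t *\<^sub>R x + sin t *\<^sub>R frame i x"

definition fderiv :: "3 \<Rightarrow> (real^4 \<Rightarrow> real) \<Rightarrow> real^4 \<Rightarrow> real" where
  "fderiv i f x = deriv (\<lambda>t. f (flow i t x)) 0"

definition frame_bracket :: "3 \<Rightarrow> 3 \<Rightarrow> real^4 \<Rightarrow> real^4" where
  "frame_bracket i j x =
     frechet_derivative (frame j) (at x) (frame i x) - frechet_derivative (frame i) (at x) (frame j x)"

definition struct_coeff :: "3 \<Rightarrow> 3 \<Rightarrow> 3 \<Rightarrow> real^4 \<Rightarrow> real" where
  "struct_coeff i j k x = frame_bracket i j x \<bullet> frame k x"

section \<open>Tensor fields\<close>

text \<open>A covariant 2-tensor field on the three-sphere is a family of bilinear forms on the tangent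
  spaces; values at points off \<open>S3\<close> or at vectors which are not tangent play no role.\<close>

type_synonym tensor2 = "real^4 \<Rightarrow> real^4 \<Rightarrow> real^4 \<Rightarrow> real"

definition sym_tensor :: "tensor2 \<Rightarrow> bool" where
  "sym_tensor h \<longleftrightarrow>
     (\<forall>x\<in>S3. \<forall>u\<in>tangent x. \<forall>v\<in>tangent x. \<forall>w\<in>tangent x. \<forall>a b.
        h x v w = h x w v \<and> h x (a *\<^sub>R u + b *\<^sub>R v) w = a * h x u w + b * h x v w)"

definition tensor_zero :: "tensor2 \<Rightarrow> bool" where
  "tensor_zero h \<longleftrightarrow> (\<forall>x\<in>S3. \<forall>v\<in>tangent x. \<forall>w\<in>tangent x. h x v w = 0)"

definition comps :: "tensor2 \<Rightarrow> real^4 \<Rightarrow> real^3^3" where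
  "comps h x = (\<chi> i j. h x (frame i x) (frame j x))"

definition round_metric :: tensor2 where
  "round_metric x v w = v \<bullet> w"

section \<open>Function spaces\<close>

text \<open>Iterated frame derivatives; a word \<open>[i1, ..., ik]\<close> stands for \<open>E_i1 ... E_ik\<close>.\<close>

primrec fderivs :: "3 list \<Rightarrow> (real^4 \<Rightarrow> real) \<Rightarrow> real^4 \<Rightarrow> real" where
  "fderivs [] f = f"
| "fderivs (i # w) f = fderiv i (fderivs w f)"

definition Ck :: "nat \<Rightarrow> (real^4 \<Rightarrow> real) \<Rightarrow> bool" where
  "Ck k f \<longleftrightarrow>
     (\<forall>w. length w \<le> k \<longrightarrow> continuous_on S3 (fderivs w f)) \<and>
     (\<forall>w i. \<forall>x\<in>S3. length w < k \<longrightarrow> (\<lambda>t. fderivs w f (flow i t x)) differentiable at 0)"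

definition Ck_alpha :: "nat \<Rightarrow> real \<Rightarrow> (real^4 \<Rightarrow> real) \<Rightarrow> bool" where
  "Ck_alpha k \<alpha> f \<longleftrightarrow> Ck k f \<and>
     (\<forall>w. length w = k \<longrightarrow>
        (\<exists>C. \<forall>x\<in>S3. \<forall>y\<in>S3. \<bar>fderivs w f x - fderivs w f y\<bar> \<le> C * dist x y powr \<alpha>))"

text \<open>The norm is only meaningful (that is, all suprema are finite) on functions satisfying
  \<open>Ck_alpha k \<alpha>\<close>; it is never used elsewhere.\<close>

definition Ck_alpha_norm :: "nat \<Rightarrow> real \<Rightarrow> (real^4 \<Rightarrow> real) \<Rightarrow> real" where
  "Ck_alpha_norm k \<alpha> f =
     (\<Sum>w\<in>{w. length w \<le> k}. SUP x\<in>S3. \<bar>fderivs w f x\<bar>) +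
     (\<Sum>w\<in>{w. length w = k}. SUP (x, y)\<in>{(x, y). x \<in> S3 \<and> y \<in> S3 \<and> x \<noteq> y}.
        \<bar>fderivs w f x - fderivs w f y\<bar> / dist x y powr \<alpha>)"

definition tensors :: "nat \<Rightarrow> real \<Rightarrow> tensor2 set" where
  "tensors k \<alpha> = {h. sym_tensor h \<and> (\<forall>i j. Ck_alpha k \<alpha> (\<lambda>x. comps h x $ i $ j))}"

definition tensor_norm :: "nat \<Rightarrow> real \<Rightarrow> tensor2 \<Rightarrow> real" where
  "tensor_norm k \<alpha> h = (\<Sum>i\<in>UNIV. \<Sum>j\<in>UNIV. Ck_alpha_norm k \<alpha> (\<lambda>x. comps h x $ i $ j))"

definition metrics :: "nat \<Rightarrow> real \<Rightarrow> tensor2 set" where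
  "metrics k \<alpha> =
     {g \<in> tensors k \<alpha>. \<forall>x\<in>S3. \<forall>v\<in>tangent x. v \<noteq> 0 \<longrightarrow> g x v v > 0}"

text \<open>Paths of metrics are continuous into the Hoelder space.\<close>

definition metric_path :: "nat \<Rightarrow> real \<Rightarrow> real set \<Rightarrow> (real \<Rightarrow> tensor2) \<Rightarrow> bool" where
  "metric_path k \<alpha> I \<gamma> \<longleftrightarrow>
     (\<forall>s\<in>I. \<gamma> s \<in> metrics k \<alpha> \<and>
        ((\<lambda>t. tensor_norm k \<alpha> (\<lambda>x v w. \<gamma> t x v w - \<gamma> s x v w)) \<longlongrightarrow> 0) (at s within I))"

definition has_path_derivative :: "nat \<Rightarrow> real \<Rightarrow> (real \<Rightarrow> tensor2) \<Rightarrow> tensor2 \<Rightarrow> real \<Rightarrow> bool" where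
  "has_path_derivative k \<alpha> \<gamma> h s \<longleftrightarrow> h \<in> tensors k \<alpha> \<and>
     ((\<lambda>t. tensor_norm k \<alpha> (\<lambda>x v w. (\<gamma> t x v w - \<gamma> s x v w) / (t - s) - h x v w)) \<longlongrightarrow> 0) (at s)"

section \<open>Riemannian geometry in the frame\<close>

text \<open>Below \<open>G\<close> is the component matrix of a metric, \<open>H\<close> that of a symmetric 2-tensor, and \<open>\<omega>\<close>
  the component vector of a 1-form.\<close>

definition ginv :: "(real^4 \<Rightarrow> real^3^3) \<Rightarrow> real^4 \<Rightarrow> real^3^3" where
  "ginv G x = matrix_inv (G x)"

text \<open>\<open>koszul G i j k\<close> is twice \<open>g (\<nabla>_{E_i} E_j, E_k)\<close> and \<open>christoffel G i j l\<close> is the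
  \<open>E_l\<close>-coefficient of \<open>\<nabla>_{E_i} E_j\<close>, for the Levi-Civita connection.\<close>

definition koszul :: "(real^4 \<Rightarrow> real^3^3) \<Rightarrow> 3 \<Rightarrow> 3 \<Rightarrow> 3 \<Rightarrow> real^4 \<Rightarrow> real" where
  "koszul G i j k x =
     fderiv i (\<lambda>y. G y $ j $ k) x + fderiv j (\<lambda>y. G y $ i $ k) x - fderiv k (\<lambda>y. G y $ i $ j) x
     + (\<Sum>m\<in>UNIV. struct_coeff i j m x * G x $ m $ k - struct_coeff i k m x * G x $ m $ j
                   - struct_coeff j k m x * G x $ m $ i)"

definition christoffel :: "(real^4 \<Rightarrow> real^3^3) \<Rightarrow> 3 \<Rightarrow> 3 \<Rightarrow> 3 \<Rightarrow> real^4 \<Rightarrow> real" where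
  "christoffel G i j l x = (1/2) * (\<Sum>k\<in>UNIV. ginv G x $ l $ k * koszul G i j k x)"

text \<open>\<open>riem G i j k l\<close> is the \<open>E_l\<close>-coefficient of
  \<open>\<nabla>_{E_i} \<nabla>_{E_j} E_k - \<nabla>_{E_j} \<nabla>_{E_i} E_k - \<nabla>_{[E_i, E_j]} E_k\<close>.\<close>

definition riem :: "(real^4 \<Rightarrow> real^3^3) \<Rightarrow> 3 \<Rightarrow> 3 \<Rightarrow> 3 \<Rightarrow> 3 \<Rightarrow> real^4 \<Rightarrow> real" where
  "riem G i j k l x =
     fderiv i (christoffel G j k l) x - fderiv j (christoffel G i k l) x
     + (\<Sum>m\<in>UNIV. christoffel G j k m x * christoffel G i m l x
                   - christoffel G i k m x * christoffel G j m l x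
                   - struct_coeff i j m x * christoffel G m k l x)"

definition ric :: "(real^4 \<Rightarrow> real^3^3) \<Rightarrow> real^4 \<Rightarrow> real^3^3" where
  "ric G x = (\<chi> j k. \<Sum>i\<in>UNIV. riem G i j k i x)"

definition tr_g :: "(real^4 \<Rightarrow> real^3^3) \<Rightarrow> (real^4 \<Rightarrow> real^3^3) \<Rightarrow> real^4 \<Rightarrow> real" where
  "tr_g G H x = (\<Sum>i\<in>UNIV. \<Sum>j\<in>UNIV. ginv G x $ i $ j * H x $ i $ j)"

definition inner_g ::
  "(real^4 \<Rightarrow> real^3^3) \<Rightarrow> (real^4 \<Rightarrow> real^3^3) \<Rightarrow> (real^4 \<Rightarrow> real^3^3) \<Rightarrow> real^4 \<Rightarrow> real" where
  "inner_g G H K x =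
     (\<Sum>i\<in>UNIV. \<Sum>j\<in>UNIV. \<Sum>k\<in>UNIV. \<Sum>l\<in>UNIV.
        ginv G x $ i $ k * ginv G x $ j $ l * H x $ i $ j * K x $ k $ l)"

definition scal :: "(real^4 \<Rightarrow> real^3^3) \<Rightarrow> real^4 \<Rightarrow> real" where
  "scal G = tr_g G (ric G)"

text \<open>The integral of \<open>f\<close> over the unit sphere of \<open>\<real>^4\<close> with respect to surface measure is \<open>4\<close>
  times the integral of \<open>y \<mapsto> f (y / |y|)\<close> over the unit ball (polar coordinates).  As the frame is
  orthonormal for the round metric, the volume form of \<open>g\<close> has density \<open>sqrt (det G)\<close>.\<close>

definition sphere_integral :: "(real^4 \<Rightarrow> real) \<Rightarrow> real" where
  "sphere_integral f = 4 * (LINT y:ball 0 1|lborel. f (y /\<^sub>R norm y))"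

definition integral_g :: "(real^4 \<Rightarrow> real^3^3) \<Rightarrow> (real^4 \<Rightarrow> real) \<Rightarrow> real" where
  "integral_g G f = sphere_integral (\<lambda>x. f x * sqrt (det (G x)))"

definition vol :: "tensor2 \<Rightarrow> real" where
  "vol g = integral_g (comps g) (\<lambda>x. 1)"

definition F_third :: "tensor2 \<Rightarrow> real" where
  "F_third g = (let G = comps g in
     vol g powr (1/3) *
       (integral_g G (inner_g G (ric G) (ric G)) + (1/3) * integral_g G (\<lambda>x. (scal G x)\<^sup>2)))"

text \<open>Covariant derivatives: \<open>nabla1 G \<omega> i j\<close> is \<open>\<nabla>_i \<omega>_j\<close>, and \<open>nabla2 G H k i j\<close> is \<open>\<nabla>_k H_ij\<close>.\<close>

definition nabla1 :: "(real^4 \<Rightarrow> real^3^3) \<Rightarrow> (real^4 \<Rightarrow> real^3) \<Rightarrow> 3 \<Rightarrow> 3 \<Rightarrow> real^4 \<Rightarrow> real" where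
  "nabla1 G \<omega> i j x =
     fderiv i (\<lambda>y. \<omega> y $ j) x - (\<Sum>l\<in>UNIV. christoffel G i j l x * \<omega> x $ l)"

definition nabla2 ::
  "(real^4 \<Rightarrow> real^3^3) \<Rightarrow> (real^4 \<Rightarrow> real^3^3) \<Rightarrow> 3 \<Rightarrow> 3 \<Rightarrow> 3 \<Rightarrow> real^4 \<Rightarrow> real" where
  "nabla2 G H k i j x =
     fderiv k (\<lambda>y. H y $ i $ j) x
     - (\<Sum>l\<in>UNIV. christoffel G k i l x * H x $ l $ j + christoffel G k j l x * H x $ i $ l)"

definition delta_g :: "(real^4 \<Rightarrow> real^3^3) \<Rightarrow> (real^4 \<Rightarrow> real^3^3) \<Rightarrow> real^4 \<Rightarrow> real^3" where
  "delta_g G H x = (\<chi> j. \<Sum>i\<in>UNIV. \<Sum>k\<in>UNIV. ginv G x $ i $ k * nabla2 G H k i j x)"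

definition beta_g :: "(real^4 \<Rightarrow> real^3^3) \<Rightarrow> (real^4 \<Rightarrow> real^3^3) \<Rightarrow> real^4 \<Rightarrow> real^3" where
  "beta_g G H x = (\<chi> j. delta_g G H x $ j - (1/3) * fderiv j (tr_g G H) x)"

definition div_g :: "(real^4 \<Rightarrow> real^3^3) \<Rightarrow> (real^4 \<Rightarrow> real^3) \<Rightarrow> real^4 \<Rightarrow> real" where
  "div_g G \<omega> x = (\<Sum>i\<in>UNIV. \<Sum>k\<in>UNIV. ginv G x $ i $ k * nabla1 G \<omega> i k x)"

definition killing_g :: "(real^4 \<Rightarrow> real^3^3) \<Rightarrow> (real^4 \<Rightarrow> real^3) \<Rightarrow> real^4 \<Rightarrow> real^3^3" where
  "killing_g G \<omega> x =
     (\<chi> i j. nabla1 G \<omega> i j x + nabla1 G \<omega> j i x - (2/3) * div_g G \<omega> x * G x $ i $ j)"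

section \<open>Critical metrics, local minimizers, infinitesimal deformations\<close>

text \<open>\<open>is_gradient \<alpha> g T\<close>: the continuous symmetric tensor \<open>T\<close> is the gradient of the functional at
  \<open>g\<close>.  It is determined by \<open>g\<close> (on tangent vectors of the sphere).\<close>

definition is_gradient :: "real \<Rightarrow> tensor2 \<Rightarrow> tensor2 \<Rightarrow> bool" where
  "is_gradient \<alpha> g T \<longleftrightarrow> g \<in> metrics 4 \<alpha> \<and> sym_tensor T \<and> (\<forall>i j. Ck 0 (\<lambda>x. comps T x $ i $ j)) \<and>
     (\<forall>\<gamma> h \<epsilon>. \<epsilon> > 0 \<and> metric_path 4 \<alpha> {-\<epsilon><..<\<epsilon>} \<gamma> \<and> \<gamma> 0 = g \<and> has_path_derivative 4 \<alpha> \<gamma> h 0 \<longrightarrow>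
        ((\<lambda>s. F_third (\<gamma> s)) has_real_derivative
           integral_g (comps g) (inner_g (comps g) (comps T) (comps h))) (at 0))"

definition critical :: "real \<Rightarrow> tensor2 \<Rightarrow> bool" where
  "critical \<alpha> g \<longleftrightarrow> (\<exists>T. is_gradient \<alpha> g T \<and> tensor_zero T)"

text \<open>\<open>L\<close> is the derivative at \<open>s = 0\<close> of the gradient at \<open>g + s h\<close>; existence of these gradients
  and of the derivative is part of the definition.\<close>

definition is_linearized_gradient :: "real \<Rightarrow> tensor2 \<Rightarrow> tensor2 \<Rightarrow> tensor2 \<Rightarrow> bool" where
  "is_linearized_gradient \<alpha> g h L \<longleftrightarrow>
     (\<exists>T. (\<forall>\<^sub>F s in nhds 0. is_gradient \<alpha> (\<lambda>x v w. g x v w + s * h x v w) (T s)) \<and>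
        (\<forall>x\<in>S3. \<forall>v\<in>tangent x. \<forall>w\<in>tangent x.
           ((\<lambda>s. T s x v w) has_real_derivative L x v w) (at 0)))"

definition local_minimizer :: "real \<Rightarrow> tensor2 \<Rightarrow> bool" where
  "local_minimizer \<alpha> g \<longleftrightarrow>
     (\<exists>\<epsilon>>0. \<forall>g'\<in>metrics 2 \<alpha>.
        tensor_norm 2 \<alpha> (\<lambda>x v w. g' x v w - g x v w) < \<epsilon> \<longrightarrow> F_third g' \<ge> F_third g)"

definition H1_third :: "real \<Rightarrow> tensor2 \<Rightarrow> tensor2 set" where
  "H1_third \<alpha> g = {h \<in> tensors 4 \<alpha>.
     integral_g (comps g) (tr_g (comps g) (comps h)) = 0 \<and>
     (\<exists>L. is_linearized_gradient \<alpha> g h L \<and>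
        (\<forall>x\<in>S3. comps L x
           + (1/2) *\<^sub>R killing_g (comps g) (beta_g (comps g)
               (killing_g (comps g) (beta_g (comps g) (comps h)))) x = 0))}"

definition transverse_traceless :: "tensor2 \<Rightarrow> tensor2 \<Rightarrow> bool" where
  "transverse_traceless g h \<longleftrightarrow>
     (\<forall>x\<in>S3. delta_g (comps g) (comps h) x = 0 \<and> tr_g (comps g) (comps h) x = 0)"

definition integrable_deformation :: "real \<Rightarrow> tensor2 \<Rightarrow> tensor2 \<Rightarrow> bool" where
  "integrable_deformation \<alpha> g h \<longleftrightarrow>
     (\<exists>\<gamma> \<epsilon>. \<epsilon> > 0 \<and> metric_path 4 \<alpha> {-\<epsilon><..<\<epsilon>} \<gamma> \<and> (\<forall>s\<in>{-\<epsilon><..<\<epsilon>}. critical \<alpha> (\<gamma> s)) \<and>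
        \<gamma> 0 = g \<and> has_path_derivative 4 \<alpha> \<gamma> h 0)"

section \<open>Sanity checks\<close>

lemma frame_tangent: "frame i x \<in> tangent x"
  using exhaust_3[of i]
  by (auto simp: frame_def tangent_def inner_vec_def sum_4 vector_def algebra_simps)

lemma norm_S3: "x \<in> S3 \<longleftrightarrow> (x$1)\<^sup>2 + (x$2)\<^sup>2 + (x$3)\<^sup>2 + (x$4)\<^sup>2 = 1"
  by (simp add: norm_eq_1 inner_vec_def sum_4 power2_eq_square)

lemma frame_orthonormal:
  assumes "x \<in> S3" shows "frame i x \<bullet> frame j x = (if i = j then 1 else 0)"
  using assms exhaust_3[of i] exhaust_3[of j] unfolding norm_S3
  by (auto simp: frame_def inner_vec_def sum_4 vector_def power2_eq_square algebra_simps)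

lemma frame_linear: "linear (frame i)"
  using exhaust_3[of i]
  by (auto intro!: linearI simp: frame_def vec_eq_iff forall_4 vector_def algebra_simps)

lemma frame_bracket_eq: "frame_bracket i j x = frame j (frame i x) - frame i (frame j x)"
proof -
  have "(frame i has_derivative frame i) (at x)" for i
    using frame_linear linear_conv_bounded_linear bounded_linear_imp_has_derivative by blast
  then have "frechet_derivative (frame i) (at x) = frame i" for i
    by (metis frechet_derivative_at)
  then show ?thesis by (simp add: frame_bracket_def)
qed

lemma frame_bracket_values:
  "frame_bracket 1 2 x = 2 *\<^sub>R frame 3 x"
  "frame_bracket 2 3 x = 2 *\<^sub>R frame 1 x"
  "frame_bracket 3 1 x = 2 *\<^sub>R frame 2 x"
  by (auto simp: frame_bracket_eq frame_def vec_eq_iff forall_4 vector_def)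

lemma frame_bracket_skew: "frame_bracket i j x = - frame_bracket j i x"
  by (simp add: frame_bracket_def)

lemma struct_coeff_values:
  assumes "x \<in> S3"
  shows "struct_coeff i j k x =
    (if (i, j, k) \<in> {(1,2,3), (2,3,1), (3,1,2)} then 2
     else if (i, j, k) \<in> {(2,1,3), (3,2,1), (1,3,2)} then -2 else 0)"
proof -
  have d: "frame_bracket i i x = 0" for i by (simp add: frame_bracket_def)
  note s = frame_bracket_skew[of 2 1] frame_bracket_skew[of 3 2] frame_bracket_skew[of 1 3]
  show ?thesis
    using exhaust_3[of i] exhaust_3[of j] exhaust_3[of k] assms
    by (elim disjE) (simp_all add: struct_coeff_def s d frame_bracket_values frame_orthonormal)
qed

lemma flow_S3:
  assumes "x \<in> S3" shows "flow i t x \<in> S3"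
proof -
  have "x \<bullet> frame i x = 0" using frame_tangent by (simp add: tangent_def)
  then have "flow i t x \<bullet> flow i t x = (cos t)\<^sup>2 + (sin t)\<^sup>2"
    using assms frame_orthonormal[OF assms, of i i]
    by (simp add: flow_def inner_add inner_commute norm_eq_1 power2_eq_square)
  then show ?thesis by (simp add: norm_eq_1)
qed

lemma fderiv_const:
  assumes "\<And>y. y \<in> S3 \<Longrightarrow> f y = c" "x \<in> S3" shows "fderiv i f x = 0"
  using assms flow_S3 by (simp add: fderiv_def)

lemma comps_round:
  assumes "x \<in> S3" shows "comps round_metric x = mat 1"
  by (simp add: comps_def round_metric_def frame_orthonormal[OF assms] vec_eq_iff mat_def)

lemma christoffel_round:
  assumes "x \<in> S3"
  shows "christoffel (comps round_metric) i j l x = (1/2) * struct_coeff i j l x"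
proof -
  have 1: "fderiv a (\<lambda>y. comps round_metric y $ b $ c) x = 0" for a b c
    by (rule fderiv_const[OF _ assms, where c="mat 1 $ b $ c"]) (simp only: comps_round)
  have inv: "ginv (comps round_metric) x = mat 1"
  proof -
    have "\<exists>B. (mat 1 :: real^3^3) ** B = mat 1 \<and> B ** mat 1 = mat 1"
      by (intro exI[of _ "mat 1"]) (simp add: matrix_mul_lid)
    then have "mat 1 ** matrix_inv (mat 1 :: real^3^3) = mat 1"
      unfolding matrix_inv_def by (rule someI2_ex) simp
    then show ?thesis
      by (simp only: matrix_mul_lid ginv_def comps_round[OF assms])
  qed
  show ?thesis
    using exhaust_3[of i] exhaust_3[of j] exhaust_3[of l]
    by (elim disjE) (simp_all add: christoffel_def koszul_def 1 inv comps_round[OF assms] sum_3 mat_def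
        struct_coeff_values[OF assms])
qed

lemma ric_round:
  assumes "x \<in> S3" shows "ric (comps round_metric) x = mat 2"
proof -
  have 1: "fderiv a (christoffel (comps round_metric) b c d) x = 0" for a b c d
  proof (rule fderiv_const[OF _ assms])
    fix y assume "y \<in> S3"
    show "christoffel (comps round_metric) b c d y = christoffel (comps round_metric) b c d x"
      by (simp only: christoffel_round struct_coeff_values \<open>y \<in> S3\<close> assms)
  qed
  show ?thesis
    by (simp add: ric_def riem_def 1 vec_eq_iff forall_3 sum_3 mat_def
        christoffel_round[OF assms] struct_coeff_values[OF assms])
qed

end

theory Submission
  imports Defs
begin

text \<open>
  The left-invariant metrics \<open>diag (a, 1, 1)\<close> have energy proportional to
  \<open>a^(2/3) (5 a^2 - 16 a + 20)\<close>, whose derivative is proportional to \<open>a^(-1/3) (a - 1)^2\<close>: the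
  energy strictly decreases as \<open>a\<close> decreases from \<open>1\<close>, although its second variation vanishes there.

  The integrand of the functional is a smooth function of the 2-jet of the metric in the frame, and
  frame derivatives integrate to zero.  Hence the first variation at a left-invariant metric \<open>G\<close>
  depends only on the mean of the variation, so the gradient at \<open>G\<close> is left-invariant and is computed
  from the energy of constant matrices.  Along \<open>1 + s h\<close> with \<open>h = diag (-2, 1, 1)\<close> it is \<open>O(s^2)\<close>, so
  \<open>h\<close> lies in the kernel.

  Suppose \<open>g_s\<close> are critical with \<open>g_s = g + s h + o(s)\<close>.  The jet of \<open>g_s\<close> deviates from its mean by
  \<open>o(s)\<close>, so replacing \<open>g_s\<close> by its mean \<open>M_s\<close>, a constant matrix, changes the first variation in
  direction \<open>h\<close> only by \<open>o(s^2)\<close>.  But at \<open>M_s = 1 + s h + o(s)\<close> that first variation is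
  \<open>c s^2 + o(s^2)\<close> with \<open>c \<noteq> 0\<close>, because the cubic term of the energy in direction \<open>h\<close> does not vanish.
\<close>



section \<open>Integration over the sphere\<close>

text \<open>The curve of critical metrics is known only to first order, as
  \<open>g + s h + o(s)\<close>, while the contradiction sits at order \<open>s^2\<close>. Two
  cancellations make this enough. For the oscillating part, the linear Taylor term about the mean
  integrates to zero, so a deviation \<open>o(s)\<close> costs \<open>o(s^2)\<close>. For the mean,
  the Hessian of the energy on constant matrices pairs \<open>h\<close> to zero with every constant
  matrix, so an unknown \<open>o(s)\<close> in \<open>M_s\<close> also costs \<open>o(s^2)\<close>.
  The mean of a critical metric may be far from diagonal form, so curvature is computed for every
  symmetric constant matrix, through trace, second invariant and determinant. At general jets no
  explicit derivative of the integrands is written down: they are placed in a class of functions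
  with uniform quadratic Taylor remainder, together with their derivative in the single direction
  \<open>h\<close>, and the abstract derivative is identified only along constant jets. The matrix
  \<open>diag (-2, 1, 1)\<close> is, up to a factor, the trace-free part of the Berger deformation
  \<open>diag (1, 0, 0)\<close>.\<close>

lemma compact_S3: "compact S3" by simp

lemma S3_nonempty: "(axis 1 1 :: real^4) \<in> S3"
  by (simp add: norm_axis_1)

lemma continuous_S3_bounded:
  fixes f :: "real^4 \<Rightarrow> real"
  assumes "continuous_on S3 f"
  obtains C where "C \<ge> 0" "\<And>x. x \<in> S3 \<Longrightarrow> \<bar>f x\<bar> \<le> C"
proof -
  have "bounded (f ` S3)"
    using assms compact_S3 compact_continuous_image compact_imp_bounded by blast
  then obtain C where "\<forall>x\<in>S3. \<bar>f x\<bar> \<le> C"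
    by (auto simp: bounded_iff)
  then show ?thesis
    using that[of "max C 0"] by (metis max.coboundedI1 max.cobounded2)
qed

lemma set_integrable_radial:
  fixes f :: "real^4 \<Rightarrow> real"
  assumes f: "continuous_on S3 f"
  shows "set_integrable lborel (ball 0 1) (\<lambda>y. f (y /\<^sub>R norm y))"
proof -
  obtain C where C: "C \<ge> 0" "\<And>x. x \<in> S3 \<Longrightarrow> \<bar>f x\<bar> \<le> C"
    using continuous_S3_bounded[OF f] by blast
  define D where "D = max C \<bar>f 0\<bar>"
  have S3: "y /\<^sub>R norm y \<in> S3" if "y \<noteq> 0" for y :: "real^4"
    using that by simp
  have "(\<lambda>y::real^4. y /\<^sub>R norm y) ` (ball 0 1 - {0}) \<subseteq> S3"
    using S3 by blast
  moreover have "continuous_on (ball 0 1 - {0}) (\<lambda>y::real^4. y /\<^sub>R norm y)"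
    by (auto intro!: continuous_intros)
  ultimately have "continuous_on (ball 0 1 - {0}) (\<lambda>y::real^4. f (y /\<^sub>R norm y))"
    using continuous_on_compose2[OF f] by blast
  then have m: "(\<lambda>y. indicator (ball 0 1 - {0}) y *\<^sub>R f (y /\<^sub>R norm y)) \<in> borel_measurable borel"
    by (intro borel_measurable_continuous_on_indicator) (auto intro: borel_open)
  have eq: "(\<lambda>y::real^4. indicator (ball 0 1) y *\<^sub>R f (y /\<^sub>R norm y)) =
     (\<lambda>y. indicator (ball 0 1 - {0}) y *\<^sub>R f (y /\<^sub>R norm y) + indicator {0} y *\<^sub>R f 0)"
    by (auto simp: fun_eq_iff indicator_def)
  have m2: "(\<lambda>y. indicator (ball 0 1) y *\<^sub>R f (y /\<^sub>R norm y)) \<in> borel_measurable lborel"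
    unfolding eq using m by measurable
  have "integrable lborel (\<lambda>y::real^4. indicator (ball 0 1) y *\<^sub>R D)"
    by (intro integrable_scaleR_left integrable_real_indicator) (use emeasure_lborel_ball_finite[of "0::real^4" 1] in auto)
  then show ?thesis
    unfolding set_integrable_def
  proof (rule Bochner_Integration.integrable_bound[OF _ m2], intro AE_I2)
    fix y :: "real^4"
    have "\<bar>f (y /\<^sub>R norm y)\<bar> \<le> D"
      using C(2)[OF S3, of y] by (cases "y = 0") (auto simp: D_def)
    then show "norm (indicator (ball 0 1) y *\<^sub>R f (y /\<^sub>R norm y)) \<le> norm (indicator (ball 0 1) y *\<^sub>R D)"
      by (simp add: indicator_def D_def)
  qed
qed

lemma sphere_integral_add:
  assumes "continuous_on S3 f" "continuous_on S3 g"
  shows "sphere_integral (\<lambda>x. f x + g x) = sphere_integral f + sphere_integral g"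
  using set_integral_add(2)[OF set_integrable_radial[OF assms(1)] set_integrable_radial[OF assms(2)]]
  by (simp add: sphere_integral_def)

lemma sphere_integral_cmult: "sphere_integral (\<lambda>x. c * f x) = c * sphere_integral f"
  by (simp add: sphere_integral_def)

lemma sphere_integral_diff:
  assumes "continuous_on S3 f" "continuous_on S3 g"
  shows "sphere_integral (\<lambda>x. f x - g x) = sphere_integral f - sphere_integral g"
  using set_integral_diff(2)[OF set_integrable_radial[OF assms(1)] set_integrable_radial[OF assms(2)]]
  by (simp add: sphere_integral_def)

lemma sphere_integral_cong:
  assumes "continuous_on S3 f" "\<And>x. x \<in> S3 \<Longrightarrow> f x = g x"
  shows "sphere_integral f = sphere_integral g"
proof -
  have g: "continuous_on S3 g"
    using assms continuous_on_cong by blast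
  have "AE y in lborel. indicator (ball 0 1) y *\<^sub>R f (y /\<^sub>R norm y) = indicator (ball 0 1) y *\<^sub>R g (y /\<^sub>R norm y)"
    using AE_lborel_singleton[of 0] by eventually_elim (use assms(2) in auto)
  then show ?thesis
    unfolding sphere_integral_def set_lebesgue_integral_def
    using set_integrable_radial[OF assms(1)] set_integrable_radial[OF g]
    by (subst integral_cong_AE) (auto simp: set_integrable_def)
qed

lemma sphere_integral_mono:
  assumes f: "continuous_on S3 f" and g: "continuous_on S3 g" and le: "\<And>x. x \<in> S3 \<Longrightarrow> f x \<le> g x"
  shows "sphere_integral f \<le> sphere_integral g"
proof -
  have "AE y in lborel. indicator (ball 0 1) y *\<^sub>R f (y /\<^sub>R norm y) \<le> indicator (ball 0 1) y *\<^sub>R g (y /\<^sub>R norm y)"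
    using AE_lborel_singleton[of 0] by eventually_elim (use le in \<open>auto simp: indicator_def\<close>)
  then show ?thesis
    unfolding sphere_integral_def set_lebesgue_integral_def
    using set_integrable_radial[OF f] set_integrable_radial[OF g]
    by (auto intro!: integral_mono_AE simp: set_integrable_def)
qed

definition sphere_area :: real where
  "sphere_area = sphere_integral (\<lambda>x. 1)"

lemma sphere_integral_const: "sphere_integral (\<lambda>x. c) = c * sphere_area"
  using sphere_integral_cmult[of c "\<lambda>x. 1"] by (simp add: sphere_area_def)

lemma sphere_area_pos: "sphere_area > 0"
proof -
  have "measure lborel (ball (0::real^4) 1) > 0"
    by (simp add: content_ball_pos)
  then show ?thesis
    by (simp add: sphere_area_def sphere_integral_def set_lebesgue_integral_def emeasure_lborel_ball_finite)
qed

lemma sphere_integral_abs_le: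
  assumes "continuous_on S3 f" and "\<And>x. x \<in> S3 \<Longrightarrow> \<bar>f x\<bar> \<le> C"
  shows "\<bar>sphere_integral f\<bar> \<le> C * sphere_area"
proof -
  have "sphere_integral f \<le> sphere_integral (\<lambda>x. C)"
    using assms by (intro sphere_integral_mono) (auto simp: abs_le_iff)
  moreover have "sphere_integral (\<lambda>x. - C) \<le> sphere_integral f"
    using assms by (intro sphere_integral_mono) (auto simp: abs_le_iff minus_le_iff)
  ultimately show ?thesis
    by (simp add: sphere_integral_const abs_le_iff minus_le_iff)
qed

lemma sphere_integral_sum:
  assumes "finite A" "\<And>a. a \<in> A \<Longrightarrow> continuous_on S3 (f a)"
  shows "sphere_integral (\<lambda>x. \<Sum>a\<in>A. f a x) = (\<Sum>a\<in>A. sphere_integral (f a))"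
  using assms
proof (induction A rule: finite_induct)
  case empty
  then show ?case using sphere_integral_const[of 0] by simp
next
  case (insert a A)
  then show ?case
    by (simp add: sphere_integral_add continuous_on_sum)
qed

text \<open>An orthogonal map preserves the ball, commutes with the radial projection and has
  determinant of absolute value 1. The change of variables formula is applied to functions into
  \<open>real^1\<close>, hence the detour through \<open>vec\<close>.\<close>

lemma sphere_integral_orthogonal:
  assumes f: "continuous_on S3 f" and T: "orthogonal_transformation T"
  shows "sphere_integral (\<lambda>x. f (T x)) = sphere_integral f"
proof -
  have lin: "linear T" and nT: "norm (T y) = norm y" for y
    using T by (simp_all add: orthogonal_transformation_linear orthogonal_transformation_norm)
  have cT: "continuous_on S3 T" by (simp add: lin linear_continuous_on linear_linear)
  have fT: "continuous_on S3 (\<lambda>x. f (T x))"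
    by (rule continuous_on_compose2[OF f cT]) (simp add: nT image_subset_iff)
  define F where "F = (\<lambda>y::real^4. vec (f (y /\<^sub>R norm y)) :: real^1)"
  have vec1: "bounded_linear (vec :: real \<Rightarrow> real^1)"
    unfolding linear_conv_bounded_linear[symmetric] by (auto intro!: linearI simp: vec_eq_iff)
  have *: "(\<lambda>y. vec (g (y /\<^sub>R norm y)) :: real^1) absolutely_integrable_on ball 0 1
     \<and> sphere_integral g = 4 * (integral (ball 0 1) (\<lambda>y. vec (g (y /\<^sub>R norm y)) :: real^1) $ 1)"
    if g: "continuous_on S3 g" for g
  proof -
    have gi: "set_integrable lborel (ball 0 1) (\<lambda>y. g (y /\<^sub>R norm y))"
      by (rule set_integrable_radial[OF g])
    have "set_integrable lebesgue (ball 0 1) (\<lambda>y. g (y /\<^sub>R norm y))"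
      using gi unfolding set_integrable_def by (simp add: integrable_completion)
    from absolutely_integrable_linear[OF this vec1]
    have 1: "(\<lambda>y. vec (g (y /\<^sub>R norm y)) :: real^1) absolutely_integrable_on ball 0 1"
      by (simp add: o_def)
    then have "(\<lambda>y. vec (g (y /\<^sub>R norm y)) :: real^1) integrable_on ball 0 1"
      using set_lebesgue_integral_eq_integral(1) by blast
    from integral_component_eq_cart[OF this, of 1]
    show ?thesis using 1 set_borel_integral_eq_integral(2)[OF gi]
      by (simp add: sphere_integral_def)
  qed
  have FT: "F \<circ> T = (\<lambda>y. vec (f (T (y /\<^sub>R norm y))))"
    by (auto simp: F_def fun_eq_iff nT linear_cmul[OF lin])
  have "integral (T ` ball 0 1) F = \<bar>det (matrix T)\<bar> *\<^sub>R integral (ball 0 1) (F \<circ> T)"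
    using *[OF fT] FT by (intro integral_change_of_variables_linear[OF lin]) auto
  moreover have "T ` ball 0 1 = ball 0 1"
    using image_orthogonal_transformation_ball[OF T, of 0 1] linear_0[OF lin] by simp
  moreover have "\<bar>det (matrix T)\<bar> = 1"
    using T orthogonal_transformation_det by blast
  ultimately have "integral (ball 0 1) F = integral (ball 0 1) (F \<circ> T)" by simp
  then show ?thesis using *[OF f] *[OF fT] FT by (simp add: F_def)
qed

section \<open>Flows of the frame fields and the divergence theorem\<close>

lemma linear_flow: "linear (flow i t)"
  by (auto intro!: linearI simp: flow_def linear_add[OF frame_linear] linear_cmul[OF frame_linear] algebra_simps)

lemma frame_norm: "norm (frame i x) = norm x"
  using exhaust_3[of i]
  by (auto simp: frame_def norm_eq_sqrt_inner inner_vec_def sum_4 vector_def)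

lemma flow_orthogonal: "orthogonal_transformation (flow i t)"
  unfolding orthogonal_transformation
proof (intro conjI allI linear_flow)
  fix x
  have o: "x \<bullet> frame i x = 0" using frame_tangent by (simp add: tangent_def)
  have n: "frame i x \<bullet> frame i x = x \<bullet> x"
    using frame_norm[of i x] by (simp add: norm_eq_sqrt_inner)
  have "flow i t x \<bullet> flow i t x = ((cos t)\<^sup>2 + (sin t)\<^sup>2) * (x \<bullet> x)"
    unfolding flow_def power2_eq_square using o
    by (simp add: inner_add_left inner_add_right n inner_commute distrib_right del: sin_cos_squared_add3)
  then show "norm (flow i t x) = norm x" by (simp add: norm_eq_sqrt_inner)
qed

text \<open>\<open>frame i\<close> is right multiplication by a unit imaginary quaternion, whose
  square is -1. This turns the addition formulas of sine and cosine into the group law of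
  \<open>flow i\<close>.\<close>

lemma frame_frame: "frame i (frame i x) = - x"
  using exhaust_3[of i] by (auto simp: frame_def vec_eq_iff forall_4 vector_def)

lemma flow_add: "flow i (t + u) x = flow i u (flow i t x)"
proof -
  have "flow i u (flow i t x) = (cos u * cos t) *\<^sub>R x + (cos u * sin t) *\<^sub>R frame i x
      + (sin u * cos t) *\<^sub>R frame i x + (sin u * sin t) *\<^sub>R frame i (frame i x)"
    by (simp add: flow_def linear_add[OF frame_linear] linear_cmul[OF frame_linear] algebra_simps)
  then show ?thesis
    by (simp add: flow_def frame_frame cos_add sin_add algebra_simps)
qed

lemma flow_0 [simp]: "flow i 0 x = x" by (simp add: flow_def)

lemma has_derivative_flow:
  assumes "\<And>x. x \<in> S3 \<Longrightarrow> (\<lambda>t. f (flow i t x)) differentiable at 0" "x \<in> S3"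
  shows "((\<lambda>t. f (flow i t x)) has_real_derivative fderiv i f (flow i t x)) (at t)"
proof -
  have "((\<lambda>u. f (flow i u (flow i t x))) has_real_derivative fderiv i f (flow i t x)) (at 0)"
    using assms(1)[OF flow_S3[OF assms(2)]] unfolding fderiv_def
    by (simp add: DERIV_deriv_iff_real_differentiable)
  then have "((\<lambda>u. f (flow i (t + u) x)) has_real_derivative fderiv i f (flow i t x)) (at 0)"
    by (simp add: flow_add)
  then show ?thesis
    using DERIV_shift[of "\<lambda>u. f (flow i u x)" _ 0 t] by (simp add: add.commute)
qed

text \<open>The flow preserves the integral, so the difference of \<open>f\<close> along the flow
  for time \<open>t\<close> integrates to zero. By the mean value theorem and uniform continuity of
  the derivative on the compact sphere, this difference is \<open>t * fderiv i f\<close> up to a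
  uniform error \<open>t * e\<close>.\<close>

lemma sphere_integral_fderiv:
  assumes f: "continuous_on S3 f" and df: "\<And>x. x \<in> S3 \<Longrightarrow> (\<lambda>t. f (flow i t x)) differentiable at 0"
    and c: "continuous_on S3 (fderiv i f)"
  shows "sphere_integral (fderiv i f) = 0"
proof -
  have "\<bar>sphere_integral (fderiv i f)\<bar> \<le> e * sphere_area" if "e > 0" for e
  proof -
    from compact_uniformly_continuous[OF c compact_S3] \<open>e > 0\<close>
    obtain d where d: "d > 0" "\<And>x y. x \<in> S3 \<Longrightarrow> y \<in> S3 \<Longrightarrow> dist y x < d \<Longrightarrow>
       dist (fderiv i f y) (fderiv i f x) < e"
      unfolding uniformly_continuous_on_def by metis
    have "((\<lambda>t::real. \<bar>cos t - 1\<bar> + \<bar>sin t\<bar>) \<longlongrightarrow> \<bar>cos 0 - 1\<bar> + \<bar>sin 0\<bar>) (at 0)"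
      by (intro tendsto_intros)
    then have "\<forall>\<^sub>F t::real in at 0. \<bar>cos t - 1\<bar> + \<bar>sin t\<bar> < d"
      using d(1) by (auto dest: order_tendstoD)
    then obtain r where r: "r > 0" "\<And>t::real. t \<noteq> 0 \<Longrightarrow> \<bar>t\<bar> < r \<Longrightarrow> \<bar>cos t - 1\<bar> + \<bar>sin t\<bar> < d"
      by (auto simp: eventually_at dist_real_def)
    define t where "t = r / 2"
    have t: "t > 0" "t < r" using r(1) by (auto simp: t_def)
    have near: "dist (flow i u x) x < d" if "x \<in> S3" "0 < u" "u < r" for u x
    proof -
      have "dist (flow i u x) x = norm ((cos u - 1) *\<^sub>R x + sin u *\<^sub>R frame i x)"
        by (simp add: dist_norm flow_def algebra_simps)
      also have "\<dots> \<le> \<bar>cos u - 1\<bar> + \<bar>sin u\<bar>"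
        using norm_triangle_ineq[of "(cos u - 1) *\<^sub>R x" "sin u *\<^sub>R frame i x"] that
        by (simp add: frame_norm)
      finally show ?thesis using r(2)[of u] that by simp
    qed
    have bd: "\<bar>f (flow i t x) - f x - t * fderiv i f x\<bar> \<le> t * e" if x: "x \<in> S3" for x
    proof -
      obtain z where z: "0 < z" "z < t" "f (flow i t x) - f (flow i 0 x) = (t - 0) * fderiv i f (flow i z x)"
        using MVT2[OF t(1), of "\<lambda>u. f (flow i u x)" "\<lambda>u. fderiv i f (flow i u x)"]
          has_derivative_flow[OF df x] by auto
      have "\<bar>fderiv i f (flow i z x) - fderiv i f x\<bar> \<le> e"
        using d(2)[OF x flow_S3[OF x] near[OF x z(1)]] z t by (auto simp: dist_real_def)
      then have "\<bar>t * (fderiv i f (flow i z x) - fderiv i f x)\<bar> \<le> t * e"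
        using t by (simp add: abs_mult)
      then show ?thesis using z(3) by (simp add: right_diff_distrib)
    qed
    have cf: "continuous_on S3 (\<lambda>x. f (flow i t x))"
      by (rule continuous_on_compose2[OF f])
        (use flow_S3 in \<open>auto simp: linear_continuous_on linear_linear linear_flow\<close>)
    have "\<bar>sphere_integral (\<lambda>x. f (flow i t x) - f x - t * fderiv i f x)\<bar> \<le> t * e * sphere_area"
      by (rule sphere_integral_abs_le) (use bd in \<open>auto intro!: continuous_intros cf f c\<close>)
    also have "sphere_integral (\<lambda>x. f (flow i t x) - f x - t * fderiv i f x) = - (t * sphere_integral (fderiv i f))"
      by (subst sphere_integral_diff sphere_integral_diff[OF cf f],
          auto intro!: continuous_intros cf f c simp: sphere_integral_cmult sphere_integral_diff[OF cf f]
           sphere_integral_orthogonal[OF f flow_orthogonal])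
    finally show ?thesis using t by (simp add: abs_mult)
  qed
  note b = this
  have "\<bar>sphere_integral (fderiv i f)\<bar> \<le> 0 + e" if "e > 0" for e
    using b[of "e / sphere_area"] that sphere_area_pos by simp
  then have "\<bar>sphere_integral (fderiv i f)\<bar> \<le> 0" by (rule field_le_epsilon)
  then show ?thesis by simp
qed


section \<open>Functions with quadratically small first order Taylor remainder\<close>

text \<open>One constant serves all pairs of points of \<open>\<Omega>\<close>, without reference to
  the segment between them; closure under products, inverses and square roots is then pure algebra
  on remainders. The bounds on \<open>p\<close> and \<open>D\<close> themselves are what the product
  rule consumes.\<close>

definition C11_on :: "'a::real_normed_vector set \<Rightarrow> ('a \<Rightarrow> real) \<Rightarrow> ('a \<Rightarrow> 'a \<Rightarrow> real) \<Rightarrow> bool" where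
  "C11_on \<Omega> p D \<longleftrightarrow> (\<forall>x\<in>\<Omega>. linear (D x)) \<and>
     (\<exists>C\<ge>0. \<forall>x\<in>\<Omega>. \<bar>p x\<bar> \<le> C \<and> (\<forall>v. \<bar>D x v\<bar> \<le> C * norm v) \<and>
        (\<forall>y\<in>\<Omega>. \<bar>p y - p x\<bar> \<le> C * norm (y - x) \<and>
                \<bar>p y - p x - D x (y - x)\<bar> \<le> C * (norm (y - x))\<^sup>2))"

lemma C11_onI:
  assumes "\<And>x. x \<in> \<Omega> \<Longrightarrow> linear (D x)"
    and "\<And>x. x \<in> \<Omega> \<Longrightarrow> \<bar>p x\<bar> \<le> C1"
    and "\<And>x v. x \<in> \<Omega> \<Longrightarrow> \<bar>D x v\<bar> \<le> C2 * norm v"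
    and "\<And>x y. x \<in> \<Omega> \<Longrightarrow> y \<in> \<Omega> \<Longrightarrow> \<bar>p y - p x\<bar> \<le> C3 * norm (y - x)"
    and "\<And>x y. x \<in> \<Omega> \<Longrightarrow> y \<in> \<Omega> \<Longrightarrow> \<bar>p y - p x - D x (y - x)\<bar> \<le> C4 * (norm (y - x))\<^sup>2"
  shows "C11_on \<Omega> p D"
proof -
  define C where "C = \<bar>C1\<bar> + \<bar>C2\<bar> + \<bar>C3\<bar> + \<bar>C4\<bar>"
  have le: "C1 \<le> C" "C2 \<le> C" "C3 \<le> C" "C4 \<le> C" by (auto simp: C_def)
  have "C \<ge> 0" by (simp add: C_def)
  have up: "t \<le> C * s" if "t \<le> c * s" "c \<le> C" "s \<ge> 0" for t c s
    using that by (meson mult_right_mono order_trans)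
  show ?thesis
    unfolding C11_on_def
  proof (intro conjI exI[of _ C] ballI allI)
    fix x y v assume x: "x \<in> \<Omega>" and y: "y \<in> \<Omega>"
    show "\<bar>p y - p x\<bar> \<le> C * norm (y - x)" by (rule up[OF assms(4)[OF x y] le(3)]) simp
    show "\<bar>p y - p x - D x (y - x)\<bar> \<le> C * (norm (y - x))\<^sup>2" by (rule up[OF assms(5)[OF x y] le(4)]) simp
  next
    fix x v assume x: "x \<in> \<Omega>"
    show "\<bar>D x v\<bar> \<le> C * norm v" by (rule up[OF assms(3)[OF x] le(2)]) simp
    show "\<bar>p x\<bar> \<le> C" using assms(2)[OF x] le(1) by simp
  qed (use \<open>C \<ge> 0\<close> assms(1) in auto)
qed

lemma C11_onE:
  assumes "C11_on \<Omega> p D"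
  obtains C where "C \<ge> 0" and "\<And>x. x \<in> \<Omega> \<Longrightarrow> linear (D x)"
    and "\<And>x. x \<in> \<Omega> \<Longrightarrow> \<bar>p x\<bar> \<le> C"
    and "\<And>x v. x \<in> \<Omega> \<Longrightarrow> \<bar>D x v\<bar> \<le> C * norm v"
    and "\<And>x y. x \<in> \<Omega> \<Longrightarrow> y \<in> \<Omega> \<Longrightarrow> \<bar>p y - p x\<bar> \<le> C * norm (y - x)"
    and "\<And>x y. x \<in> \<Omega> \<Longrightarrow> y \<in> \<Omega> \<Longrightarrow> \<bar>p y - p x - D x (y - x)\<bar> \<le> C * (norm (y - x))\<^sup>2"
  using assms unfolding C11_on_def by blast

lemma linear_real_cmult: "linear (D :: 'a::real_vector \<Rightarrow> real) \<Longrightarrow> linear (\<lambda>v. c * D v)"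
  using linear_compose_scale_right[of D c] by simp

lemma C11_on_const: "C11_on \<Omega> (\<lambda>x. c) (\<lambda>x v. 0)"
  by (rule C11_onI[of _ _ _ "\<bar>c\<bar>" 0 0 0]) (auto simp: linear_zero)

lemma C11_on_linear:
  assumes "bounded \<Omega>" "bounded_linear l"
  shows "C11_on \<Omega> l (\<lambda>x. l)"
proof -
  obtain R where R: "\<And>x. x \<in> \<Omega> \<Longrightarrow> norm x \<le> R"
    using assms(1) by (auto simp: bounded_iff)
  obtain K where K: "K > 0" "\<And>v. \<bar>l v\<bar> \<le> K * norm v"
    using bounded_linear.pos_bounded[OF assms(2)] by (auto simp: mult.commute)
  have lin: "linear l" using assms(2) by (rule bounded_linear.linear)
  show ?thesis
  proof (rule C11_onI[of _ _ _ "K * R" K K 0])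
    fix x assume "x \<in> \<Omega>"
    then show "\<bar>l x\<bar> \<le> K * R"
      using K R by (meson mult_left_mono order_trans less_imp_le)
  qed (use K lin in \<open>auto simp: linear_diff[OF lin, symmetric]\<close>)
qed

lemma C11_on_add:
  assumes "C11_on \<Omega> p D" "C11_on \<Omega> q E"
  shows "C11_on \<Omega> (\<lambda>x. p x + q x) (\<lambda>x v. D x v + E x v)"
proof -
  obtain A where A: "A \<ge> 0" "\<And>x. x \<in> \<Omega> \<Longrightarrow> linear (D x)" "\<And>x. x \<in> \<Omega> \<Longrightarrow> \<bar>p x\<bar> \<le> A"
    "\<And>x v. x \<in> \<Omega> \<Longrightarrow> \<bar>D x v\<bar> \<le> A * norm v"
    "\<And>x y. x \<in> \<Omega> \<Longrightarrow> y \<in> \<Omega> \<Longrightarrow> \<bar>p y - p x\<bar> \<le> A * norm (y - x)"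
    "\<And>x y. x \<in> \<Omega> \<Longrightarrow> y \<in> \<Omega> \<Longrightarrow> \<bar>p y - p x - D x (y - x)\<bar> \<le> A * (norm (y - x))\<^sup>2"
    using C11_onE[OF assms(1)] by blast
  obtain B where B: "B \<ge> 0" "\<And>x. x \<in> \<Omega> \<Longrightarrow> linear (E x)" "\<And>x. x \<in> \<Omega> \<Longrightarrow> \<bar>q x\<bar> \<le> B"
    "\<And>x v. x \<in> \<Omega> \<Longrightarrow> \<bar>E x v\<bar> \<le> B * norm v"
    "\<And>x y. x \<in> \<Omega> \<Longrightarrow> y \<in> \<Omega> \<Longrightarrow> \<bar>q y - q x\<bar> \<le> B * norm (y - x)"
    "\<And>x y. x \<in> \<Omega> \<Longrightarrow> y \<in> \<Omega> \<Longrightarrow> \<bar>q y - q x - E x (y - x)\<bar> \<le> B * (norm (y - x))\<^sup>2"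
    using C11_onE[OF assms(2)] by blast
  show ?thesis
  proof (rule C11_onI[of _ _ _ "A + B" "A + B" "A + B" "A + B"])
    fix x assume x: "x \<in> \<Omega>"
    show "linear (\<lambda>v. D x v + E x v)" using A(2) B(2) x by (simp add: linear_compose_add)
    show "\<bar>p x + q x\<bar> \<le> A + B" using A(3)[OF x] B(3)[OF x] by linarith
    show "\<bar>D x v + E x v\<bar> \<le> (A + B) * norm v" for v
      using A(4)[OF x, of v] B(4)[OF x, of v] by (simp add: distrib_right)
    fix y assume y: "y \<in> \<Omega>"
    show "\<bar>p y + q y - (p x + q x)\<bar> \<le> (A + B) * norm (y - x)"
      using A(5)[OF x y] B(5)[OF x y] by (simp add: distrib_right)
    show "\<bar>p y + q y - (p x + q x) - (D x (y - x) + E x (y - x))\<bar> \<le> (A + B) * (norm (y - x))\<^sup>2"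
      using A(6)[OF x y] B(6)[OF x y] by (simp add: distrib_right)
  qed
qed

lemma C11_on_mult:
  assumes "C11_on \<Omega> p D" "C11_on \<Omega> q E"
  shows "C11_on \<Omega> (\<lambda>x. p x * q x) (\<lambda>x v. p x * E x v + q x * D x v)"
proof -
  obtain A where A: "A \<ge> 0" "\<And>x. x \<in> \<Omega> \<Longrightarrow> linear (D x)" "\<And>x. x \<in> \<Omega> \<Longrightarrow> \<bar>p x\<bar> \<le> A"
    "\<And>x v. x \<in> \<Omega> \<Longrightarrow> \<bar>D x v\<bar> \<le> A * norm v"
    "\<And>x y. x \<in> \<Omega> \<Longrightarrow> y \<in> \<Omega> \<Longrightarrow> \<bar>p y - p x\<bar> \<le> A * norm (y - x)"
    "\<And>x y. x \<in> \<Omega> \<Longrightarrow> y \<in> \<Omega> \<Longrightarrow> \<bar>p y - p x - D x (y - x)\<bar> \<le> A * (norm (y - x))\<^sup>2"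
    using C11_onE[OF assms(1)] by blast
  obtain B where B: "B \<ge> 0" "\<And>x. x \<in> \<Omega> \<Longrightarrow> linear (E x)" "\<And>x. x \<in> \<Omega> \<Longrightarrow> \<bar>q x\<bar> \<le> B"
    "\<And>x v. x \<in> \<Omega> \<Longrightarrow> \<bar>E x v\<bar> \<le> B * norm v"
    "\<And>x y. x \<in> \<Omega> \<Longrightarrow> y \<in> \<Omega> \<Longrightarrow> \<bar>q y - q x\<bar> \<le> B * norm (y - x)"
    "\<And>x y. x \<in> \<Omega> \<Longrightarrow> y \<in> \<Omega> \<Longrightarrow> \<bar>q y - q x - E x (y - x)\<bar> \<le> B * (norm (y - x))\<^sup>2"
    using C11_onE[OF assms(2)] by blast
  have prod: "\<bar>a * b\<bar> \<le> s * t" if "\<bar>a\<bar> \<le> s" "\<bar>b\<bar> \<le> t" for a b s t :: real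
    using that by (simp add: abs_mult mult_mono')
  show ?thesis
  proof (rule C11_onI[of _ _ _ "A * B" "A * B + B * A" "A * B + B * A" "A * B + A * B + B * A"])
    fix x assume x: "x \<in> \<Omega>"
    show "linear (\<lambda>v. p x * E x v + q x * D x v)"
      using A(2) B(2) x by (simp add: linear_compose_add linear_real_cmult)
    show "\<bar>p x * q x\<bar> \<le> A * B" using prod[OF A(3)[OF x] B(3)[OF x]] .
    show "\<bar>p x * E x v + q x * D x v\<bar> \<le> (A * B + B * A) * norm v" for v
      using prod[OF A(3)[OF x] B(4)[OF x, of v]] prod[OF B(3)[OF x] A(4)[OF x, of v]]
      by (simp add: algebra_simps)
    fix y assume y: "y \<in> \<Omega>"
    have "p y * q y - p x * q x = p y * (q y - q x) + q x * (p y - p x)"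
      by (simp add: algebra_simps)
    then show "\<bar>p y * q y - p x * q x\<bar> \<le> (A * B + B * A) * norm (y - x)"
      using prod[OF A(3)[OF y] B(5)[OF x y]] prod[OF B(3)[OF x] A(5)[OF x y]]
      by (simp add: algebra_simps)
    have e: "p y * q y - p x * q x - (p x * E x (y - x) + q x * D x (y - x)) =
        (p y - p x) * (q y - q x) + p x * (q y - q x - E x (y - x)) + q x * (p y - p x - D x (y - x))"
      by (simp add: algebra_simps)
    show "\<bar>p y * q y - p x * q x - (p x * E x (y - x) + q x * D x (y - x))\<bar>
        \<le> (A * B + A * B + B * A) * (norm (y - x))\<^sup>2"
      unfolding e
      using prod[OF A(5)[OF x y] B(5)[OF x y]] prod[OF A(3)[OF x] B(6)[OF x y]]
        prod[OF B(3)[OF x] A(6)[OF x y]]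
      by (simp add: algebra_simps power2_eq_square)
  qed
qed

lemma C11_on_inverse:
  assumes "C11_on \<Omega> w D" "c > 0" "\<And>x. x \<in> \<Omega> \<Longrightarrow> w x \<ge> c"
  shows "C11_on \<Omega> (\<lambda>x. inverse (w x)) (\<lambda>x v. - (inverse (w x) * (inverse (w x) * D x v)))"
proof -
  obtain A where A: "A \<ge> 0" "\<And>x. x \<in> \<Omega> \<Longrightarrow> linear (D x)" "\<And>x. x \<in> \<Omega> \<Longrightarrow> \<bar>w x\<bar> \<le> A"
    "\<And>x v. x \<in> \<Omega> \<Longrightarrow> \<bar>D x v\<bar> \<le> A * norm v"
    "\<And>x y. x \<in> \<Omega> \<Longrightarrow> y \<in> \<Omega> \<Longrightarrow> \<bar>w y - w x\<bar> \<le> A * norm (y - x)"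
    "\<And>x y. x \<in> \<Omega> \<Longrightarrow> y \<in> \<Omega> \<Longrightarrow> \<bar>w y - w x - D x (y - x)\<bar> \<le> A * (norm (y - x))\<^sup>2"
    using C11_onE[OF assms(1)] by blast
  define k where "k = inverse c"
  have k: "\<bar>inverse (w x)\<bar> \<le> k" if "x \<in> \<Omega>" for x
    using assms(2) assms(3)[OF that] unfolding k_def by (simp add: le_imp_inverse_le)
  have prod: "\<bar>a * b\<bar> \<le> s * t" if "\<bar>a\<bar> \<le> s" "\<bar>b\<bar> \<le> t" for a b s t :: real
    using that by (simp add: abs_mult mult_mono')
  show ?thesis
  proof (rule C11_onI[of _ _ _ k "k * (k * A)" "k * (k * A)" "k * (k * A) + k * (k * (k * (A * A)))"])
    fix x assume x: "x \<in> \<Omega>"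
    have "linear (\<lambda>v. (- inverse (w x) * inverse (w x)) * D x v)"
      using A(2)[OF x] by (rule linear_real_cmult)
    then show "linear (\<lambda>v. - (inverse (w x) * (inverse (w x) * D x v)))"
      by (simp add: algebra_simps)
    show "\<bar>inverse (w x)\<bar> \<le> k" by (rule k[OF x])
    show "\<bar>- (inverse (w x) * (inverse (w x) * D x v))\<bar> \<le> k * (k * A) * norm v" for v
      using prod[OF k[OF x] prod[OF k[OF x] A(4)[OF x, of v]]] by (simp add: algebra_simps)
    fix y assume y: "y \<in> \<Omega>"
    have nz: "w x \<noteq> 0" "w y \<noteq> 0" using assms(2) assms(3)[OF x] assms(3)[OF y] by auto
    have "inverse (w y) - inverse (w x) = - (inverse (w x) * (inverse (w y) * (w y - w x)))"
      using nz by (simp add: field_simps)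
    then show "\<bar>inverse (w y) - inverse (w x)\<bar> \<le> k * (k * A) * norm (y - x)"
      using prod[OF k[OF x] prod[OF k[OF y] A(5)[OF x y]]] by (simp add: algebra_simps)
    \<comment> \<open>With \<open>d = w y - w x\<close> this rests on
      \<open>1 / w y - 1 / w x = - d / (w x)^2 + d^2 / ((w x)^2 * w y)\<close>.\<close>
    have e: "inverse (w y) - inverse (w x) - - (inverse (w x) * (inverse (w x) * D x (y - x))) =
       - (inverse (w x) * (inverse (w x) * (w y - w x - D x (y - x))))
       + inverse (w x) * (inverse (w x) * (inverse (w y) * ((w y - w x) * (w y - w x))))"
      using nz by (simp add: field_simps)
    show "\<bar>inverse (w y) - inverse (w x) - - (inverse (w x) * (inverse (w x) * D x (y - x)))\<bar>
      \<le> (k * (k * A) + k * (k * (k * (A * A)))) * (norm (y - x))\<^sup>2"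
      unfolding e
      using prod[OF k[OF x] prod[OF k[OF x] A(6)[OF x y]]]
        prod[OF k[OF x] prod[OF k[OF x] prod[OF k[OF y] prod[OF A(5)[OF x y] A(5)[OF x y]]]]]
      by (simp add: algebra_simps power2_eq_square)
  qed
qed

lemma C11_on_sqrt:
  assumes "C11_on \<Omega> w D" "c > 0" "\<And>x. x \<in> \<Omega> \<Longrightarrow> w x \<ge> c"
  shows "C11_on \<Omega> (\<lambda>x. sqrt (w x)) (\<lambda>x v. (1/2) * (inverse (sqrt (w x)) * D x v))"
proof -
  obtain A where A: "A \<ge> 0" "\<And>x. x \<in> \<Omega> \<Longrightarrow> linear (D x)" "\<And>x. x \<in> \<Omega> \<Longrightarrow> \<bar>w x\<bar> \<le> A"
    "\<And>x v. x \<in> \<Omega> \<Longrightarrow> \<bar>D x v\<bar> \<le> A * norm v"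
    "\<And>x y. x \<in> \<Omega> \<Longrightarrow> y \<in> \<Omega> \<Longrightarrow> \<bar>w y - w x\<bar> \<le> A * norm (y - x)"
    "\<And>x y. x \<in> \<Omega> \<Longrightarrow> y \<in> \<Omega> \<Longrightarrow> \<bar>w y - w x - D x (y - x)\<bar> \<le> A * (norm (y - x))\<^sup>2"
    using C11_onE[OF assms(1)] by blast
  define k where "k = inverse (sqrt c)"
  have k0: "k > 0" using assms(2) by (simp add: k_def)
  have k: "\<bar>inverse (sqrt (w x))\<bar> \<le> k" if "x \<in> \<Omega>" for x
    using assms(2) assms(3)[OF that] unfolding k_def by (simp add: le_imp_inverse_le)
  have prod: "\<bar>a * b\<bar> \<le> s * t" if "\<bar>a\<bar> \<le> s" "\<bar>b\<bar> \<le> t" for a b s t :: real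
    using that by (simp add: abs_mult mult_mono')
  show ?thesis
  proof (rule C11_onI[of _ _ _ "sqrt A" "(1/2) * (k * A)" "k * A"
       "(1/2) * (k * A) + (1/2) * (k * ((k * A) * (k * A)))"])
    fix x assume x: "x \<in> \<Omega>"
    have wx: "w x > 0" using assms(2) assms(3)[OF x] by simp
    have "linear (\<lambda>v. ((1/2) * inverse (sqrt (w x))) * D x v)"
      using A(2)[OF x] by (rule linear_real_cmult)
    then show "linear (\<lambda>v. (1/2) * (inverse (sqrt (w x)) * D x v))"
      by (simp add: algebra_simps)
    show "\<bar>sqrt (w x)\<bar> \<le> sqrt A" using A(3)[OF x] wx by simp
    show "\<bar>(1/2) * (inverse (sqrt (w x)) * D x v)\<bar> \<le> (1/2) * (k * A) * norm v" for v
      using prod[OF k[OF x] A(4)[OF x, of v]] by (simp add: algebra_simps abs_mult)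
    fix y assume y: "y \<in> \<Omega>"
    have wy: "w y > 0" using assms(2) assms(3)[OF y] by simp
    define a where "a = sqrt (w x)"
    define b where "b = sqrt (w y)"
    have ab: "a > 0" "b > 0" "w x = a * a" "w y = b * b" using wx wy by (auto simp: a_def b_def)
    have i: "\<bar>inverse (a + b)\<bar> \<le> k"
    proof -
      have "inverse (a + b) \<le> inverse a" using ab by (simp add: le_imp_inverse_le)
      moreover have "inverse a \<le> k" using k[OF x] wx by (simp add: a_def)
      ultimately have "inverse (a + b) \<le> k" by (rule order_trans)
      then show ?thesis using ab(1,2) by simp
    qed
    have "b - a = inverse (a + b) * (w y - w x)"
      using ab by (simp add: field_simps)
    then have lip: "\<bar>b - a\<bar> \<le> k * A * norm (y - x)"
      using prod[OF i A(5)[OF x y]] by (simp add: algebra_simps)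
    then show "\<bar>sqrt (w y) - sqrt (w x)\<bar> \<le> k * A * norm (y - x)" by (simp add: a_def b_def)
    \<comment> \<open>Since \<open>b^2 - a^2 = 2 * a * (b - a) + (b - a)^2\<close>, dividing by
      \<open>2 * a\<close> leaves the remainder of \<open>w\<close> and the square of
      \<open>b - a\<close>, which \<open>lip\<close> controls.\<close>
    have e: "b - a - (1/2) * (inverse a * D x (y - x)) =
       (1/2) * (inverse a * (w y - w x - D x (y - x))) - (1/2) * (inverse a * ((b - a) * (b - a)))"
      using ab by (simp add: field_simps)
    have "\<bar>b - a - (1/2) * (inverse a * D x (y - x))\<bar>
      \<le> ((1/2) * (k * A) + (1/2) * (k * ((k * A) * (k * A)))) * (norm (y - x))\<^sup>2"
      unfolding e
      using prod[OF k[OF x] A(6)[OF x y]] prod[OF k[OF x] prod[OF lip lip]]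
      by (simp add: algebra_simps power2_eq_square a_def)
    then show "\<bar>sqrt (w y) - sqrt (w x) - (1/2) * (inverse (sqrt (w x)) * D x (y - x))\<bar>
      \<le> ((1/2) * (k * A) + (1/2) * (k * ((k * A) * (k * A)))) * (norm (y - x))\<^sup>2"
      by (simp add: a_def b_def)
  qed
qed

lemma C11_on_continuous:
  assumes "C11_on \<Omega> p D"
  shows "continuous_on \<Omega> p"
proof -
  obtain C where C: "C \<ge> 0" "\<And>x y. x \<in> \<Omega> \<Longrightarrow> y \<in> \<Omega> \<Longrightarrow> \<bar>p y - p x\<bar> \<le> C * norm (y - x)"
    using C11_onE[OF assms] by metis
  have "C-lipschitz_on \<Omega> p"
    using C by (intro lipschitz_onI) (auto simp: dist_norm)
  then show ?thesis by (rule lipschitz_on_continuous_on)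
qed

text \<open>The derivative in the fixed direction \<open>K\<close> is again of this class; no higher regularity in other
  directions is ever needed.\<close>

definition C11_dir :: "'a::real_normed_vector \<Rightarrow> 'a set \<Rightarrow> ('a \<Rightarrow> real) \<Rightarrow> bool" where
  "C11_dir K \<Omega> p \<longleftrightarrow> (\<exists>D E. C11_on \<Omega> p D \<and> C11_on \<Omega> (\<lambda>x. D x K) E)"

lemma C11_dir_const: "C11_dir K \<Omega> (\<lambda>x. c)"
  unfolding C11_dir_def using C11_on_const by blast

lemma C11_dir_linear:
  assumes "bounded \<Omega>" "bounded_linear l"
  shows "C11_dir K \<Omega> l"
  unfolding C11_dir_def using C11_on_linear[OF assms] C11_on_const by blast

lemma C11_dir_add:
  assumes "C11_dir K \<Omega> p" "C11_dir K \<Omega> q"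
  shows "C11_dir K \<Omega> (\<lambda>x. p x + q x)"
proof -
  obtain D E D' E' where DE: "C11_on \<Omega> p D" "C11_on \<Omega> (\<lambda>x. D x K) E"
    "C11_on \<Omega> q D'" "C11_on \<Omega> (\<lambda>x. D' x K) E'"
    using assms unfolding C11_dir_def by auto
  show ?thesis
    unfolding C11_dir_def
    by (intro exI conjI) (rule C11_on_add[OF DE(1,3)], rule C11_on_add[OF DE(2,4)])
qed

lemma C11_dir_mult:
  assumes "C11_dir K \<Omega> p" "C11_dir K \<Omega> q"
  shows "C11_dir K \<Omega> (\<lambda>x. p x * q x)"
proof -
  obtain D E D' E' where DE: "C11_on \<Omega> p D" "C11_on \<Omega> (\<lambda>x. D x K) E"
    "C11_on \<Omega> q D'" "C11_on \<Omega> (\<lambda>x. D' x K) E'"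
    using assms unfolding C11_dir_def by auto
  show ?thesis
    unfolding C11_dir_def
    by (intro exI conjI) (rule C11_on_mult[OF DE(1,3)], rule C11_on_add[OF C11_on_mult[OF DE(1,4)] C11_on_mult[OF DE(3,2)]])
qed

lemma C11_dir_diff:
  assumes "C11_dir K \<Omega> p" "C11_dir K \<Omega> q"
  shows "C11_dir K \<Omega> (\<lambda>x. p x - q x)"
  using C11_dir_add[OF assms(1) C11_dir_mult[OF C11_dir_const[of K \<Omega> "-1"] assms(2)]] by simp

lemma C11_dir_sum:
  assumes "finite A" "\<And>a. a \<in> A \<Longrightarrow> C11_dir K \<Omega> (p a)"
  shows "C11_dir K \<Omega> (\<lambda>x. \<Sum>a\<in>A. p a x)"
  using assms by (induction A rule: finite_induct) (simp_all add: C11_dir_const C11_dir_add)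

lemma C11_dir_power:
  assumes "C11_dir K \<Omega> p"
  shows "C11_dir K \<Omega> (\<lambda>x. p x ^ n)"
  by (induction n) (simp_all add: C11_dir_const C11_dir_mult assms)

lemma C11_dir_inverse:
  assumes "C11_dir K \<Omega> w" "c > 0" "\<And>x. x \<in> \<Omega> \<Longrightarrow> w x \<ge> c"
  shows "C11_dir K \<Omega> (\<lambda>x. inverse (w x))"
proof -
  obtain D E where DE: "C11_on \<Omega> w D" "C11_on \<Omega> (\<lambda>x. D x K) E"
    using assms(1) unfolding C11_dir_def by blast
  have i: "C11_on \<Omega> (\<lambda>x. inverse (w x)) (\<lambda>x v. - (inverse (w x) * (inverse (w x) * D x v)))"
    by (rule C11_on_inverse[OF DE(1) assms(2,3)])
  have "\<exists>F. C11_on \<Omega> (\<lambda>x. -1 * (inverse (w x) * (inverse (w x) * D x K))) F"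
    by (intro exI) (rule C11_on_mult[OF C11_on_const C11_on_mult[OF i C11_on_mult[OF i DE(2)]]])
  then have "\<exists>F. C11_on \<Omega> (\<lambda>x. - (inverse (w x) * (inverse (w x) * D x K))) F"
    by simp
  then show ?thesis
    unfolding C11_dir_def using i by blast
qed

lemma C11_dir_sqrt:
  assumes "C11_dir K \<Omega> w" "c > 0" "\<And>x. x \<in> \<Omega> \<Longrightarrow> w x \<ge> c"
  shows "C11_dir K \<Omega> (\<lambda>x. sqrt (w x))"
proof -
  obtain D E where DE: "C11_on \<Omega> w D" "C11_on \<Omega> (\<lambda>x. D x K) E"
    using assms(1) unfolding C11_dir_def by blast
  have s: "C11_on \<Omega> (\<lambda>x. sqrt (w x)) (\<lambda>x v. (1/2) * (inverse (sqrt (w x)) * D x v))"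
    by (rule C11_on_sqrt[OF DE(1) assms(2,3)])
  have "\<exists>F. C11_on \<Omega> (\<lambda>x. inverse (sqrt (w x))) F"
    using C11_on_inverse[OF s, of "sqrt c"] assms by auto
  then obtain F where F: "C11_on \<Omega> (\<lambda>x. inverse (sqrt (w x))) F" by blast
  have "\<exists>E'. C11_on \<Omega> (\<lambda>x. (1/2) * (inverse (sqrt (w x)) * D x K)) E'"
    by (intro exI) (rule C11_on_mult[OF C11_on_const C11_on_mult[OF F DE(2)]])
  then show ?thesis unfolding C11_dir_def using s by blast
qed


section \<open>Functions on the sphere\<close>

declare mem_sphere_0 [simp del] mem_sphere [simp del]

text \<open>A witness that the index set of the Hoelder quotient is inhabited: a supremum of reals
  over the empty set has no useful value.\<close>

lemma S3_distinct: "(axis 1 1, - axis 1 1) \<in> {(x, y). x \<in> S3 \<and> y \<in> S3 \<and> x \<noteq> (y :: real^4)}"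
  using S3_nonempty by (auto simp: mem_sphere_0 eq_neg_iff_add_eq_0 vec_eq_iff axis_def)

lemma fderiv_cong:
  assumes "\<And>y. y \<in> S3 \<Longrightarrow> f y = g y" "x \<in> S3"
  shows "fderiv i f x = fderiv i g x"
  using assms flow_S3[of x i] by (simp add: fderiv_def)

lemma Ck_continuous: "Ck k f \<Longrightarrow> length w \<le> k \<Longrightarrow> continuous_on S3 (fderivs w f)"
  by (simp add: Ck_def)

lemma Ck_has_derivative:
  assumes "Ck k f" "length w < k" "x \<in> S3"
  shows "((\<lambda>t. fderivs w f (flow i t x)) has_real_derivative fderivs (i # w) f x) (at 0)"
  using assms unfolding Ck_def
  by (simp add: fderiv_def DERIV_deriv_iff_real_differentiable)

lemma sphere_integral_fderivs:
  assumes "Ck k f" "length w < k"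
  shows "sphere_integral (fderivs (i # w) f) = 0"
  using assms sphere_integral_fderiv[of "fderivs w f" i] Ck_continuous[of k f "i # w"]
    Ck_continuous[of k f w]
  by (auto simp: Ck_def)

text \<open>\<open>deriv\<close> is linear only on differentiable functions, so each step of the
  induction on the word draws differentiability along the flow from \<open>Ck k\<close>.\<close>

lemma fderivs_lincomb:
  assumes "Ck k f" "Ck k g" "length w \<le> k" "x \<in> S3"
  shows "fderivs w (\<lambda>y. c * f y + d * g y) x = c * fderivs w f x + d * fderivs w g x"
  using assms(3,4)
proof (induction w arbitrary: x)
  case (Cons i w)
  have "fderivs (i # w) (\<lambda>y. c * f y + d * g y) x
      = fderiv i (\<lambda>y. c * fderivs w f y + d * fderivs w g y) x"
    using Cons by (auto intro!: fderiv_cong)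
  also have "\<dots> = c * fderivs (i # w) f x + d * fderivs (i # w) g x"
    using Ck_has_derivative[OF assms(1), of w x i] Ck_has_derivative[OF assms(2), of w x i] Cons.prems
    unfolding fderiv_def by (intro DERIV_imp_deriv) (auto intro!: derivative_eq_intros)
  finally show ?case .
qed simp

lemma Ck_lincomb:
  assumes "Ck k f" "Ck k g"
  shows "Ck k (\<lambda>y. c * f y + d * g y)"
  unfolding Ck_def
proof (intro conjI allI impI ballI)
  fix w :: "3 list" assume w: "length w \<le> k"
  have "continuous_on S3 (\<lambda>x. c * fderivs w f x + d * fderivs w g x)"
    using assms w by (intro continuous_intros) (auto simp: Ck_def)
  then show "continuous_on S3 (fderivs w (\<lambda>y. c * f y + d * g y))"
    using fderivs_lincomb[OF assms w] continuous_on_cong by (metis (no_types, lifting))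
next
  fix w :: "3 list" and i x assume x: "x \<in> S3" and w: "length w < k"
  have "(\<lambda>t. fderivs w (\<lambda>y. c * f y + d * g y) (flow i t x)) =
    (\<lambda>t. c * fderivs w f (flow i t x) + d * fderivs w g (flow i t x))"
    using fderivs_lincomb[OF assms _ flow_S3[OF x]] w by auto
  then show "(\<lambda>t. fderivs w (\<lambda>y. c * f y + d * g y) (flow i t x)) differentiable at 0"
    using assms w x by (auto simp: Ck_def intro!: derivative_intros)
qed

lemma Ck_alpha_lincomb:
  assumes "Ck_alpha k \<alpha> f" "Ck_alpha k \<alpha> g"
  shows "Ck_alpha k \<alpha> (\<lambda>y. c * f y + d * g y)"
  unfolding Ck_alpha_def
proof (intro conjI allI impI)
  have f: "Ck k f" and g: "Ck k g" using assms by (auto simp: Ck_alpha_def)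
  show "Ck k (\<lambda>y. c * f y + d * g y)" by (rule Ck_lincomb[OF f g])
  fix w :: "3 list" assume w: "length w = k"
  obtain A where A: "\<And>x y. x \<in> S3 \<Longrightarrow> y \<in> S3 \<Longrightarrow> \<bar>fderivs w f x - fderivs w f y\<bar> \<le> A * dist x y powr \<alpha>"
    using assms(1) w unfolding Ck_alpha_def by blast
  obtain B where B: "\<And>x y. x \<in> S3 \<Longrightarrow> y \<in> S3 \<Longrightarrow> \<bar>fderivs w g x - fderivs w g y\<bar> \<le> B * dist x y powr \<alpha>"
    using assms(2) w unfolding Ck_alpha_def by blast
  show "\<exists>C. \<forall>x\<in>S3. \<forall>y\<in>S3. \<bar>fderivs w (\<lambda>y. c * f y + d * g y) x - fderivs w (\<lambda>y. c * f y + d * g y) y\<bar>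
      \<le> C * dist x y powr \<alpha>"
  proof (intro exI[of _ "\<bar>c\<bar> * A + \<bar>d\<bar> * B"] ballI)
    fix x y :: "real^4" assume x: "x \<in> S3" and y: "y \<in> S3"
    define u where "u = fderivs w f x - fderivs w f y"
    define v where "v = fderivs w g x - fderivs w g y"
    have "fderivs w (\<lambda>y. c * f y + d * g y) x - fderivs w (\<lambda>y. c * f y + d * g y) y = c * u + d * v"
      using fderivs_lincomb[OF f g, of w] w x y by (simp add: u_def v_def algebra_simps)
    moreover have "\<bar>c * u + d * v\<bar> \<le> \<bar>c\<bar> * \<bar>u\<bar> + \<bar>d\<bar> * \<bar>v\<bar>"
      by (metis abs_mult abs_triangle_ineq)
    moreover have "\<bar>c\<bar> * \<bar>u\<bar> \<le> \<bar>c\<bar> * (A * dist x y powr \<alpha>)"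
      using A[OF x y] by (intro mult_left_mono) (auto simp: u_def)
    moreover have "\<bar>d\<bar> * \<bar>v\<bar> \<le> \<bar>d\<bar> * (B * dist x y powr \<alpha>)"
      using B[OF x y] by (intro mult_left_mono) (auto simp: v_def)
    ultimately show "\<bar>fderivs w (\<lambda>y. c * f y + d * g y) x - fderivs w (\<lambda>y. c * f y + d * g y) y\<bar>
      \<le> (\<bar>c\<bar> * A + \<bar>d\<bar> * B) * dist x y powr \<alpha>"
      by (simp add: algebra_simps)
  qed
qed

lemma finite_words: "finite {w :: 3 list. length w \<le> k}" "finite {w :: 3 list. length w = k}"
  using finite_lists_length_le[of "UNIV :: 3 set" k] finite_lists_length_eq[of "UNIV :: 3 set" k] by simp_all

text \<open>Every summand of the norm is a finite nonnegative supremum, by compactness for the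
  derivatives and by the Hoelder bound for the quotients, so each is at most the sum.\<close>

lemma fderivs_le_Ck_alpha_norm:
  assumes f: "Ck_alpha k \<alpha> f" and w: "length w \<le> k" and x: "x \<in> S3"
  shows "\<bar>fderivs w f x\<bar> \<le> Ck_alpha_norm k \<alpha> f"
proof -
  have bdd: "\<bar>fderivs w f x\<bar> \<le> (SUP x\<in>S3. \<bar>fderivs w f x\<bar>)" if "length w \<le> k" "x \<in> S3" for w x
  proof -
    have "continuous_on S3 (fderivs w f)" using f that by (simp add: Ck_alpha_def Ck_def)
    from continuous_S3_bounded[OF this] obtain C where "\<And>x. x \<in> S3 \<Longrightarrow> \<bar>fderivs w f x\<bar> \<le> C" by metis
    then have "bdd_above ((\<lambda>x. \<bar>fderivs w f x\<bar>) ` S3)" by (intro bdd_aboveI2)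
    then show ?thesis using that(2) by (rule cSUP_upper2) simp
  qed
  have hol: "0 \<le> (SUP (x, y)\<in>{(x, y). x \<in> S3 \<and> y \<in> S3 \<and> x \<noteq> y}.
        \<bar>fderivs w f x - fderivs w f y\<bar> / dist x y powr \<alpha>)" if w: "length w = k" for w
  proof -
    obtain C where C: "\<And>x y. x \<in> S3 \<Longrightarrow> y \<in> S3 \<Longrightarrow> \<bar>fderivs w f x - fderivs w f y\<bar> \<le> C * dist x y powr \<alpha>"
      using f w unfolding Ck_alpha_def by blast
    let ?A = "{(x, y). x \<in> S3 \<and> y \<in> S3 \<and> x \<noteq> y}"
    let ?q = "\<lambda>(x, y). \<bar>fderivs w f x - fderivs w f y\<bar> / dist x y powr \<alpha>"
    have "bdd_above (?q ` ?A)"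
      by (rule bdd_aboveI2[of _ _ C]) (auto simp: pos_divide_le_eq C)
    moreover have "(axis 1 1, - axis 1 1) \<in> ?A" by (rule S3_distinct)
    ultimately show ?thesis by (rule cSUP_upper2) simp
  qed
  have pos: "0 \<le> (SUP x\<in>S3. \<bar>fderivs w f x\<bar>)" if "length w \<le> k" for w
    using bdd[OF that S3_nonempty] abs_ge_zero order_trans by blast
  have "\<bar>fderivs w f x\<bar> \<le> (SUP x\<in>S3. \<bar>fderivs w f x\<bar>)" by (rule bdd[OF w x])
  also have "\<dots> \<le> (\<Sum>w\<in>{w. length w \<le> k}. SUP x\<in>S3. \<bar>fderivs w f x\<bar>)"
    by (rule member_le_sum) (use w pos finite_words in auto)
  also have "\<dots> \<le> Ck_alpha_norm k \<alpha> f"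
    unfolding Ck_alpha_norm_def using sum_nonneg[of "{w. length w = k}", OF hol] by simp
  finally show ?thesis .
qed

lemma Ck_alpha_norm_nonneg: "Ck_alpha k \<alpha> f \<Longrightarrow> 0 \<le> Ck_alpha_norm k \<alpha> f"
  using fderivs_le_Ck_alpha_norm[of k \<alpha> f "[]", OF _ _ S3_nonempty] by force

lemma fderivs_const:
  assumes "\<And>x. x \<in> S3 \<Longrightarrow> f x = c" "x \<in> S3"
  shows "fderivs w f x = (if w = [] then c else 0)"
  using assms(2)
proof (induction w arbitrary: x)
  case (Cons i w)
  have "fderiv i (fderivs w f) x = 0"
    by (rule fderiv_const[of _ "if w = [] then c else 0"]) (use Cons in auto)
  then show ?case by simp
qed (use assms in auto)

lemma Ck_const:
  assumes "\<And>x. x \<in> S3 \<Longrightarrow> f x = c"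
  shows "Ck k f"
  unfolding Ck_def
proof (intro conjI allI impI ballI)
  show "continuous_on S3 (fderivs w f)" for w
    using fderivs_const[OF assms] continuous_on_cong[of S3 S3 "fderivs w f" "\<lambda>x. if w = [] then c else 0"]
    by auto
  show "(\<lambda>t. fderivs w f (flow i t x)) differentiable at 0" if "x \<in> S3" for w i x
    using fderivs_const[OF assms flow_S3[OF that]] by simp
qed

lemma Ck_alpha_const:
  assumes "\<And>x. x \<in> S3 \<Longrightarrow> f x = c"
  shows "Ck_alpha k \<alpha> f"
  unfolding Ck_alpha_def using Ck_const[OF assms] fderivs_const[OF assms]
  by (auto intro!: exI[of _ 0])

lemma Ck_alpha_norm_const:
  assumes c: "\<And>x. x \<in> S3 \<Longrightarrow> f x = c"
  shows "Ck_alpha_norm k \<alpha> f = \<bar>c\<bar>"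
proof -
  have ne: "S3 \<noteq> {}" using S3_nonempty by blast
  have 1: "(SUP x\<in>S3. \<bar>fderivs w f x\<bar>) = (if w = [] then \<bar>c\<bar> else 0)" for w
  proof -
    have "(SUP x\<in>S3. \<bar>fderivs w f x\<bar>) = (SUP x\<in>S3. (if w = [] then \<bar>c\<bar> else 0))"
      by (rule SUP_cong) (auto simp: fderivs_const[OF c])
    then show ?thesis using ne by simp
  qed
  let ?A = "{(x, y). x \<in> S3 \<and> y \<in> S3 \<and> x \<noteq> (y :: real^4)}"
  have ne2: "?A \<noteq> {}" using S3_distinct by blast
  have 2: "(SUP (x, y)\<in>?A. \<bar>fderivs w f x - fderivs w f y\<bar> / dist x y powr \<alpha>) = 0" for w
  proof -
    have "(SUP (x, y)\<in>?A. \<bar>fderivs w f x - fderivs w f y\<bar> / dist x y powr \<alpha>) = (SUP p\<in>?A. 0)"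
      by (rule SUP_cong) (auto simp: fderivs_const[OF c])
    then show ?thesis using ne2 by simp
  qed
  have "(\<Sum>w\<in>{w :: 3 list. length w \<le> k}. if w = [] then \<bar>c\<bar> else 0) = \<bar>c\<bar>"
    by (subst sum.delta[OF finite_words(1)]) simp
  then show ?thesis unfolding Ck_alpha_norm_def 1 2 by simp
qed

section \<open>Inverses of three by three matrices\<close>

text \<open>The entries of the adjugate. Arithmetic in the index type is modulo 3, and choosing the
  complementary rows and columns cyclically absorbs the cofactor signs.\<close>

definition adj3 :: "real^3^3 \<Rightarrow> 3 \<Rightarrow> 3 \<Rightarrow> real" where
  "adj3 A i j = A $ (j+1) $ (i+1) * A $ (j+2) $ (i+2) - A $ (j+1) $ (i+2) * A $ (j+2) $ (i+1)"

lemma matrix_inv_unique3: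
  fixes A B :: "real^3^3"
  assumes "A ** B = mat 1" "B ** A = mat 1"
  shows "matrix_inv A = B"
proof -
  have "A ** matrix_inv A = mat 1"
    unfolding matrix_inv_def by (rule someI2[of _ B]) (use assms in auto)
  then show ?thesis
    by (metis assms(2) matrix_mul_assoc matrix_mul_lid matrix_mul_rid)
qed

lemma
  assumes "det A \<noteq> 0"
  shows matrix_inv_adj3: "matrix_inv A $ i $ j = adj3 A i j * inverse (det A)"
    and matrix_inv_left3: "matrix_inv A ** A = mat 1"
    and matrix_inv_right3: "A ** matrix_inv A = mat 1"
proof -
  define B :: "real^3^3" where "B = (\<chi> i j. adj3 A i j * inverse (det A))"
  have num: "(2::3) + 2 = 1" "(2::3) + 1 = 3" "(3::3) + 1 = 1" "(3::3) + 2 = 2" "(1::3) + 1 = 2" "(1::3) + 2 = 3"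
    by simp_all
  have a: "(\<Sum>k\<in>UNIV. A $ i $ k * adj3 A k j) = (if i = j then det A else 0)"
     "(\<Sum>k\<in>UNIV. adj3 A i k * A $ k $ j) = (if i = j then det A else 0)" for i j
    using exhaust_3[of i] exhaust_3[of j]
    by (elim disjE; hypsubst; simp only: sum_3 adj3_def det_3 num; simp add: algebra_simps)+
  have "A ** B = mat 1"
    using assms a(1) by (simp add: B_def matrix_matrix_mult_def vec_eq_iff mat_def sum_distrib_right[symmetric] mult.assoc[symmetric])
  moreover have "B ** A = mat 1"
  proof -
    have "(\<Sum>k\<in>UNIV. adj3 A i k * inverse (det A) * A $ k $ j) = (if i = j then 1 else 0)" for i j
      using a(2)[of i j] assms by (simp add: sum_3 field_simps split: if_splits)
    then show ?thesis by (simp add: B_def matrix_matrix_mult_def vec_eq_iff mat_def)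
  qed
  ultimately show "matrix_inv A $ i $ j = adj3 A i j * inverse (det A)"
    "matrix_inv A ** A = mat 1" "A ** matrix_inv A = mat 1"
    using matrix_inv_unique3 by (auto simp: B_def)
qed

text \<open>The cofactor formula gives differentiability; the derivative is then read off by
  differentiating the product of the inverse with \<open>A t\<close>, which is constantly
  \<open>mat 1\<close>.\<close>

lemma has_derivative_matrix_inv:
  fixes A :: "real \<Rightarrow> real^3^3" and A' :: "real^3^3"
  assumes d: "\<And>i j. ((\<lambda>t. A t $ i $ j) has_real_derivative A' $ i $ j) (at t)"
    and nz: "\<And>s. det (A s) \<noteq> 0"
  shows "((\<lambda>t. matrix_inv (A t) $ i $ j) has_real_derivative
     - (matrix_inv (A t) ** A' ** matrix_inv (A t)) $ i $ j) (at t)"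
proof -
  have d': "(\<lambda>t. A t $ i $ j) differentiable at t" for i j
    using d by (auto simp: real_differentiable_def)
  have det: "(\<lambda>t. det (A t)) differentiable at t"
    unfolding det_3 by (intro derivative_intros d')
  have "(\<lambda>t. matrix_inv (A t) $ i $ j) differentiable at t" for i j
    unfolding matrix_inv_adj3[OF nz] adj3_def by (intro derivative_intros det d' nz)
  then have "\<forall>i j. \<exists>b. ((\<lambda>t. matrix_inv (A t) $ i $ j) has_real_derivative b) (at t)"
    by (simp add: real_differentiable_def)
  then obtain b where b: "\<And>i j. ((\<lambda>t. matrix_inv (A t) $ i $ j) has_real_derivative b i j) (at t)"
    by metis
  define B :: "real^3^3" where "B = (\<chi> i j. b i j)"
  have B: "((\<lambda>t. matrix_inv (A t) $ i $ j) has_real_derivative B $ i $ j) (at t)" for i j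
    using b by (simp add: B_def)
  have "B ** A t + matrix_inv (A t) ** A' = 0"
  proof -
    have "(B ** A t + matrix_inv (A t) ** A') $ i $ j = 0" for i j
    proof -
      have "((\<lambda>t. (matrix_inv (A t) ** A t) $ i $ j) has_real_derivative
           (B ** A t + matrix_inv (A t) ** A') $ i $ j) (at t)"
        unfolding matrix_matrix_mult_def sum_3
        by (auto intro!: derivative_eq_intros B d simp: sum_3)
      then have "((\<lambda>t. mat 1 $ i $ j :: real) has_real_derivative
           (B ** A t + matrix_inv (A t) ** A') $ i $ j) (at t)"
        by (simp only: matrix_inv_left3[OF nz])
      then show ?thesis using DERIV_unique DERIV_const by blast
    qed
    then show ?thesis by (simp add: vec_eq_iff)
  qed
  then have "B ** A t = - (matrix_inv (A t) ** A')" by (simp add: add_eq_0_iff2)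
  then have "B ** A t ** matrix_inv (A t) = - (matrix_inv (A t) ** A') ** matrix_inv (A t)"
    by simp
  then have "B = - (matrix_inv (A t) ** A') ** matrix_inv (A t)"
    by (metis matrix_inv_right3[OF nz] matrix_mul_assoc matrix_mul_rid)
  moreover have "(- M) ** N = - (M ** N)" for M N :: "real^3^3"
    by (simp add: matrix_matrix_mult_def vec_eq_iff sum_negf)
  ultimately have "B $ i $ j = - (matrix_inv (A t) ** A' ** matrix_inv (A t)) $ i $ j" by simp
  then show ?thesis using B[of i j] by simp
qed


section \<open>The integrands as functions of the two-jet of the metric\<close>

text \<open>The coordinates of a jet are the components \<open>G_ij\<close>, their frame derivatives \<open>E_a G_ij\<close> and
  their second frame derivatives \<open>E_a E_b G_ij\<close>.\<close>

type_synonym jet = "real^((3 \<times> 3) + (3 \<times> 3 \<times> 3) + (3 \<times> 3 \<times> 3 \<times> 3))"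

definition jet :: "(real^4 \<Rightarrow> real^3^3) \<Rightarrow> real^4 \<Rightarrow> jet" where
  "jet G x = (\<chi> c. case c of Inl (i, j) \<Rightarrow> G x $ i $ j
     | Inr (Inl (a, i, j)) \<Rightarrow> fderivs [a] (\<lambda>y. G y $ i $ j) x
     | Inr (Inr (a, b, i, j)) \<Rightarrow> fderivs [a, b] (\<lambda>y. G y $ i $ j) x)"

definition const_jet :: "real^3^3 \<Rightarrow> jet" where
  "const_jet A = (\<chi> c. case c of Inl (i, j) \<Rightarrow> A $ i $ j | Inr _ \<Rightarrow> 0)"

definition jmat :: "jet \<Rightarrow> real^3^3" where
  "jmat J = (\<chi> i j. J $ Inl (i, j))"

definition sc :: "3 \<Rightarrow> 3 \<Rightarrow> 3 \<Rightarrow> real" where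
  "sc i j k = (if (i, j, k) \<in> {(1,2,3), (2,3,1), (3,1,2)} then 2
     else if (i, j, k) \<in> {(2,1,3), (3,2,1), (1,3,2)} then -2 else 0)"

text \<open>The cofactor form, rather than \<open>matrix_inv\<close>, shows the inverse as a
  polynomial times an inverse determinant, to which the closure rules of \<open>C11_dir\<close>
  apply.\<close>

definition inv_jet :: "jet \<Rightarrow> 3 \<Rightarrow> 3 \<Rightarrow> real" where
  "inv_jet J i j = adj3 (jmat J) i j * inverse (det (jmat J))"

text \<open>The formal derivative of the inverse metric along \<open>E_a\<close>, that is, minus
  \<open>G^(-1) (E_a G) G^(-1)\<close>. The difference from 0 matches the rule
  \<open>C11_dir_diff\<close>. The functions \<open>dkoszul_jet\<close> and
  \<open>dchristoffel_jet\<close> are formal derivatives along \<open>E_a\<close> in the same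
  sense.\<close>

definition dinv_jet :: "jet \<Rightarrow> 3 \<Rightarrow> 3 \<Rightarrow> 3 \<Rightarrow> real" where
  "dinv_jet J a i j = 0 - (\<Sum>l\<in>UNIV. (\<Sum>k\<in>UNIV. inv_jet J i k * J $ Inr (Inl (a, k, l))) * inv_jet J l j)"

definition koszul_jet :: "jet \<Rightarrow> 3 \<Rightarrow> 3 \<Rightarrow> 3 \<Rightarrow> real" where
  "koszul_jet J i j k =
     J $ Inr (Inl (i, j, k)) + J $ Inr (Inl (j, i, k)) - J $ Inr (Inl (k, i, j))
     + (\<Sum>m\<in>UNIV. sc i j m * J $ Inl (m, k) - sc i k m * J $ Inl (m, j) - sc j k m * J $ Inl (m, i))"

definition dkoszul_jet :: "jet \<Rightarrow> 3 \<Rightarrow> 3 \<Rightarrow> 3 \<Rightarrow> 3 \<Rightarrow> real" where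
  "dkoszul_jet J a i j k =
     J $ Inr (Inr (a, i, j, k)) + J $ Inr (Inr (a, j, i, k)) - J $ Inr (Inr (a, k, i, j))
     + (\<Sum>m\<in>UNIV. sc i j m * J $ Inr (Inl (a, m, k)) - sc i k m * J $ Inr (Inl (a, m, j))
          - sc j k m * J $ Inr (Inl (a, m, i)))"

definition christoffel_jet :: "jet \<Rightarrow> 3 \<Rightarrow> 3 \<Rightarrow> 3 \<Rightarrow> real" where
  "christoffel_jet J i j l = (1/2) * (\<Sum>k\<in>UNIV. inv_jet J l k * koszul_jet J i j k)"

definition dchristoffel_jet :: "jet \<Rightarrow> 3 \<Rightarrow> 3 \<Rightarrow> 3 \<Rightarrow> 3 \<Rightarrow> real" where
  "dchristoffel_jet J a i j l = (1/2) * (\<Sum>k\<in>UNIV. dinv_jet J a l k * koszul_jet J i j k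
      + inv_jet J l k * dkoszul_jet J a i j k)"

definition riem_jet :: "jet \<Rightarrow> 3 \<Rightarrow> 3 \<Rightarrow> 3 \<Rightarrow> 3 \<Rightarrow> real" where
  "riem_jet J i j k l = dchristoffel_jet J i j k l - dchristoffel_jet J j i k l
     + (\<Sum>m\<in>UNIV. christoffel_jet J j k m * christoffel_jet J i m l
          - christoffel_jet J i k m * christoffel_jet J j m l - sc i j m * christoffel_jet J m k l)"

definition ric_jet :: "jet \<Rightarrow> 3 \<Rightarrow> 3 \<Rightarrow> real" where
  "ric_jet J j k = (\<Sum>i\<in>UNIV. riem_jet J i j k i)"

definition scal_jet :: "jet \<Rightarrow> real" where
  "scal_jet J = (\<Sum>i\<in>UNIV. \<Sum>j\<in>UNIV. inv_jet J i j * ric_jet J i j)"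

definition ric_sq_jet :: "jet \<Rightarrow> real" where
  "ric_sq_jet J = (\<Sum>i\<in>UNIV. \<Sum>j\<in>UNIV. \<Sum>k\<in>UNIV. \<Sum>l\<in>UNIV.
        inv_jet J i k * inv_jet J j l * ric_jet J i j * ric_jet J k l)"

definition dens_jet :: "jet \<Rightarrow> real" where
  "dens_jet J = sqrt (det (jmat J))"

definition curv_jet :: "jet \<Rightarrow> real" where
  "curv_jet J = ric_sq_jet J * dens_jet J + (1/3) * ((scal_jet J)\<^sup>2 * dens_jet J)"

text \<open>The integrands are polynomial in the jet, apart from the inverse and the square root of
  the determinant. Boundedness controls the former dependence, the uniform lower bound the
  latter.\<close>

definition regular :: "jet set \<Rightarrow> bool" where
  "regular \<Omega> \<longleftrightarrow> bounded \<Omega> \<and> (\<exists>c>0. \<forall>J\<in>\<Omega>. c \<le> det (jmat J))"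

section \<open>Regularity of the integrands in the jet\<close>

lemma C11_dir_nth: "bounded \<Omega> \<Longrightarrow> C11_dir K \<Omega> (\<lambda>J::real^'n. J $ c)"
  by (rule C11_dir_linear) (auto intro: bounded_linear_vec_nth)

lemmas C11_dir_intros = C11_dir_const C11_dir_add C11_dir_diff C11_dir_mult C11_dir_power
  C11_dir_sum[OF finite]

context
  fixes \<Omega> :: "jet set" and K :: jet
  assumes regular: "regular \<Omega>"
begin

lemma bounded_regular: "bounded \<Omega>" using regular by (simp add: regular_def)

lemma C11_dir_det: "C11_dir K \<Omega> (\<lambda>J. det (jmat J))"
  unfolding det_3 jmat_def by (simp, intro C11_dir_intros C11_dir_nth bounded_regular)

lemma C11_dir_inverse_det: "C11_dir K \<Omega> (\<lambda>J. inverse (det (jmat J)))"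
  using regular C11_dir_inverse[OF C11_dir_det] unfolding regular_def by blast

lemma C11_dir_dens: "C11_dir K \<Omega> dens_jet"
  using regular C11_dir_sqrt[OF C11_dir_det] unfolding regular_def dens_jet_def[abs_def] by blast

lemma C11_dir_inv_jet: "C11_dir K \<Omega> (\<lambda>J. inv_jet J i j)"
  unfolding inv_jet_def adj3_def
  by (intro C11_dir_intros C11_dir_inverse_det; simp add: jmat_def C11_dir_nth bounded_regular)

lemma C11_dir_christoffel: "C11_dir K \<Omega> (\<lambda>J. christoffel_jet J i j l)"
  unfolding christoffel_jet_def koszul_jet_def
  by (intro C11_dir_intros C11_dir_inv_jet C11_dir_nth bounded_regular)

lemma C11_dir_dchristoffel: "C11_dir K \<Omega> (\<lambda>J. dchristoffel_jet J a i j l)"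
  unfolding dchristoffel_jet_def koszul_jet_def dkoszul_jet_def dinv_jet_def
  by (intro C11_dir_intros C11_dir_inv_jet C11_dir_nth bounded_regular)

lemma C11_dir_ric: "C11_dir K \<Omega> (\<lambda>J. ric_jet J i j)"
  unfolding ric_jet_def riem_jet_def
  by (intro C11_dir_intros C11_dir_christoffel C11_dir_dchristoffel)

lemma C11_dir_ric_sq: "C11_dir K \<Omega> ric_sq_jet"
  unfolding ric_sq_jet_def[abs_def]
  by (intro C11_dir_intros C11_dir_ric C11_dir_inv_jet)

lemma C11_dir_scal: "C11_dir K \<Omega> scal_jet"
  unfolding scal_jet_def[abs_def]
  by (intro C11_dir_intros C11_dir_ric C11_dir_inv_jet)

lemma C11_dir_curv: "C11_dir K \<Omega> curv_jet"
  unfolding curv_jet_def[abs_def]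
  by (intro C11_dir_intros C11_dir_ric_sq C11_dir_scal C11_dir_dens)

end

lemma C11_dir_continuous: "C11_dir K \<Omega> p \<Longrightarrow> continuous_on \<Omega> p"
  unfolding C11_dir_def by (auto intro: C11_on_continuous)

lemma continuous_on_jet:
  assumes "\<And>i j. Ck 2 (\<lambda>x. G x $ i $ j)"
  shows "continuous_on S3 (jet G)"
  unfolding jet_def
proof (intro continuous_on_vec_lambda)
  fix c :: "(3 \<times> 3) + (3 \<times> 3 \<times> 3) + (3 \<times> 3 \<times> 3 \<times> 3)"
  note c = Ck_continuous[OF assms]
  show "continuous_on S3 (\<lambda>x. case c of Inl (i, j) \<Rightarrow> G x $ i $ j
     | Inr (Inl (a, i, j)) \<Rightarrow> fderivs [a] (\<lambda>y. G y $ i $ j) x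
     | Inr (Inr (a, b, i, j)) \<Rightarrow> fderivs [a, b] (\<lambda>y. G y $ i $ j) x)"
  proof (cases c)
    case (Inl p)
    then show ?thesis using c[of "[]"] by (cases p) simp
  next
    case (Inr q)
    show ?thesis
    proof (cases q)
      case (Inl p)
      obtain a i j where "p = (a, i, j)" by (cases p) auto
      then show ?thesis using c[of "[a]"] Inl Inr by simp
    next
      case Inr2: (Inr p)
      obtain a b i j where "p = (a, b, i, j)" by (cases p) auto
      then show ?thesis using c[of "[a, b]"] Inr Inr2 by simp
    qed
  qed
qed

section \<open>The curvature of a metric computed from its two-jet\<close>

lemma struct_coeff_sc: "x \<in> S3 \<Longrightarrow> struct_coeff i j k x = sc i j k"
  by (simp add: struct_coeff_values sc_def)

lemma jmat_jet [simp]: "jmat (jet G x) = G x"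
  by (simp add: jmat_def jet_def vec_eq_iff)

context
  fixes G :: "real^4 \<Rightarrow> real^3^3"
  assumes Ck: "\<And>i j. Ck 2 (\<lambda>x. G x $ i $ j)" and det: "\<And>x. x \<in> S3 \<Longrightarrow> det (G x) \<noteq> 0"
begin

lemma ginv_jet:
  assumes "x \<in> S3" shows "ginv G x $ i $ j = inv_jet (jet G x) i j"
  using matrix_inv_adj3[OF det[OF assms]] by (simp add: ginv_def inv_jet_def)

lemma koszul_koszul_jet:
  assumes "x \<in> S3" shows "koszul G i j k x = koszul_jet (jet G x) i j k"
  by (simp add: koszul_def koszul_jet_def struct_coeff_sc[OF assms] jet_def)

lemma christoffel_christoffel_jet:
  assumes "x \<in> S3" shows "christoffel G i j k x = christoffel_jet (jet G x) i j k"
  by (simp add: christoffel_def christoffel_jet_def koszul_koszul_jet ginv_jet assms)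

lemma has_derivative_ginv:
  assumes x: "x \<in> S3"
  shows "((\<lambda>t. ginv G (flow a t x) $ i $ j) has_real_derivative dinv_jet (jet G x) a i j) (at 0)"
proof -
  define A' :: "real^3^3" where "A' = (\<chi> i j. fderivs [a] (\<lambda>y. G y $ i $ j) x)"
  have "((\<lambda>t. matrix_inv (G (flow a t x)) $ i $ j) has_real_derivative
     - (matrix_inv (G (flow a 0 x)) ** A' ** matrix_inv (G (flow a 0 x))) $ i $ j) (at 0)"
    using Ck_has_derivative[OF Ck, of "[]" x] det[OF flow_S3[OF x]]
    by (intro has_derivative_matrix_inv) (simp_all add: x A'_def)
  moreover have "- (matrix_inv (G x) ** A' ** matrix_inv (G x)) $ i $ j = dinv_jet (jet G x) a i j"
    using ginv_jet[OF x, unfolded ginv_def]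
    by (simp add: matrix_matrix_mult_def dinv_jet_def A'_def) (simp add: jet_def)
  ultimately show ?thesis by (simp add: ginv_def)
qed

lemma has_derivative_koszul:
  assumes x: "x \<in> S3"
  shows "((\<lambda>t. koszul G i j k (flow a t x)) has_real_derivative dkoszul_jet (jet G x) a i j k) (at 0)"
proof -
  have d1: "((\<lambda>t. G (flow a t x) $ i $ j) has_real_derivative fderiv a (\<lambda>y. G y $ i $ j) x) (at 0)" for i j
    using Ck_has_derivative[OF Ck, of "[]" x i j a] x by simp
  have d2: "((\<lambda>t. fderiv b (\<lambda>y. G y $ i $ j) (flow a t x)) has_real_derivative
      fderiv a (fderiv b (\<lambda>y. G y $ i $ j)) x) (at 0)" for b i j
    using Ck_has_derivative[OF Ck, of "[b]" x i j a] x by simp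
  have "((\<lambda>t. fderiv i (\<lambda>y. G y $ j $ k) (flow a t x) + fderiv j (\<lambda>y. G y $ i $ k) (flow a t x)
      - fderiv k (\<lambda>y. G y $ i $ j) (flow a t x)
     + (\<Sum>m\<in>UNIV. sc i j m * G (flow a t x) $ m $ k - sc i k m * G (flow a t x) $ m $ j
                   - sc j k m * G (flow a t x) $ m $ i)) has_real_derivative dkoszul_jet (jet G x) a i j k) (at 0)"
    unfolding dkoszul_jet_def
    by (auto intro!: derivative_eq_intros d1 d2 simp: jet_def mult.commute)
  then show ?thesis
    by (simp add: koszul_def struct_coeff_sc[OF flow_S3[OF x]])
qed

lemma fderiv_christoffel:
  assumes x: "x \<in> S3"
  shows "fderiv a (christoffel G i j l) x = dchristoffel_jet (jet G x) a i j l"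
  unfolding fderiv_def
proof (rule DERIV_imp_deriv)
  show "((\<lambda>t. christoffel G i j l (flow a t x)) has_real_derivative dchristoffel_jet (jet G x) a i j l) (at 0)"
    unfolding christoffel_def dchristoffel_jet_def
    by (auto intro!: derivative_eq_intros has_derivative_ginv has_derivative_koszul x
        simp: ginv_jet koszul_koszul_jet x algebra_simps)
qed

lemma ric_ric_jet:
  assumes x: "x \<in> S3"
  shows "ric G x $ j $ k = ric_jet (jet G x) j k"
  by (simp add: ric_def ric_jet_def riem_def riem_jet_def fderiv_christoffel
      christoffel_christoffel_jet struct_coeff_sc x)

lemma ric_sq_ric_sq_jet:
  assumes x: "x \<in> S3"
  shows "inner_g G (ric G) (ric G) x = ric_sq_jet (jet G x)"
  by (simp add: inner_g_def ric_sq_jet_def ginv_jet ric_ric_jet x)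

lemma scal_scal_jet:
  assumes x: "x \<in> S3"
  shows "scal G x = scal_jet (jet G x)"
  by (simp add: scal_def tr_g_def scal_jet_def ginv_jet ric_ric_jet x)

end

lemma vol_jet: "vol g = sphere_integral (\<lambda>x. dens_jet (jet (comps g) x))"
  by (simp add: vol_def integral_g_def dens_jet_def)

text \<open>The regular set makes the integrands continuous on the sphere. This allows them to be
  exchanged with the jet formulas, which agree only on \<open>S3\<close>, and lets the two curvature
  integrals be combined into one.\<close>

lemma F_third_jet:
  assumes Ck: "\<And>i j. Ck 2 (\<lambda>x. comps g x $ i $ j)" and reg: "regular \<Omega>"
    and \<Omega>: "\<And>x. x \<in> S3 \<Longrightarrow> jet (comps g) x \<in> \<Omega>"
  shows "F_third g = sphere_integral (\<lambda>x. dens_jet (jet (comps g) x)) powr (1/3) *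
     sphere_integral (\<lambda>x. curv_jet (jet (comps g) x))"
proof -
  let ?G = "comps g"
  let ?J = "jet (comps g)"
  have det: "det (?G x) \<noteq> 0" if "x \<in> S3" for x
    using reg \<Omega>[OF that] unfolding regular_def by (metis jmat_jet less_irrefl order_less_le_trans)
  have c: "continuous_on S3 (\<lambda>x. p (?J x))" if "C11_dir 0 \<Omega> p" for p
    by (rule continuous_on_compose2[OF C11_dir_continuous[OF that] continuous_on_jet[OF Ck]])
      (use \<Omega> in auto)
  have cr: "continuous_on S3 (\<lambda>x. ric_sq_jet (?J x) * dens_jet (?J x))"
    by (rule c[OF C11_dir_mult[OF C11_dir_ric_sq[OF reg] C11_dir_dens[OF reg]]])
  have cs: "continuous_on S3 (\<lambda>x. (scal_jet (?J x))\<^sup>2 * dens_jet (?J x))"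
    by (rule c[OF C11_dir_mult[OF C11_dir_power[OF C11_dir_scal[OF reg]] C11_dir_dens[OF reg]]])
  have "integral_g ?G (inner_g ?G (ric ?G) (ric ?G)) = sphere_integral (\<lambda>x. ric_sq_jet (?J x) * dens_jet (?J x))"
    unfolding integral_g_def
    by (rule sphere_integral_cong[OF cr, symmetric]) (simp add: ric_sq_ric_sq_jet[OF Ck det] dens_jet_def)
  moreover have "integral_g ?G (\<lambda>x. (scal ?G x)\<^sup>2) = sphere_integral (\<lambda>x. (scal_jet (?J x))\<^sup>2 * dens_jet (?J x))"
    unfolding integral_g_def
    by (rule sphere_integral_cong[OF cs, symmetric]) (simp add: scal_scal_jet[OF Ck det] dens_jet_def)
  moreover have "sphere_integral (\<lambda>x. curv_jet (?J x)) =
     sphere_integral (\<lambda>x. ric_sq_jet (?J x) * dens_jet (?J x))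
     + (1/3) * sphere_integral (\<lambda>x. (scal_jet (?J x))\<^sup>2 * dens_jet (?J x))"
    unfolding curv_jet_def
    using sphere_integral_add[OF cr continuous_on_mult_left[OF cs, of "1/3"]]
    by (simp only: sphere_integral_cmult)
  ultimately show ?thesis
    by (simp add: F_third_def Let_def vol_jet)
qed


section \<open>Left-invariant metrics\<close>

lemma const_jet_nth [simp]: "const_jet A $ Inl (i, j) = A $ i $ j" "const_jet A $ Inr c = 0"
  by (simp_all add: const_jet_def)

lemma jmat_const_jet [simp]: "jmat (const_jet A) = A"
  by (simp add: jmat_def vec_eq_iff)

lemma num3: "(2::3) + 2 = 1" "(2::3) + 1 = 3" "(3::3) + 1 = 1" "(3::3) + 2 = 2" "(1::3) + 1 = 2" "(1::3) + 2 = 3"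
  by simp_all

lemma adj3_values:
  "adj3 A 1 1 = A $ 2 $ 2 * A $ 3 $ 3 - A $ 2 $ 3 * A $ 3 $ 2"
  "adj3 A 1 2 = A $ 3 $ 2 * A $ 1 $ 3 - A $ 3 $ 3 * A $ 1 $ 2"
  "adj3 A 1 3 = A $ 1 $ 2 * A $ 2 $ 3 - A $ 1 $ 3 * A $ 2 $ 2"
  "adj3 A 2 1 = A $ 2 $ 3 * A $ 3 $ 1 - A $ 2 $ 1 * A $ 3 $ 3"
  "adj3 A 2 2 = A $ 3 $ 3 * A $ 1 $ 1 - A $ 3 $ 1 * A $ 1 $ 3"
  "adj3 A 2 3 = A $ 1 $ 3 * A $ 2 $ 1 - A $ 1 $ 1 * A $ 2 $ 3"
  "adj3 A 3 1 = A $ 2 $ 1 * A $ 3 $ 2 - A $ 2 $ 2 * A $ 3 $ 1"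
  "adj3 A 3 2 = A $ 3 $ 1 * A $ 1 $ 2 - A $ 3 $ 2 * A $ 1 $ 1"
  "adj3 A 3 3 = A $ 1 $ 1 * A $ 2 $ 2 - A $ 1 $ 2 * A $ 2 $ 1"
  by (simp_all only: adj3_def num3)

lemma sc_values:
  "sc 1 1 1 = 0" "sc 1 1 2 = 0" "sc 1 1 3 = 0" "sc 1 2 1 = 0" "sc 1 2 2 = 0" "sc 1 2 3 = 2" "sc 1 3 1 = 0" "sc 1 3 2 = - 2" "sc 1 3 3 = 0"
  "sc 2 1 1 = 0" "sc 2 1 2 = 0" "sc 2 1 3 = - 2" "sc 2 2 1 = 0" "sc 2 2 2 = 0" "sc 2 2 3 = 0" "sc 2 3 1 = 2" "sc 2 3 2 = 0" "sc 2 3 3 = 0"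
  "sc 3 1 1 = 0" "sc 3 1 2 = 2" "sc 3 1 3 = 0" "sc 3 2 1 = - 2" "sc 3 2 2 = 0" "sc 3 2 3 = 0" "sc 3 3 1 = 0" "sc 3 3 2 = 0" "sc 3 3 3 = 0"
  by (simp_all add: sc_def)

section \<open>Curvature of constant matrices through their invariants\<close>

definition tr3 :: "real^3^3 \<Rightarrow> real" where
  "tr3 A = A $ 1 $ 1 + A $ 2 $ 2 + A $ 3 $ 3"

definition minors3 :: "real^3^3 \<Rightarrow> real" where
  "minors3 A = A $ 1 $ 1 * A $ 2 $ 2 + A $ 2 $ 2 * A $ 3 $ 3 + A $ 3 $ 3 * A $ 1 $ 1
     - A $ 1 $ 2 * A $ 2 $ 1 - A $ 2 $ 3 * A $ 3 $ 2 - A $ 3 $ 1 * A $ 1 $ 3"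

text \<open>For constant \<open>G = diag (a, b, c)\<close> with trace \<open>s\<close>, second invariant \<open>q\<close> and determinant \<open>p\<close>,
  Milnor's formula gives the Ricci eigenvalues \<open>2 \<mu>_j \<mu>_k\<close> with \<open>\<mu>_i = (s - 2 a_i) / sqrt p\<close>, so
  \<open>|Ric|^2 + R^2 / 3 = curv_poly s q p / p^2\<close>.\<close>

definition curv_poly :: "real \<Rightarrow> real \<Rightarrow> real \<Rightarrow> real" where
  "curv_poly s q p = (16/3) * (4 * q - s\<^sup>2)\<^sup>2 - 8 * s * (4 * q * s - s^3 - 8 * p)"

text \<open>For \<open>z = 1 / D\<close>. The structure constant term of the curvature carries one
  factor \<open>z\<close> where the quadratic terms carry two; writing \<open>z\<close> as
  \<open>z^2 * D\<close> gives all of them the common factor \<open>z^2\<close> and leaves a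
  polynomial.\<close>

lemma scale_identity:
  fixes z p q r t u D :: real
  assumes "z * (z * D) = z"
  shows "z * p * (z * q) - z * r * (z * t) - 2 * (z * u) = z\<^sup>2 * (p * q - r * t - 2 * D * u)"
proof -
  have "z * p * (z * q) - z * r * (z * t) - 2 * (z * u) = z * p * (z * q) - z * r * (z * t) - 2 * (z * (z * D) * u)"
    unfolding assms by (rule refl)
  also have "\<dots> = z\<^sup>2 * (p * q - r * t - 2 * D * u)"
    unfolding power2_eq_square
    by (simp only: right_diff_distrib mult.assoc mult.left_commute)
  finally show ?thesis .
qed

context
  fixes A :: "real^3^3" and a b c d e f \<delta> :: real
  assumes A: "A $ 1 $ 1 = a" "A $ 2 $ 2 = b" "A $ 3 $ 3 = c" "A $ 1 $ 2 = d" "A $ 2 $ 1 = d"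
    "A $ 1 $ 3 = e" "A $ 3 $ 1 = e" "A $ 2 $ 3 = f" "A $ 3 $ 2 = f"
    and det: "det A \<noteq> 0" and \<delta>: "\<delta> = inverse (det A)"
begin

text \<open>The Christoffel symbols multiplied by \<open>2 * det A\<close>, hence polynomial in the
  entries of \<open>A\<close>.\<close>

definition conn_poly :: "3 \<Rightarrow> 3 \<Rightarrow> 3 \<Rightarrow> real" where
  "conn_poly i j l = (\<Sum>k\<in>UNIV. adj3 A l k * koszul_jet (const_jet A) i j k)"

lemma christoffel_const_jet: "christoffel_jet (const_jet A) i j l = (1/2) * \<delta> * conn_poly i j l"
  by (simp add: christoffel_jet_def conn_poly_def inv_jet_def \<delta> sum_distrib_left algebra_simps)

lemma dchristoffel_const_jet: "dchristoffel_jet (const_jet A) i j k l = 0"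
  by (simp add: dchristoffel_jet_def dkoszul_jet_def dinv_jet_def)

lemma det_explicit: "det A = a * b * c + 2 * d * e * f - a * f^2 - b * e^2 - c * d^2"
  by (simp add: det_3 A power2_eq_square algebra_simps)

text \<open>Tabulated so that the Ricci formula becomes, entry by entry, a polynomial identity in
  the six independent entries of a symmetric matrix.\<close>

lemma conn_values:
  "conn_poly 1 1 1 = - 4 * e^2 * f + 4 * d^2 * f + 4 * c * d * e - 4 * b * d * e"
  "conn_poly 1 1 2 = 4 * e^3 + 4 * d^2 * e - 4 * a * d * f - 4 * a * c * e"
  "conn_poly 1 1 3 = - 4 * d * e^2 - 4 * d^3 + 4 * a * e * f + 4 * a * b * d"
  "conn_poly 1 2 1 = - 4 * e * f^2 + 2 * c * d * f + 2 * b * d * f + 2 * b * c * e - 2 * b^2 * e - 2 * a * d * f + 2 * a * b * e"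
  "conn_poly 1 2 2 = 4 * e^2 * f - 2 * c * d * e + 2 * b * d * e - 2 * a * d * e - 2 * a * c * f - 2 * a * b * f + 2 * a^2 * f"
  "conn_poly 1 2 3 = 4 * d * e * f - 2 * c * d^2 - 4 * b * e^2 - 2 * b * d^2 + 2 * a * d^2 + 2 * a * b * c + 2 * a * b^2 - 2 * a^2 * b"
  "conn_poly 1 3 1 = 4 * d * f^2 - 2 * c * e * f + 2 * c^2 * d - 2 * b * e * f - 2 * b * c * d + 2 * a * e * f - 2 * a * c * d"
  "conn_poly 1 3 2 = - 4 * d * e * f + 2 * c * e^2 + 4 * c * d^2 + 2 * b * e^2 - 2 * a * e^2 - 2 * a * c^2 - 2 * a * b * c + 2 * a^2 * c"
  "conn_poly 1 3 3 = - 4 * d^2 * f - 2 * c * d * e + 2 * b * d * e + 2 * a * d * e + 2 * a * c * f + 2 * a * b * f - 2 * a^2 * f"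
  "conn_poly 2 1 1 = - 4 * e * f^2 + 2 * c * d * f + 2 * b * d * f + 2 * b * c * e - 2 * b^2 * e - 2 * a * d * f + 2 * a * b * e"
  "conn_poly 2 1 2 = 4 * e^2 * f - 2 * c * d * e + 2 * b * d * e - 2 * a * d * e - 2 * a * c * f - 2 * a * b * f + 2 * a^2 * f"
  "conn_poly 2 1 3 = - 4 * d * e * f + 2 * c * d^2 - 2 * b * d^2 + 4 * a * f^2 + 2 * a * d^2 - 2 * a * b * c + 2 * a * b^2 - 2 * a^2 * b"
  "conn_poly 2 2 1 = - 4 * f^3 - 4 * d^2 * f + 4 * b * d * e + 4 * b * c * f"
  "conn_poly 2 2 2 = 4 * e * f^2 - 4 * d^2 * e - 4 * c * d * f + 4 * a * d * f"
  "conn_poly 2 2 3 = 4 * d * f^2 + 4 * d^3 - 4 * b * e * f - 4 * a * b * d"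
  "conn_poly 2 3 1 = 4 * d * e * f - 2 * c * f^2 - 4 * c * d^2 + 2 * b * f^2 + 2 * b * c^2 - 2 * b^2 * c - 2 * a * f^2 + 2 * a * b * c"
  "conn_poly 2 3 2 = - 4 * d * e^2 + 2 * c * e * f - 2 * c^2 * d - 2 * b * e * f + 2 * b * c * d + 2 * a * e * f + 2 * a * c * d"
  "conn_poly 2 3 3 = 4 * d^2 * e + 2 * c * d * f - 2 * b * d * f - 2 * b * c * e + 2 * b^2 * e - 2 * a * d * f - 2 * a * b * e"
  "conn_poly 3 1 1 = 4 * d * f^2 - 2 * c * e * f + 2 * c^2 * d - 2 * b * e * f - 2 * b * c * d + 2 * a * e * f - 2 * a * c * d"
  "conn_poly 3 1 2 = 4 * d * e * f + 2 * c * e^2 - 2 * b * e^2 - 4 * a * f^2 - 2 * a * e^2 - 2 * a * c^2 + 2 * a * b * c + 2 * a^2 * c"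
  "conn_poly 3 1 3 = - 4 * d^2 * f - 2 * c * d * e + 2 * b * d * e + 2 * a * d * e + 2 * a * c * f + 2 * a * b * f - 2 * a^2 * f"
  "conn_poly 3 2 1 = - 4 * d * e * f - 2 * c * f^2 + 2 * b * f^2 + 4 * b * e^2 + 2 * b * c^2 - 2 * b^2 * c + 2 * a * f^2 - 2 * a * b * c"
  "conn_poly 3 2 2 = - 4 * d * e^2 + 2 * c * e * f - 2 * c^2 * d - 2 * b * e * f + 2 * b * c * d + 2 * a * e * f + 2 * a * c * d"
  "conn_poly 3 2 3 = 4 * d^2 * e + 2 * c * d * f - 2 * b * d * f - 2 * b * c * e + 2 * b^2 * e - 2 * a * d * f - 2 * a * b * e"
  "conn_poly 3 3 1 = 4 * f^3 + 4 * e^2 * f - 4 * c * d * e - 4 * b * c * f"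
  "conn_poly 3 3 2 = - 4 * e * f^2 - 4 * e^3 + 4 * c * d * f + 4 * a * c * e"
  "conn_poly 3 3 3 = - 4 * d * f^2 + 4 * d * e^2 + 4 * b * e * f - 4 * a * e * f"
  by (simp_all add: conn_poly_def koszul_jet_def sum_3 sc_def adj3_values A power2_eq_square power3_eq_cube algebra_simps)

text \<open>The adjugate of \<open>tr A - 2 A\<close>: the Ricci endomorphism is \<open>2 / det A\<close> times this matrix.\<close>

definition ric_end :: "3 \<Rightarrow> 3 \<Rightarrow> real" where
  "ric_end i j = (\<chi> i j. adj3 (\<chi> i j. (if i = j then tr3 A else 0) - 2 * A $ i $ j) i j) $ i $ j"

lemma ric_end_values:
  "ric_end 1 1 = - 4 * f^2 - c^2 + 2 * b * c - b^2 + a^2"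
  "ric_end 1 2 = 4 * e * f - 2 * c * d + 2 * b * d + 2 * a * d"
  "ric_end 1 3 = 4 * d * f + 2 * c * e - 2 * b * e + 2 * a * e"
  "ric_end 2 1 = 4 * e * f - 2 * c * d + 2 * b * d + 2 * a * d"
  "ric_end 2 2 = - 4 * e^2 - c^2 + b^2 + 2 * a * c - a^2"
  "ric_end 2 3 = 4 * d * e + 2 * c * f + 2 * b * f - 2 * a * f"
  "ric_end 3 1 = 4 * d * f + 2 * c * e - 2 * b * e + 2 * a * e"
  "ric_end 3 2 = 4 * d * e + 2 * c * f + 2 * b * f - 2 * a * f"
  "ric_end 3 3 = - 4 * d^2 + c^2 - b^2 + 2 * a * b - a^2"
  by (simp_all add: ric_end_def adj3_values tr3_def A power2_eq_square algebra_simps)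

text \<open>The left side is \<open>4 * (det A)^2\<close> times the Ricci tensor. As
  \<open>sc\<close> is invariant under rotations of the frame, the formula is forced by Milnor's
  diagonal case, in which the adjugate of \<open>tr A - 2 A\<close> has the diagonal entries
  \<open>(s - 2 a_j) * (s - 2 a_k)\<close>. The nine entries are verified directly.\<close>

lemma ric_identity:
  "(\<Sum>l\<in>UNIV. \<Sum>m\<in>UNIV. conn_poly i j m * conn_poly l m l - conn_poly l j m * conn_poly i m l
       - 2 * det A * (sc l i m * conn_poly m j l))
     = 8 * det A * (\<Sum>k\<in>UNIV. A $ i $ k * ric_end k j)" (is "?P i j")
proof -
  have "\<forall>i j. ?P i j"
    unfolding forall_3
    by (intro conjI; simp only: sum_3 conn_values sc_values ric_end_values A det_explicit; algebra)
  then show ?thesis by blast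
qed

lemma ric_const_jet:
  "ric_jet (const_jet A) i j = 2 * \<delta> * (\<Sum>k\<in>UNIV. A $ i $ k * ric_end k j)"
proof -
  let ?N = conn_poly
  have \<delta>2: "\<delta> * (\<delta> * det A) = \<delta>" using det by (simp add: \<delta>)
  have t: "\<delta> * p * (\<delta> * q) - \<delta> * r * (\<delta> * t) - 2 * (\<delta> * u) = \<delta>\<^sup>2 * (p * q - r * t - 2 * det A * u)"
    for p q r t u
    by (rule scale_identity[OF \<delta>2])
  have "4 * ric_jet (const_jet A) i j = (\<Sum>l\<in>UNIV. \<Sum>m\<in>UNIV. \<delta> * ?N i j m * (\<delta> * ?N l m l)
      - \<delta> * ?N l j m * (\<delta> * ?N i m l) - 2 * (\<delta> * (sc l i m * ?N m j l)))"
    by (simp add: ric_jet_def riem_jet_def dchristoffel_const_jet christoffel_const_jet sum_distrib_left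
        right_diff_distrib mult.assoc mult.left_commute[of "sc _ _ _"])
  also have "\<dots> = \<delta>\<^sup>2 * (\<Sum>l\<in>UNIV. \<Sum>m\<in>UNIV. ?N i j m * ?N l m l - ?N l j m * ?N i m l
       - 2 * det A * (sc l i m * ?N m j l))"
    by (simp only: t sum_distrib_left)
  also have "\<dots> = 8 * (\<delta> * (\<delta> * det A)) * (\<Sum>k\<in>UNIV. A $ i $ k * ric_end k j)"
    unfolding ric_identity by (simp add: power2_eq_square)
  finally show ?thesis by (simp only: \<delta>2)
qed

lemma ric_const_jet_sym: "ric_jet (const_jet A) i j = ric_jet (const_jet A) j i"
proof -
  have "(\<Sum>k\<in>UNIV. A $ i $ k * ric_end k j) = (\<Sum>k\<in>UNIV. A $ j $ k * ric_end k i)"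
    using exhaust_3[of i] exhaust_3[of j]
    by (elim disjE; simp add: sum_3 ric_end_def adj3_values tr3_def A; simp add: algebra_simps)
  then show ?thesis by (simp only: ric_const_jet)
qed

lemma inv_const_jet: "inv_jet (const_jet A) i j = matrix_inv A $ i $ j"
  by (simp add: matrix_inv_adj3[OF det] inv_jet_def)

lemma inv_const_jet_sym: "inv_jet (const_jet A) i j = inv_jet (const_jet A) j i"
  using exhaust_3[of i] exhaust_3[of j]
  by (elim disjE; simp add: inv_jet_def adj3_values A)

lemma ric_end_eq: "(\<Sum>k\<in>UNIV. inv_jet (const_jet A) i k * ric_jet (const_jet A) k j) = 2 * \<delta> * ric_end i j"
proof -
  define E :: "real^3^3" where "E = (\<chi> i j. 2 * \<delta> * ric_end i j)"
  have "(A ** E) $ i $ j = ric_jet (const_jet A) i j" for i j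
    by (simp add: E_def matrix_matrix_mult_def ric_const_jet sum_distrib_left mult.left_commute)
  then have "(matrix_inv A ** (A ** E)) $ i $ j = (\<Sum>k\<in>UNIV. inv_jet (const_jet A) i k * ric_jet (const_jet A) k j)"
    by (simp add: matrix_matrix_mult_def[of "matrix_inv A"] inv_const_jet)
  moreover have "matrix_inv A ** (A ** E) = E"
    by (simp add: matrix_mul_assoc matrix_inv_left3[OF det])
  ultimately show ?thesis by (simp add: E_def)
qed

lemma tr_ric_end: "(\<Sum>i\<in>UNIV. ric_end i i) = 4 * minors3 A - (tr3 A)\<^sup>2"
  by (simp add: sum_3 ric_end_def adj3_values tr3_def minors3_def A power2_eq_square algebra_simps)

text \<open>Let \<open>e1, e2, e3\<close> be the elementary symmetric functions of the eigenvalues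
  of \<open>tr A - 2 A\<close>. Its adjugate has their pairwise products as eigenvalues, so the
  adjugate has trace \<open>e2\<close>, and its square has trace \<open>e2^2 - 2 e1 e3\<close>. Here
  \<open>e1 = s\<close>, \<open>e2 = 4 q - s^2\<close> and
  \<open>e3 = 4 q s - s^3 - 8 p\<close>.\<close>

lemma tr_ric_end_sq: "(\<Sum>i\<in>UNIV. \<Sum>j\<in>UNIV. ric_end i j * ric_end j i) = (4 * minors3 A - (tr3 A)\<^sup>2)\<^sup>2
    - 2 * tr3 A * (4 * minors3 A * tr3 A - (tr3 A)^3 - 8 * det A)"
  by (simp only: sum_3 ric_end_values tr3_def minors3_def A det_explicit) algebra

lemma scal_const_jet: "scal_jet (const_jet A) = 2 * \<delta> * (4 * minors3 A - (tr3 A)\<^sup>2)"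
proof -
  have "scal_jet (const_jet A) = (\<Sum>i\<in>UNIV. \<Sum>j\<in>UNIV. inv_jet (const_jet A) i j * ric_jet (const_jet A) j i)"
    unfolding scal_jet_def by (intro sum.cong refl arg_cong2[where f = "(*)"] ric_const_jet_sym)
  then show ?thesis by (simp only: ric_end_eq sum_distrib_left[symmetric] tr_ric_end)
qed

text \<open>The squared norm of Ricci is the trace of the square of the endomorphism
  \<open>g^(-1) Ric\<close>; symmetry of both factors lets the fourfold sum be regrouped into that
  product.\<close>

lemma ric_sq_const_jet: "ric_sq_jet (const_jet A) = 4 * \<delta>\<^sup>2 * ((4 * minors3 A - (tr3 A)\<^sup>2)\<^sup>2
    - 2 * tr3 A * (4 * minors3 A * tr3 A - (tr3 A)^3 - 8 * det A))"
proof -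
  let ?g = "inv_jet (const_jet A)" and ?R = "ric_jet (const_jet A)"
  have "ric_sq_jet (const_jet A) = (\<Sum>i\<in>UNIV. \<Sum>j\<in>UNIV. \<Sum>k\<in>UNIV. \<Sum>l\<in>UNIV. (?g k i * ?R i j) * (?g j l * ?R l k))"
    unfolding ric_sq_jet_def
    by (intro sum.cong refl) (metis (no_types, lifting) inv_const_jet_sym ric_const_jet_sym mult.assoc mult.left_commute)
  also have "\<dots> = (\<Sum>j\<in>UNIV. \<Sum>k\<in>UNIV. (\<Sum>i\<in>UNIV. ?g k i * ?R i j) * (\<Sum>l\<in>UNIV. ?g j l * ?R l k))"
    unfolding sum_product by (rule trans[OF sum.swap sum.cong[OF refl sum.swap]])
  also have "\<dots> = 4 * \<delta>\<^sup>2 * (\<Sum>i\<in>UNIV. \<Sum>j\<in>UNIV. ric_end i j * ric_end j i)"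
    by (simp only: ric_end_eq sum_distrib_left) (simp add: power2_eq_square mult_ac)
  finally show ?thesis by (simp only: tr_ric_end_sq)
qed

lemma curv_const_jet_aux:
  "curv_jet (const_jet A) = curv_poly (tr3 A) (minors3 A) (det A) * \<delta>\<^sup>2 * sqrt (det A)"
proof -
  have "4 * u\<^sup>2 * (q\<^sup>2 - 2 * s * r) * w + 1/3 * ((2 * u * q)\<^sup>2 * w) = ((16/3) * q\<^sup>2 - 8 * s * r) * u\<^sup>2 * w"
    for q s r w u :: real
    by (simp add: power2_eq_square algebra_simps)
  then show ?thesis
    by (simp only: curv_jet_def dens_jet_def scal_const_jet ric_sq_const_jet curv_poly_def jmat_const_jet)
qed

end

lemma curv_const_jet:
  assumes "\<And>i j. A $ i $ j = A $ j $ i" "det A \<noteq> 0"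
  shows "curv_jet (const_jet A) = curv_poly (tr3 A) (minors3 A) (det A) * (inverse (det A))\<^sup>2 * sqrt (det A)"
  by (rule curv_const_jet_aux[OF refl refl refl refl _ refl _ refl _ assms(2) refl]) (rule assms(1))+

lemma dens_const_jet: "dens_jet (const_jet A) = sqrt (det A)"
  by (simp add: dens_jet_def)


section \<open>Sphere averages of functions of jets\<close>

lemma linear_vec_expand:
  fixes l :: "real^'n \<Rightarrow> real"
  assumes "linear l"
  shows "l v = (\<Sum>c\<in>UNIV. l (axis c 1) * v $ c)"
proof -
  have "l v = l (\<Sum>c\<in>UNIV. v $ c *\<^sub>R axis c 1)"
    using basis_expansion[of v] by (simp add: scalar_mult_eq_scaleR)
  then show ?thesis
    by (simp add: linear_sum[OF assms] linear_cmul[OF assms] mult.commute)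
qed

lemma continuous_on_linear_comp:
  fixes l :: "'a::euclidean_space \<Rightarrow> real"
  assumes "linear l" "continuous_on S J"
  shows "continuous_on S (\<lambda>x. l (J x))"
  by (rule bounded_linear.continuous_on[OF _ assms(2)]) (use assms(1) linear_conv_bounded_linear in blast)

lemma sphere_integral_linear:
  fixes J :: "real^4 \<Rightarrow> real^'n"
  assumes J: "continuous_on S3 J" and l: "linear l"
  shows "sphere_integral (\<lambda>x. l (J x)) = l (\<chi> c. sphere_integral (\<lambda>x. J x $ c))"
proof -
  have "continuous_on S3 (\<lambda>x. J x $ c)" for c by (intro continuous_intros J)
  then show ?thesis
    by (subst linear_vec_expand[OF l], subst sphere_integral_sum)
      (auto simp: sphere_integral_cmult linear_vec_expand[OF l, of "\<chi> c. _ c"] intro!: continuous_on_mult_left)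
qed

text \<open>The first order Taylor term integrates to zero because \<open>m\<close> is the mean of \<open>J\<close>.\<close>

lemma sphere_integral_mean_value:
  fixes p :: "real^'n \<Rightarrow> real"
  assumes p: "C11_on \<Omega> p D"
  obtains C where "C \<ge> 0" and "\<And>J m \<rho>. continuous_on S3 J \<Longrightarrow> (\<And>x. x \<in> S3 \<Longrightarrow> J x \<in> \<Omega>) \<Longrightarrow> m \<in> \<Omega> \<Longrightarrow>
     (\<And>c. sphere_integral (\<lambda>x. J x $ c) = sphere_area * m $ c) \<Longrightarrow>
     (\<And>x. x \<in> S3 \<Longrightarrow> norm (J x - m) \<le> \<rho>) \<Longrightarrow>
     \<bar>sphere_integral (\<lambda>x. p (J x)) - sphere_area * p m\<bar> \<le> C * \<rho>\<^sup>2"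
proof -
  obtain C where C: "C \<ge> 0" "\<And>x. x \<in> \<Omega> \<Longrightarrow> linear (D x)"
    "\<And>x y. x \<in> \<Omega> \<Longrightarrow> y \<in> \<Omega> \<Longrightarrow> \<bar>p y - p x - D x (y - x)\<bar> \<le> C * (norm (y - x))\<^sup>2"
    using C11_onE[OF p] by metis
  show ?thesis
  proof (rule that[of "C * sphere_area"])
    show "0 \<le> C * sphere_area" using C(1) sphere_area_pos by simp
    fix J m \<rho>
    assume J: "continuous_on S3 J" and J\<Omega>: "\<And>x. x \<in> S3 \<Longrightarrow> J x \<in> \<Omega>" and m: "m \<in> \<Omega>"
      and mean: "\<And>c. sphere_integral (\<lambda>x. J x $ c) = sphere_area * m $ c"
      and \<rho>: "\<And>x. x \<in> S3 \<Longrightarrow> norm (J x - m) \<le> \<rho>"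
    have lin: "linear (D m)" using C(2)[OF m] .
    have cp: "continuous_on S3 (\<lambda>x. p (J x))"
      by (rule continuous_on_compose2[OF C11_on_continuous[OF p] J]) (use J\<Omega> in auto)
    have cl: "continuous_on S3 (\<lambda>x. D m (J x))"
      by (rule continuous_on_linear_comp[OF lin J])
    have "(\<chi> c. sphere_integral (\<lambda>x. J x $ c)) = sphere_area *\<^sub>R m"
      by (simp add: mean vec_eq_iff)
    then have iD: "sphere_integral (\<lambda>x. D m (J x)) = sphere_area * D m m"
      by (simp add: sphere_integral_linear[OF J lin] linear_cmul[OF lin])
    have e: "p (J x) - p m - D m (J x - m) = p (J x) - (D m (J x) + (p m - D m m))" for x
      by (simp add: linear_diff[OF lin])
    have "sphere_integral (\<lambda>x. p (J x) - p m - D m (J x - m))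
        = sphere_integral (\<lambda>x. p (J x)) - sphere_area * p m"
      unfolding e
      by (subst sphere_integral_diff[OF cp], intro continuous_intros cl,
          subst sphere_integral_add[OF cl], intro continuous_intros)
        (simp add: iD sphere_integral_const algebra_simps)
    moreover have "\<bar>sphere_integral (\<lambda>x. p (J x) - p m - D m (J x - m))\<bar> \<le> (C * \<rho>\<^sup>2) * sphere_area"
    proof (rule sphere_integral_abs_le)
      show "continuous_on S3 (\<lambda>x. p (J x) - p m - D m (J x - m))"
        unfolding e by (intro continuous_intros cp cl)
      fix x :: "real^4" assume x: "x \<in> S3"
      have "\<bar>p (J x) - p m - D m (J x - m)\<bar> \<le> C * (norm (J x - m))\<^sup>2"
        by (rule C(3)[OF m J\<Omega>[OF x]])
      also have "\<dots> \<le> C * \<rho>\<^sup>2"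
        using \<rho>[OF x] C(1) by (intro mult_left_mono power_mono) auto
      finally show "\<bar>p (J x) - p m - D m (J x - m)\<bar> \<le> C * \<rho>\<^sup>2" .
    qed
    ultimately show "\<bar>sphere_integral (\<lambda>x. p (J x)) - sphere_area * p m\<bar> \<le> C * sphere_area * \<rho>\<^sup>2"
      by (simp add: mult_ac)
  qed
qed

lemma has_real_derivative_remainder:
  fixes f :: "real \<Rightarrow> real"
  assumes "\<forall>\<^sub>F t in at 0. \<bar>f t - f 0 - t * L\<bar> \<le> \<bar>t\<bar> * r t" and "(r \<longlongrightarrow> 0) (at 0)"
  shows "(f has_real_derivative L) (at 0)"
proof -
  have "\<forall>\<^sub>F t in at 0. norm ((f t - f 0) / t - L) \<le> r t"
    using assms(1) eventually_neq_at_within[of 0 0 UNIV]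
  proof eventually_elim
    case (elim t)
    then have "(f t - f 0) / t - L = (f t - f 0 - t * L) / t" by (simp add: field_simps)
    then show ?case using elim by (simp add: abs_divide divide_le_eq mult.commute)
  qed
  then have "((\<lambda>t. (f t - f 0) / t - L) \<longlongrightarrow> 0) (at 0)"
    by (rule Lim_null_comparison[OF _ assms(2)])
  then show ?thesis by (simp add: has_field_derivative_iff LIM_zero_iff)
qed

lemma C11_on_directional_derivative:
  assumes p: "C11_on \<Omega> p D" and x: "x \<in> \<Omega>" and ev: "\<forall>\<^sub>F t in at 0. x + t *\<^sub>R v \<in> \<Omega>"
  shows "((\<lambda>t. p (x + t *\<^sub>R v)) has_real_derivative D x v) (at 0)"
proof -
  obtain C where C: "C \<ge> 0" "\<And>x. x \<in> \<Omega> \<Longrightarrow> linear (D x)"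
    "\<And>x y. x \<in> \<Omega> \<Longrightarrow> y \<in> \<Omega> \<Longrightarrow> \<bar>p y - p x - D x (y - x)\<bar> \<le> C * (norm (y - x))\<^sup>2"
    using C11_onE[OF p] by metis
  show ?thesis
  proof (rule has_real_derivative_remainder)
    show "\<forall>\<^sub>F t in at 0. \<bar>p (x + t *\<^sub>R v) - p (x + 0 *\<^sub>R v) - t * D x v\<bar> \<le> \<bar>t\<bar> * (C * \<bar>t\<bar> * (norm v)\<^sup>2)"
      using ev
    proof eventually_elim
      case (elim t)
      then show ?case
        using C(3)[OF x elim] by (simp add: linear_cmul[OF C(2)[OF x]] power2_eq_square mult_ac)
    qed
    show "((\<lambda>t. C * \<bar>t\<bar> * (norm v)\<^sup>2) \<longlongrightarrow> 0) (at 0)"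
      by (auto intro!: tendsto_eq_intros)
  qed
qed

text \<open>Differentiation under the integral sign: the quadratic remainder of \<open>p\<close> and
  the remainder \<open>|t| * r t\<close> of the jets are both uniform in \<open>x\<close>, so the
  integrated error is \<open>o(t)\<close>. Continuity of \<open>D (J 0 x) (k x)\<close> in
  \<open>x\<close> is a hypothesis because \<open>C11_on\<close> does not assert continuity of
  \<open>D\<close>.\<close>

lemma sphere_integral_has_derivative:
  fixes J :: "real \<Rightarrow> real^4 \<Rightarrow> real^'n"
  assumes p: "C11_on \<Omega> p D"
    and J0: "continuous_on S3 (J 0)" "\<And>x. x \<in> S3 \<Longrightarrow> J 0 x \<in> \<Omega>"
    and Jt: "\<forall>\<^sub>F t in at 0. continuous_on S3 (J t) \<and> (\<forall>x\<in>S3. J t x \<in> \<Omega>)"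
    and k: "\<And>x. x \<in> S3 \<Longrightarrow> norm (k x) \<le> B" "continuous_on S3 (\<lambda>x. D (J 0 x) (k x))"
    and r: "\<forall>\<^sub>F t in at 0. \<forall>x\<in>S3. norm (J t x - J 0 x - t *\<^sub>R k x) \<le> \<bar>t\<bar> * r t" "(r \<longlongrightarrow> 0) (at 0)"
  shows "((\<lambda>t. sphere_integral (\<lambda>x. p (J t x))) has_real_derivative
     sphere_integral (\<lambda>x. D (J 0 x) (k x))) (at 0)"
proof -
  obtain C where C: "C \<ge> 0" "\<And>x. x \<in> \<Omega> \<Longrightarrow> linear (D x)"
    "\<And>x v. x \<in> \<Omega> \<Longrightarrow> \<bar>D x v\<bar> \<le> C * norm v"
    "\<And>x y. x \<in> \<Omega> \<Longrightarrow> y \<in> \<Omega> \<Longrightarrow> \<bar>p y - p x - D x (y - x)\<bar> \<le> C * (norm (y - x))\<^sup>2"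
    using C11_onE[OF p] by metis
  have cp: "continuous_on S3 (\<lambda>x. p (j x))" if "continuous_on S3 j" "\<And>x. x \<in> S3 \<Longrightarrow> j x \<in> \<Omega>" for j
    by (rule continuous_on_compose2[OF C11_on_continuous[OF p] that(1)]) (use that(2) in auto)
  show ?thesis
  proof (rule has_real_derivative_remainder)
    show "\<forall>\<^sub>F t in at 0. \<bar>sphere_integral (\<lambda>x. p (J t x)) - sphere_integral (\<lambda>x. p (J 0 x))
        - t * sphere_integral (\<lambda>x. D (J 0 x) (k x))\<bar>
      \<le> \<bar>t\<bar> * ((C * (\<bar>t\<bar> * (B + r t)\<^sup>2) + C * r t) * sphere_area)"
      using Jt r(1)
    proof eventually_elim
      case (elim t)
      have cJ: "continuous_on S3 (\<lambda>x. p (J t x))" "continuous_on S3 (\<lambda>x. p (J 0 x))"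
        using elim J0 cp by auto
      have "\<bar>sphere_integral (\<lambda>x. p (J t x) - p (J 0 x) - t * D (J 0 x) (k x))\<bar>
         \<le> (C * (\<bar>t\<bar> * (B + r t))\<^sup>2 + C * (\<bar>t\<bar> * r t)) * sphere_area"
      proof (rule sphere_integral_abs_le)
        show "continuous_on S3 (\<lambda>x. p (J t x) - p (J 0 x) - t * D (J 0 x) (k x))"
          by (intro continuous_intros cJ k(2))
        fix x :: "real^4" assume x: "x \<in> S3"
        define u where "u = J t x - J 0 x"
        have rem: "norm (u - t *\<^sub>R k x) \<le> \<bar>t\<bar> * r t" using elim x by (simp add: u_def)
        have "norm u \<le> norm (u - t *\<^sub>R k x) + norm (t *\<^sub>R k x)"
          using norm_triangle_ineq[of "u - t *\<^sub>R k x" "t *\<^sub>R k x"] by simp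
        also have "\<dots> \<le> \<bar>t\<bar> * r t + \<bar>t\<bar> * B"
          using rem k(1)[OF x] by (simp add: add_mono mult_left_mono)
        finally have u: "norm u \<le> \<bar>t\<bar> * (B + r t)" by (simp add: algebra_simps)
        have "\<bar>p (J t x) - p (J 0 x) - D (J 0 x) u\<bar> \<le> C * (norm u)\<^sup>2"
          using C(4)[OF J0(2)[OF x], of "J t x"] elim x by (simp add: u_def)
        also have "\<dots> \<le> C * (\<bar>t\<bar> * (B + r t))\<^sup>2"
          using u C(1) by (intro mult_left_mono power_mono) auto
        finally have 1: "\<bar>p (J t x) - p (J 0 x) - D (J 0 x) u\<bar> \<le> C * (\<bar>t\<bar> * (B + r t))\<^sup>2" .
        have "D (J 0 x) u - t * D (J 0 x) (k x) = D (J 0 x) (u - t *\<^sub>R k x)"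
          by (simp add: linear_diff linear_cmul C(2)[OF J0(2)[OF x]])
        then have "\<bar>D (J 0 x) u - t * D (J 0 x) (k x)\<bar> \<le> C * norm (u - t *\<^sub>R k x)"
          using C(3)[OF J0(2)[OF x]] by simp
        also have "\<dots> \<le> C * (\<bar>t\<bar> * r t)"
          using rem C(1) by (rule mult_left_mono)
        finally show "\<bar>p (J t x) - p (J 0 x) - t * D (J 0 x) (k x)\<bar>
           \<le> C * (\<bar>t\<bar> * (B + r t))\<^sup>2 + C * (\<bar>t\<bar> * r t)"
          using 1 by linarith
      qed
      moreover have "sphere_integral (\<lambda>x. p (J t x) - p (J 0 x) - t * D (J 0 x) (k x)) =
         sphere_integral (\<lambda>x. p (J t x)) - sphere_integral (\<lambda>x. p (J 0 x))
        - t * sphere_integral (\<lambda>x. D (J 0 x) (k x))"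
        by (subst sphere_integral_diff, intro continuous_intros cJ, intro continuous_intros k(2))
          (simp add: sphere_integral_diff cJ sphere_integral_cmult)
      moreover have "(C * (\<bar>t\<bar> * (B + r t))\<^sup>2 + C * (\<bar>t\<bar> * r t)) * sphere_area
          = \<bar>t\<bar> * ((C * (\<bar>t\<bar> * (B + r t)\<^sup>2) + C * r t) * sphere_area)"
        unfolding power2_eq_square by algebra
      ultimately show ?case by simp
    qed
    have "((\<lambda>t. (C * (\<bar>t\<bar> * (B + r t)\<^sup>2) + C * r t) * sphere_area) \<longlongrightarrow>
        (C * (\<bar>0\<bar> * (B + 0)\<^sup>2) + C * 0) * sphere_area) (at 0)"
      by (intro tendsto_intros r(2))
    then show "((\<lambda>t. (C * (\<bar>t\<bar> * (B + r t)\<^sup>2) + C * r t) * sphere_area) \<longlongrightarrow> 0) (at 0)"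
      by simp
  qed
qed

section \<open>Jets of tensor fields along paths\<close>

lemma tensors_lincomb:
  assumes "g \<in> tensors k \<alpha>" "h \<in> tensors k \<alpha>"
  shows "(\<lambda>x v w. c * g x v w + d * h x v w) \<in> tensors k \<alpha>"
  unfolding tensors_def
proof (intro CollectI conjI allI)
  show "sym_tensor (\<lambda>x v w. c * g x v w + d * h x v w)"
    using assms unfolding tensors_def sym_tensor_def mem_Collect_eq by (auto simp: algebra_simps)
  show "Ck_alpha k \<alpha> (\<lambda>x. comps (\<lambda>x v w. c * g x v w + d * h x v w) x $ i $ j)" for i j
    using assms Ck_alpha_lincomb[of k \<alpha> "\<lambda>x. comps g x $ i $ j" "\<lambda>x. comps h x $ i $ j" c d]
    by (simp add: tensors_def comps_def)
qed

lemma Ck_mono: "Ck k f \<Longrightarrow> l \<le> k \<Longrightarrow> Ck l f"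
  by (simp add: Ck_def)

lemma tensors_Ck: "h \<in> tensors k \<alpha> \<Longrightarrow> l \<le> k \<Longrightarrow> Ck l (\<lambda>x. comps h x $ i $ j)"
  by (auto simp: tensors_def Ck_alpha_def intro: Ck_mono)

lemma jet_lincomb:
  assumes "g \<in> tensors k \<alpha>" "h \<in> tensors k \<alpha>" "2 \<le> k" "x \<in> S3"
  shows "jet (comps (\<lambda>x v w. c * g x v w + d * h x v w)) x = c *\<^sub>R jet (comps g) x + d *\<^sub>R jet (comps h) x"
proof -
  have cl: "fderivs w (\<lambda>y. comps (\<lambda>x v w. c * g x v w + d * h x v w) y $ i $ j) x =
     c * fderivs w (\<lambda>y. comps g y $ i $ j) x + d * fderivs w (\<lambda>y. comps h y $ i $ j) x"
    if "length w \<le> 2" for w i j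
    using fderivs_lincomb[OF tensors_Ck[OF assms(1,3)] tensors_Ck[OF assms(2,3)] that assms(4), of c i j d i j]
    by (simp add: comps_def)
  show ?thesis
    using cl[of "[]"] cl[of "[_]"] cl[of "[_, _]"]
    by (auto simp: jet_def vec_eq_iff split: sum.split prod.split simp del: fderivs.simps(2))
qed

lemma fderivs_le_tensor_norm:
  assumes "h \<in> tensors k \<alpha>" "length w \<le> k" "x \<in> S3"
  shows "\<bar>fderivs w (\<lambda>y. comps h y $ i $ j) x\<bar> \<le> tensor_norm k \<alpha> h"
proof -
  have C: "Ck_alpha k \<alpha> (\<lambda>x. comps h x $ i $ j)" for i j using assms(1) by (simp add: tensors_def)
  have "\<bar>fderivs w (\<lambda>y. comps h y $ i $ j) x\<bar> \<le> Ck_alpha_norm k \<alpha> (\<lambda>x. comps h x $ i $ j)"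
    by (rule fderivs_le_Ck_alpha_norm[OF C assms(2,3)])
  also have "\<dots> \<le> (\<Sum>j\<in>UNIV. Ck_alpha_norm k \<alpha> (\<lambda>x. comps h x $ i $ j))"
    by (rule member_le_sum) (auto intro: Ck_alpha_norm_nonneg[OF C])
  also have "\<dots> \<le> (\<Sum>i\<in>UNIV. \<Sum>j\<in>UNIV. Ck_alpha_norm k \<alpha> (\<lambda>x. comps h x $ i $ j))"
    by (rule member_le_sum) (auto intro!: sum_nonneg Ck_alpha_norm_nonneg[OF C])
  finally show ?thesis by (simp add: tensor_norm_def)
qed

lemma norm_vec_le_card:
  fixes v :: "real^'n"
  assumes "\<And>c. \<bar>v $ c\<bar> \<le> B"
  shows "norm v \<le> of_nat CARD('n) * B"
proof -
  have "norm v \<le> (\<Sum>c\<in>UNIV. \<bar>v $ c\<bar>)" by (rule norm_le_l1_cart)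
  also have "\<dots> \<le> of_nat CARD('n) * B" by (rule sum_bounded_above) (use assms in auto)
  finally show ?thesis .
qed

abbreviation jet_dim :: real where
  "jet_dim \<equiv> of_nat CARD((3 \<times> 3) + (3 \<times> 3 \<times> 3) + (3 \<times> 3 \<times> 3 \<times> 3))"

lemma norm_jet_le:
  assumes "h \<in> tensors k \<alpha>" "2 \<le> k" "x \<in> S3"
  shows "norm (jet (comps h) x) \<le> jet_dim * tensor_norm k \<alpha> h"
proof (rule norm_vec_le_card)
  fix c :: "(3 \<times> 3) + (3 \<times> 3 \<times> 3) + (3 \<times> 3 \<times> 3 \<times> 3)"
  have cl: "\<bar>fderivs w (\<lambda>y. comps h y $ i $ j) x\<bar> \<le> tensor_norm k \<alpha> h" if "length w \<le> 2" for w i j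
    using fderivs_le_tensor_norm[OF assms(1) _ assms(3)] that assms(2) by simp
  show "\<bar>jet (comps h) x $ c\<bar> \<le> tensor_norm k \<alpha> h"
    using cl[of "[]"] cl[of "[_]"] cl[of "[_, _]"]
    by (auto simp: jet_def split: sum.split prod.split simp del: fderivs.simps(2))
qed

text \<open>The difference quotient minus \<open>\<eta>\<close> is itself a tensor field
  \<open>q t\<close> whose norm tends to 0, and the norm bounds two-jets uniformly on the sphere.
  Since \<open>\<gamma> t = \<gamma> 0 + t * (\<eta> + q t)\<close>, the remainder of the jet is
  \<open>t\<close> times the jet of \<open>q t\<close>.\<close>

lemma path_jet:
  assumes "metric_path k \<alpha> {-\<epsilon><..<\<epsilon>} \<gamma>" "\<epsilon> > 0" "2 \<le> k" "has_path_derivative k \<alpha> \<gamma> \<eta> 0"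
  obtains r where "(r \<longlongrightarrow> 0) (at 0)"
    "\<And>t x. \<bar>t\<bar> < \<epsilon> \<Longrightarrow> t \<noteq> 0 \<Longrightarrow> x \<in> S3 \<Longrightarrow>
      norm (jet (comps (\<gamma> t)) x - jet (comps (\<gamma> 0)) x - t *\<^sub>R jet (comps \<eta>) x) \<le> \<bar>t\<bar> * r t"
proof -
  define q where "q t = (\<lambda>x v w. (\<gamma> t x v w - \<gamma> 0 x v w) / (t - 0) - \<eta> x v w)" for t
  have \<gamma>: "\<gamma> t \<in> tensors k \<alpha>" if "\<bar>t\<bar> < \<epsilon>" for t
    using assms(1) that by (auto simp: metric_path_def metrics_def abs_less_iff)
  have \<eta>: "\<eta> \<in> tensors k \<alpha>" and lim: "((\<lambda>t. tensor_norm k \<alpha> (q t)) \<longlongrightarrow> 0) (at 0)"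
    using assms(4) by (auto simp: has_path_derivative_def q_def)
  have \<gamma>0: "\<gamma> 0 \<in> tensors k \<alpha>" using \<gamma>[of 0] assms(2) by simp
  show ?thesis
  proof (rule that[of "\<lambda>t. jet_dim * tensor_norm k \<alpha> (q t)"])
    show "((\<lambda>t. jet_dim * tensor_norm k \<alpha> (q t)) \<longlongrightarrow> 0) (at 0)"
      using tendsto_mult_right_zero[OF lim] .
    fix t and x :: "real^4" assume t: "\<bar>t\<bar> < \<epsilon>" "t \<noteq> 0" and x: "x \<in> S3"
    have "(\<lambda>x v w. 1 * (inverse t * \<gamma> t x v w + (- inverse t) * \<gamma> 0 x v w) + (-1) * \<eta> x v w) \<in> tensors k \<alpha>"
      by (intro tensors_lincomb \<gamma>[OF t(1)] \<gamma>0 \<eta>)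
    moreover have "(\<lambda>x v w. 1 * (inverse t * \<gamma> t x v w + (- inverse t) * \<gamma> 0 x v w) + (-1) * \<eta> x v w) = q t"
      using t by (simp add: q_def fun_eq_iff field_simps)
    ultimately have q: "q t \<in> tensors k \<alpha>" by simp
    have "\<gamma> t = (\<lambda>x v w. 1 * \<gamma> 0 x v w + t * (1 * \<eta> x v w + 1 * q t x v w))"
      using t by (simp add: q_def fun_eq_iff)
    then have "jet (comps (\<gamma> t)) x = 1 *\<^sub>R jet (comps (\<gamma> 0)) x + t *\<^sub>R (1 *\<^sub>R jet (comps \<eta>) x + 1 *\<^sub>R jet (comps (q t)) x)"
      using jet_lincomb[OF \<gamma>0 tensors_lincomb[OF \<eta> q, of 1 1] assms(3) x, of 1 t]
        jet_lincomb[OF \<eta> q assms(3) x, of 1 1] by simp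
    then have "jet (comps (\<gamma> t)) x - jet (comps (\<gamma> 0)) x - t *\<^sub>R jet (comps \<eta>) x = t *\<^sub>R jet (comps (q t)) x"
      by (simp add: algebra_simps)
    then show "norm (jet (comps (\<gamma> t)) x - jet (comps (\<gamma> 0)) x - t *\<^sub>R jet (comps \<eta>) x)
       \<le> \<bar>t\<bar> * (jet_dim * tensor_norm k \<alpha> (q t))"
      using norm_jet_le[OF q assms(3) x] by (simp add: mult_left_mono)
  qed
qed


section \<open>The first variation\<close>

lemma regular_cball:
  assumes "det A > 0"
  obtains \<delta> where "\<delta> > 0" "regular (cball (const_jet A) \<delta>)"
proof -
  have "((\<lambda>J. det (jmat J)) \<longlongrightarrow> det (jmat (const_jet A))) (at (const_jet A))"
    unfolding det_3 jmat_def vec_lambda_beta by (intro tendsto_intros)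
  then have "((\<lambda>J. det (jmat J)) \<longlongrightarrow> det A) (at (const_jet A))"
    by simp
  then have "\<forall>\<^sub>F J in at (const_jet A). det A / 2 < det (jmat J)"
    using assms by (intro order_tendstoD(1)) auto
  then obtain d where d: "d > 0" "\<And>J. J \<noteq> const_jet A \<Longrightarrow> dist J (const_jet A) < d \<Longrightarrow> det A / 2 < det (jmat J)"
    unfolding eventually_at by auto
  have "det A / 2 \<le> det (jmat J)" if "J \<in> cball (const_jet A) (d / 2)" for J
    using d(2)[of J] that d(1) assms by (cases "J = const_jet A") (auto simp: dist_commute)
  then have "regular (cball (const_jet A) (d / 2))"
    unfolding regular_def using assms by (intro conjI bounded_cball exI[of _ "det A / 2"]) auto
  then show ?thesis using that[of "d / 2"] d(1) by simp
qed

lemma sphere_integral_dens_pos: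
  assumes "regular \<Omega>" "continuous_on S3 J" "\<And>x. x \<in> S3 \<Longrightarrow> J x \<in> \<Omega>"
  shows "sphere_integral (\<lambda>x. dens_jet (J x)) > 0"
proof -
  obtain c where c: "c > 0" "\<And>J. J \<in> \<Omega> \<Longrightarrow> c \<le> det (jmat J)"
    using assms(1) by (auto simp: regular_def)
  have "continuous_on S3 (\<lambda>x. dens_jet (J x))"
    by (rule continuous_on_compose2[OF C11_dir_continuous[OF C11_dir_dens[OF assms(1)]] assms(2)])
      (use assms(3) in auto)
  then have "sphere_integral (\<lambda>x. sqrt c) \<le> sphere_integral (\<lambda>x. dens_jet (J x))"
    using c assms(3) by (intro sphere_integral_mono) (auto simp: dens_jet_def)
  moreover have "sphere_integral (\<lambda>x. sqrt c) > 0"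
    using c(1) sphere_area_pos by (simp add: sphere_integral_const)
  ultimately show ?thesis by simp
qed

text \<open>A ball of one radius \<open>d\<close> around each initial jet lies in
  \<open>\<Omega>\<close>, which keeps the jets of the path there for short times. Continuity of the
  two derivative integrands is left as a hypothesis because it arises in two ways: at Berger metrics
  the jet is constant and the direction arbitrary, in the obstruction the jet is arbitrary and the
  direction constant.\<close>

lemma F_third_has_derivative:
  fixes \<gamma> \<eta>
  defines "J \<equiv> (\<lambda>t. jet (comps (\<gamma> t)))" and "k \<equiv> jet (comps \<eta>)"
  assumes path: "metric_path 4 \<alpha> {-\<epsilon><..<\<epsilon>} \<gamma>" "\<epsilon> > 0" and der: "has_path_derivative 4 \<alpha> \<gamma> \<eta> 0"
    and reg: "regular \<Omega>" and d: "d > 0" "\<And>x. x \<in> S3 \<Longrightarrow> cball (J 0 x) d \<subseteq> \<Omega>"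
    and D: "C11_on \<Omega> dens_jet D" and E: "C11_on \<Omega> curv_jet E"
    and cD: "continuous_on S3 (\<lambda>x. D (J 0 x) (k x))" and cE: "continuous_on S3 (\<lambda>x. E (J 0 x) (k x))"
  defines "V \<equiv> sphere_integral (\<lambda>x. dens_jet (J 0 x))"
  shows "((\<lambda>t. F_third (\<gamma> t)) has_real_derivative
     V powr (1/3) * (sphere_integral (\<lambda>x. D (J 0 x) (k x)) * sphere_integral (\<lambda>x. curv_jet (J 0 x)) / (3 * V)
       + sphere_integral (\<lambda>x. E (J 0 x) (k x)))) (at 0)"
proof -
  have \<gamma>: "\<gamma> t \<in> tensors 4 \<alpha>" if "\<bar>t\<bar> < \<epsilon>" for t
    using path(1) that by (auto simp: metric_path_def metrics_def abs_less_iff)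
  have \<eta>: "\<eta> \<in> tensors 4 \<alpha>" using der by (simp add: has_path_derivative_def)
  have cJ: "continuous_on S3 (J t)" if "\<bar>t\<bar> < \<epsilon>" for t
    unfolding J_def by (intro continuous_on_jet tensors_Ck[OF \<gamma>[OF that]]) simp
  obtain r where r: "(r \<longlongrightarrow> 0) (at 0)"
    "\<And>t x. \<bar>t\<bar> < \<epsilon> \<Longrightarrow> t \<noteq> 0 \<Longrightarrow> x \<in> S3 \<Longrightarrow> norm (J t x - J 0 x - t *\<^sub>R k x) \<le> \<bar>t\<bar> * r t"
    using path_jet[OF path _ der] unfolding J_def k_def by auto
  define B where "B = jet_dim * tensor_norm 4 \<alpha> \<eta>"
  have B: "norm (k x) \<le> B" if "x \<in> S3" for x
    using norm_jet_le[OF \<eta> _ that] by (simp add: k_def B_def)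
  have small: "\<forall>\<^sub>F t in at 0. \<bar>t\<bar> < \<epsilon>"
    unfolding eventually_at using path(2) by (auto simp: dist_real_def)
  have ne: "\<forall>\<^sub>F t::real in at 0. t \<noteq> 0" by (rule eventually_neq_at_within)
  have "((\<lambda>t. \<bar>t\<bar> * (r t + B)) \<longlongrightarrow> \<bar>0\<bar> * (0 + B)) (at 0)"
    by (intro tendsto_intros r(1))
  then have "\<forall>\<^sub>F t in at 0. \<bar>t\<bar> * (r t + B) < d"
    using d(1) by (intro order_tendstoD(2)) auto
  then have in\<Omega>: "\<forall>\<^sub>F t in at 0. continuous_on S3 (J t) \<and> (\<forall>x\<in>S3. J t x \<in> \<Omega>)"
    using small ne
  proof eventually_elim
    case (elim t)
    have "J t x \<in> \<Omega>" if x: "x \<in> S3" for x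
    proof -
      have "norm (J t x - J 0 x) \<le> norm (J t x - J 0 x - t *\<^sub>R k x) + norm (t *\<^sub>R k x)"
        using norm_triangle_ineq[of "J t x - J 0 x - t *\<^sub>R k x" "t *\<^sub>R k x"] by simp
      also have "\<dots> \<le> \<bar>t\<bar> * r t + \<bar>t\<bar> * B"
        using r(2)[of t x] B[OF x] elim x by (simp add: add_mono mult_left_mono)
      finally have "J t x \<in> cball (J 0 x) d"
        using elim by (simp add: dist_norm norm_minus_commute algebra_simps)
      then show ?thesis using d(2)[OF x] by blast
    qed
    then show ?case using cJ elim by blast
  qed
  have c0: "continuous_on S3 (J 0)" using cJ path(2) by simp
  have J0: "J 0 x \<in> \<Omega>" if "x \<in> S3" for x using d(2)[OF that] d(1) by auto
  have r': "\<forall>\<^sub>F t in at 0. \<forall>x\<in>S3. norm (J t x - J 0 x - t *\<^sub>R k x) \<le> \<bar>t\<bar> * r t"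
    using small ne by eventually_elim (use r(2) in blast)
  define V' where "V' = sphere_integral (\<lambda>x. D (J 0 x) (k x))"
  define A' where "A' = sphere_integral (\<lambda>x. E (J 0 x) (k x))"
  have dV: "((\<lambda>t. sphere_integral (\<lambda>x. dens_jet (J t x))) has_real_derivative V') (at 0)"
    unfolding V'_def by (rule sphere_integral_has_derivative[OF D c0 J0 in\<Omega> B cD r' r(1)])
  have dA: "((\<lambda>t. sphere_integral (\<lambda>x. curv_jet (J t x))) has_real_derivative A') (at 0)"
    unfolding A'_def by (rule sphere_integral_has_derivative[OF E c0 J0 in\<Omega> B cE r' r(1)])
  have V: "V > 0" unfolding V_def by (rule sphere_integral_dens_pos[OF reg c0 J0])
  have F: "F_third (\<gamma> t) = sphere_integral (\<lambda>x. dens_jet (J t x)) powr (1/3) * sphere_integral (\<lambda>x. curv_jet (J t x))"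
    if "\<bar>t\<bar> < \<epsilon>" "\<And>x. x \<in> S3 \<Longrightarrow> J t x \<in> \<Omega>" for t
    unfolding J_def
    by (rule F_third_jet[OF tensors_Ck[OF \<gamma>[OF that(1)]] reg]) (use that(2) in \<open>auto simp: J_def\<close>)
  have "\<forall>\<^sub>F t in at 0. F_third (\<gamma> t) =
      sphere_integral (\<lambda>x. dens_jet (J t x)) powr (1/3) * sphere_integral (\<lambda>x. curv_jet (J t x))"
    using in\<Omega> small by eventually_elim (use F in blast)
  then have ev: "\<forall>\<^sub>F t in nhds 0. F_third (\<gamma> t) =
      sphere_integral (\<lambda>x. dens_jet (J t x)) powr (1/3) * sphere_integral (\<lambda>x. curv_jet (J t x))"
    using F[of 0] path(2) J0 by (simp add: eventually_nhds_conv_at)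
  have "((\<lambda>t. sphere_integral (\<lambda>x. dens_jet (J t x)) powr (1/3)) has_real_derivative
     (1/3) * V powr (1/3 - of_nat 1) * V') (at 0)"
    using DERIV_fun_powr[OF dV, of "1/3"] V by (simp add: V_def)
  moreover have "V powr (1/3 - of_nat 1) = V powr (1/3) / V"
    using V powr_diff[of V "1/3" 1] by simp
  ultimately have dP: "((\<lambda>t. sphere_integral (\<lambda>x. dens_jet (J t x)) powr (1/3)) has_real_derivative
     (1/3) * (V powr (1/3) / V) * V') (at 0)"
    by (simp only:)
  have "((\<lambda>t. sphere_integral (\<lambda>x. dens_jet (J t x)) powr (1/3) * sphere_integral (\<lambda>x. curv_jet (J t x)))
    has_real_derivative V powr (1/3) * (V' * sphere_integral (\<lambda>x. curv_jet (J 0 x)) / (3 * V) + A')) (at 0)"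
    by (rule DERIV_cong[OF DERIV_mult[OF dP dA]]) (use V in \<open>simp add: V_def[symmetric] field_simps\<close>)
  then show ?thesis
    using DERIV_cong_ev[OF refl ev refl] by (simp add: V'_def A'_def)
qed

section \<open>Derivatives at constant jets in constant directions\<close>

lemma const_jet_line: "const_jet A + t *\<^sub>R const_jet M = const_jet (A + t *\<^sub>R M)"
  by (auto simp: vec_eq_iff const_jet_def split: sum.split)

text \<open>The derivative of \<open>((tr A)^2 - tr (A^2)) / 2\<close> in direction
  \<open>M\<close>; the determinant is treated next by Jacobi's formula
  \<open>tr (adj A M)\<close>.\<close>

definition minors_deriv :: "real^3^3 \<Rightarrow> real^3^3 \<Rightarrow> real" where
  "minors_deriv A M = tr3 A * tr3 M - (\<Sum>i\<in>UNIV. \<Sum>j\<in>UNIV. A $ i $ j * M $ j $ i)"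

definition det_deriv :: "real^3^3 \<Rightarrow> real^3^3 \<Rightarrow> real" where
  "det_deriv A M = (\<Sum>i\<in>UNIV. \<Sum>j\<in>UNIV. adj3 A i j * M $ j $ i)"

definition curv_poly_deriv :: "real \<Rightarrow> real \<Rightarrow> real \<Rightarrow> real \<Rightarrow> real \<Rightarrow> real \<Rightarrow> real" where
  "curv_poly_deriv s q p s' q' p' = (32/3) * (4 * q - s\<^sup>2) * (4 * q' - 2 * s * s')
     - 8 * s' * (4 * q * s - s^3 - 8 * p) - 8 * s * (4 * q' * s + 4 * q * s' - 3 * s\<^sup>2 * s' - 8 * p')"

text \<open>Up to a positive factor, the derivative of the normalized energy \<open>p^(-4/3) curv_poly s q p\<close>.\<close>

definition var_poly :: "real \<Rightarrow> real \<Rightarrow> real \<Rightarrow> real \<Rightarrow> real \<Rightarrow> real \<Rightarrow> real" where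
  "var_poly s q p s' q' p' = 3 * p * curv_poly_deriv s q p s' q' p' - 4 * curv_poly s q p * p'"

lemma tr3_line: "((\<lambda>t. tr3 (A + t *\<^sub>R M)) has_real_derivative tr3 M) (at 0)"
  unfolding tr3_def by (auto intro!: derivative_eq_intros)

lemma minors3_line: "((\<lambda>t. minors3 (A + t *\<^sub>R M)) has_real_derivative minors_deriv A M) (at 0)"
  unfolding minors3_def minors_deriv_def tr3_def sum_3
  by (auto intro!: derivative_eq_intros simp: algebra_simps)

lemma det_line: "((\<lambda>t. det (A + t *\<^sub>R M :: real^3^3)) has_real_derivative det_deriv A M) (at 0)"
  unfolding det_3 det_deriv_def sum_3 adj3_values
  by (auto intro!: derivative_eq_intros simp: algebra_simps)

lemma curv_poly_has_derivative:
  assumes "(s has_real_derivative s') (at t)" "(q has_real_derivative q') (at t)" "(p has_real_derivative p') (at t)"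
  shows "((\<lambda>t. curv_poly (s t) (q t) (p t)) has_real_derivative
     curv_poly_deriv (s t) (q t) (p t) s' q' p') (at t)"
  unfolding curv_poly_def curv_poly_deriv_def
  by (auto intro!: derivative_eq_intros assms simp: field_simps power2_eq_square power3_eq_cube)

context
  fixes \<Omega> :: "jet set" and A M :: "real^3^3" and d :: real
  assumes d: "d > 0" "cball (const_jet A) d \<subseteq> \<Omega>" and det_pos: "det A > 0"
begin

lemma line_in: "\<forall>\<^sub>F t in at 0. const_jet A + t *\<^sub>R const_jet M \<in> \<Omega>"
proof -
  have "((\<lambda>t. dist (const_jet A) (const_jet A + t *\<^sub>R const_jet M)) \<longlongrightarrow>
      dist (const_jet A) (const_jet A + 0 *\<^sub>R const_jet M)) (at 0)"
    by (intro tendsto_intros)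
  then have "\<forall>\<^sub>F t in at 0. dist (const_jet A) (const_jet A + t *\<^sub>R const_jet M) < d"
    using d(1) by (intro order_tendstoD(2)) auto
  then show ?thesis by eventually_elim (use d(2) in auto)
qed

lemma center_in: "const_jet A \<in> \<Omega>" using d by auto

text \<open>\<open>D\<close> is known only through \<open>C11_on\<close>. Uniqueness of derivatives
  identifies it: the line of constant jets stays in \<open>\<Omega>\<close> for short times, and
  along it the density has a closed form.\<close>

lemma dens_jet_deriv_const:
  assumes D: "C11_on \<Omega> dens_jet D"
  shows "D (const_jet A) (const_jet M) = det_deriv A M / (2 * sqrt (det A))"
proof (rule DERIV_unique)
  show "((\<lambda>t. dens_jet (const_jet (A + t *\<^sub>R M))) has_real_derivative D (const_jet A) (const_jet M)) (at 0)"
    using C11_on_directional_derivative[OF D center_in line_in] by (simp add: const_jet_line)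
  show "((\<lambda>t. dens_jet (const_jet (A + t *\<^sub>R M))) has_real_derivative det_deriv A M / (2 * sqrt (det A))) (at 0)"
    unfolding dens_const_jet using det_pos
    by (auto intro!: derivative_eq_intros det_line simp: field_simps)
qed

lemma curv_jet_deriv_const:
  assumes E: "C11_on \<Omega> curv_jet E" and sym: "\<And>i j. A $ i $ j = A $ j $ i" "\<And>i j. M $ i $ j = M $ j $ i"
  shows "E (const_jet A) (const_jet M) = sqrt (det A) * inverse (det A) ^ 3 *
     (det A * curv_poly_deriv (tr3 A) (minors3 A) (det A) (tr3 M) (minors_deriv A M) (det_deriv A M)
       - (3/2) * curv_poly (tr3 A) (minors3 A) (det A) * det_deriv A M)"
proof (rule DERIV_unique)
  show "((\<lambda>t. curv_jet (const_jet (A + t *\<^sub>R M))) has_real_derivative E (const_jet A) (const_jet M)) (at 0)"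
    using C11_on_directional_derivative[OF E center_in line_in] by (simp add: const_jet_line)
  let ?f = "\<lambda>t. curv_poly (tr3 (A + t *\<^sub>R M)) (minors3 (A + t *\<^sub>R M)) (det (A + t *\<^sub>R M))"
  let ?g = "\<lambda>t. ?f t * (inverse (det (A + t *\<^sub>R M)))\<^sup>2 * sqrt (det (A + t *\<^sub>R M))"
  have "((\<lambda>t. det (A + t *\<^sub>R M)) \<longlongrightarrow> det A) (at 0)"
    using DERIV_isCont[OF det_line[of A M]] by (simp add: isCont_def)
  then have "\<forall>\<^sub>F t in at 0. det (A + t *\<^sub>R M) > 0"
    using det_pos by (rule order_tendstoD(1))
  then have "\<forall>\<^sub>F t in nhds 0. det (A + t *\<^sub>R M) > 0"
    using det_pos by (simp add: eventually_nhds_conv_at)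
  then have ev: "\<forall>\<^sub>F t in nhds 0. curv_jet (const_jet (A + t *\<^sub>R M)) = ?g t"
    by eventually_elim (intro curv_const_jet, use sym in auto)
  define B' where "B' = curv_poly_deriv (tr3 A) (minors3 A) (det A) (tr3 M) (minors_deriv A M) (det_deriv A M)"
  have f: "(?f has_real_derivative B') (at 0)"
    using curv_poly_has_derivative[OF tr3_line minors3_line det_line, of A M] by (simp add: B'_def)
  \<comment> \<open>In terms of \<open>w\<close> the square root and the inverse determinant are
    both powers, so the comparison below is an identity of rational functions.\<close>
  define w where "w = sqrt (det A)"
  have w: "w > 0" "det A = w * w" using det_pos by (auto simp: w_def)
  have "((\<lambda>t. inverse (det (A + t *\<^sub>R M))) has_real_derivative - (inverse (det A) * det_deriv A M * inverse (det A))) (at 0)"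
    using DERIV_inverse'[OF det_line[of A M]] det_pos by simp
  moreover have "((\<lambda>t. sqrt (det (A + t *\<^sub>R M))) has_real_derivative inverse w / 2 * det_deriv A M) (at 0)"
    using DERIV_chain2[OF DERIV_real_sqrt det_line[of A M]] det_pos by (simp add: w_def)
  ultimately have g: "(?g has_real_derivative
     B' * inverse (w * w) ^ 2 * w + curv_poly (tr3 A) (minors3 A) (det A) *
       (2 * inverse (w * w) * (- (inverse (w * w) * det_deriv A M * inverse (w * w)))) * w +
     curv_poly (tr3 A) (minors3 A) (det A) * inverse (w * w) ^ 2 * (inverse w / 2 * det_deriv A M)) (at 0)"
    by (rule DERIV_cong[OF DERIV_mult[OF DERIV_mult[OF f DERIV_power[where n = 2]]]])
      (use w(1) in \<open>simp_all add: w_def[symmetric] w(2) algebra_simps\<close>)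
  have e: "b' * inverse (w * w) ^ 2 * w + b * (2 * inverse (w * w) * (- (inverse (w * w) * p * inverse (w * w)))) * w +
     b * inverse (w * w) ^ 2 * (inverse w / 2 * p) = w * inverse (w * w) ^ 3 * (w * w * b' - (3/2) * b * p)" for b b' p
    using w(1) by (simp add: field_simps power2_eq_square power3_eq_cube)
  have "(?g has_real_derivative w * inverse (w * w) ^ 3 *
     (w * w * B' - (3/2) * curv_poly (tr3 A) (minors3 A) (det A) * det_deriv A M)) (at 0)"
    using g unfolding e .
  then show "((\<lambda>t. curv_jet (const_jet (A + t *\<^sub>R M))) has_real_derivative
     sqrt (det A) * inverse (det A) ^ 3 *
     (det A * curv_poly_deriv (tr3 A) (minors3 A) (det A) (tr3 M) (minors_deriv A M) (det_deriv A M)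
       - (3/2) * curv_poly (tr3 A) (minors3 A) (det A) * det_deriv A M)) (at 0)"
    using DERIV_cong_ev[OF refl ev refl] by (simp only: w(2)[symmetric] w_def[symmetric] B'_def[symmetric])
qed

end


section \<open>Berger tensors\<close>

text \<open>The integral curves of \<open>frame 1\<close> are Hopf circles; \<open>a\<close> is the
  weight along them and \<open>b\<close> the weight on the orthogonal planes. With arbitrary real
  weights the family is closed under linear combinations and contains the metrics, the deformation
  and the gradients alike.\<close>

definition berger :: "real \<Rightarrow> real \<Rightarrow> tensor2" where
  "berger a b x v w = b * (v \<bullet> w) + (a - b) * ((v \<bullet> frame 1 x) * (w \<bullet> frame 1 x))"

definition dmat :: "real \<Rightarrow> real \<Rightarrow> real^3^3" where
  "dmat a b = (\<chi> i j. if i = j then if i = 1 then a else b else 0)"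

lemma dmat_nth [simp]: "dmat a b $ i $ j = (if i = j then if i = 1 then a else b else 0)"
  by (simp add: dmat_def)

lemma round_metric_berger: "round_metric = berger 1 1"
  by (simp add: fun_eq_iff round_metric_def berger_def)

lemma comps_berger: "x \<in> S3 \<Longrightarrow> comps (berger a b) x = dmat a b"
  by (auto simp: comps_def berger_def vec_eq_iff frame_orthonormal)

lemma sym_tensor_berger: "sym_tensor (berger a b)"
  by (auto simp: sym_tensor_def berger_def inner_commute inner_add_left algebra_simps)

lemma tensors_berger: "berger a b \<in> tensors k \<alpha>"
  by (auto simp: tensors_def sym_tensor_berger comps_berger intro!: Ck_alpha_const[where c = "dmat a b $ _ $ _"] simp del: dmat_nth)

lemma metrics_berger:
  assumes "a > 0" "b > 0"
  shows "berger a b \<in> metrics k \<alpha>"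
proof -
  have "berger a b x v v > 0" if x: "x \<in> S3" and v: "v \<noteq> 0" for x v
  proof -
    define c where "c = v \<bullet> frame 1 x"
    have "c\<^sup>2 \<le> (v \<bullet> v) * (frame 1 x \<bullet> frame 1 x)"
      unfolding c_def by (rule Cauchy_Schwarz_ineq)
    then have le: "c\<^sup>2 \<le> v \<bullet> v" using frame_orthonormal[OF x, of 1 1] by simp
    have e: "berger a b x v v = b * (v \<bullet> v - c\<^sup>2) + a * c\<^sup>2"
      by (simp add: berger_def c_def power2_eq_square algebra_simps)
    show ?thesis
    proof (cases "c = 0")
      case True
      then show ?thesis using e v assms by simp
    next
      case False
      then have "a * c\<^sup>2 > 0" using assms by simp
      moreover have "b * (v \<bullet> v - c\<^sup>2) \<ge> 0" using le assms by simp
      ultimately show ?thesis using e by linarith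
    qed
  qed
  then show ?thesis using tensors_berger by (simp add: metrics_def)
qed

lemma tensor_norm_berger: "tensor_norm k \<alpha> (berger a b) = \<bar>a\<bar> + 2 * \<bar>b\<bar>"
proof -
  have "Ck_alpha_norm k \<alpha> (\<lambda>x. comps (berger a b) x $ i $ j) = \<bar>dmat a b $ i $ j\<bar>" for i j
    by (rule Ck_alpha_norm_const) (simp only: comps_berger)
  then show ?thesis by (simp add: tensor_norm_def sum_3)
qed

lemma jet_const:
  assumes "\<And>x. x \<in> S3 \<Longrightarrow> G x = A" "x \<in> S3"
  shows "jet G x = const_jet A"
proof -
  have f: "fderivs w (\<lambda>y. G y $ i $ j) x = (if w = [] then A $ i $ j else 0)" for w i j
    by (rule fderivs_const[OF _ assms(2)]) (simp add: assms(1))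
  show ?thesis
    using f[of "[]"] f[of "[_]"] f[of "[_, _]"]
    by (auto simp: jet_def const_jet_def vec_eq_iff split: sum.split prod.split simp del: fderivs.simps(2))
qed

lemma jet_berger: "x \<in> S3 \<Longrightarrow> jet (comps (berger a b)) x = const_jet (dmat a b)"
  by (rule jet_const[OF comps_berger])

lemma det_dmat: "det (dmat a b) = a * b\<^sup>2"
  and tr3_dmat: "tr3 (dmat a b) = a + 2 * b"
  and minors3_dmat: "minors3 (dmat a b) = 2 * a * b + b\<^sup>2"
  by (simp_all add: det_3 tr3_def minors3_def power2_eq_square)

lemma matrix_inv_dmat:
  assumes "a \<noteq> 0" "b \<noteq> 0"
  shows "matrix_inv (dmat a b) = dmat (inverse a) (inverse b)"
  by (rule matrix_inv_unique3; use assms in \<open>auto simp: vec_eq_iff matrix_matrix_mult_def mat_def sum_3 forall_3\<close>)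

lemma det_deriv_dmat: "det_deriv (dmat a b) M = b\<^sup>2 * M $ 1 $ 1 + a * b * (M $ 2 $ 2 + M $ 3 $ 3)"
  by (simp add: det_deriv_def sum_3 adj3_values power2_eq_square algebra_simps)

lemma minors_deriv_dmat: "minors_deriv (dmat a b) M = 2 * b * M $ 1 $ 1 + (a + b) * (M $ 2 $ 2 + M $ 3 $ 3)"
  by (simp add: minors_deriv_def sum_3 tr3_def algebra_simps)

text \<open>The entries of positive order are frame derivatives and integrate to zero. Hence the
  mean of the jets of a metric is the jet of a left-invariant tensor, for which closed formulas are
  available.\<close>

lemma jet_mean:
  assumes "h \<in> tensors k \<alpha>" "2 \<le> k"
  shows "(\<chi> c. sphere_integral (\<lambda>x. jet (comps h) x $ c)) =
     const_jet (\<chi> i j. sphere_integral (\<lambda>x. comps h x $ i $ j))"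
proof -
  have z: "sphere_integral (fderivs (a # w) (\<lambda>y. comps h y $ i $ j)) = 0" if "length w < 2" for a w i j
    by (rule sphere_integral_fderivs[OF tensors_Ck[OF assms] that])
  have "sphere_integral (\<lambda>x. jet (comps h) x $ c) =
     const_jet (\<chi> i j. sphere_integral (\<lambda>x. comps h x $ i $ j)) $ c" for c
  proof (cases c)
    case (Inl p)
    then show ?thesis by (cases p) (simp add: jet_def)
  next
    case (Inr q)
    show ?thesis
    proof (cases q)
      case (Inl p)
      obtain a i j where "p = (a, i, j)" by (cases p) auto
      then show ?thesis using z[of "[]" a i j] Inl Inr by (simp add: jet_def)
    next
      case Inr2: (Inr p)
      obtain a b i j where "p = (a, b, i, j)" by (cases p) auto
      then show ?thesis using z[of "[b]" a i j] Inr Inr2 by (simp add: jet_def)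
    qed
  qed
  then show ?thesis by (simp add: vec_eq_iff)
qed

section \<open>The gradient at Berger metrics\<close>

text \<open>With determinant \<open>p\<close>, \<open>w = sqrt p\<close> and volume
  \<open>V = sphere_area * w\<close>, the first variation is
  \<open>V^(1/3) * w * p^(-3) * var_poly / 3\<close>. The factor \<open>w\<close> is the volume
  density of the pairing; the rest is collected here.\<close>

definition grad_factor :: "real \<Rightarrow> real \<Rightarrow> real" where
  "grad_factor a b = (sphere_area * sqrt (a * b\<^sup>2)) powr (1/3) * inverse (a * b\<^sup>2) ^ 3 / 3"

text \<open>The last three arguments are the derivatives of trace, second invariant and determinant
  with respect to the (1,1) entry; in \<open>grad2\<close>, with respect to the (2,2) or (3,3)
  entry. The square of the weight lowers the two indices that the pairing raises.\<close>

definition grad1 :: "real \<Rightarrow> real \<Rightarrow> real" where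
  "grad1 a b = a\<^sup>2 * (grad_factor a b * var_poly (a + 2 * b) (2 * a * b + b\<^sup>2) (a * b\<^sup>2) 1 (2 * b) (b\<^sup>2))"

definition grad2 :: "real \<Rightarrow> real \<Rightarrow> real" where
  "grad2 a b = b\<^sup>2 * (grad_factor a b * var_poly (a + 2 * b) (2 * a * b + b\<^sup>2) (a * b\<^sup>2) 1 (a + b) (a * b))"

lemma var_poly_linear:
  "var_poly s q p (x + y) (c * x + d * y) (e * x + f * y) = var_poly s q p 1 c e * x + var_poly s q p 1 d f * y"
  unfolding var_poly_def curv_poly_deriv_def by (simp add: field_simps)

lemma inner_g_dmat:
  assumes "G x = dmat a b" "T x = dmat m n" "a \<noteq> 0" "b \<noteq> 0"
  shows "inner_g G T H x = m / a\<^sup>2 * H x $ 1 $ 1 + n / b\<^sup>2 * (H x $ 2 $ 2 + H x $ 3 $ 3)"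
  using assms
  by (simp add: inner_g_def ginv_def matrix_inv_dmat sum_3 power2_eq_square field_simps)

lemma comps_sym:
  assumes "h \<in> tensors k \<alpha>" "x \<in> S3"
  shows "comps h x $ i $ j = comps h x $ j $ i"
  using assms frame_tangent[of i x] frame_tangent[of j x]
  unfolding tensors_def sym_tensor_def comps_def vec_lambda_beta by blast

lemma first_variation_identity:
  fixes w S p B B' P d :: real
  assumes "w > 0" "S > 0" "p = w * w"
  shows "P * (d / (2 * w) * (B * (inverse p)\<^sup>2 * w * S) / (3 * (w * S)) + w * inverse p ^ 3 * (p * B' - (3/2) * B * d))
    = P * w * inverse p ^ 3 * (3 * p * B' - 4 * B * d) / 3"
  using assms(1,2) unfolding assms(3) by (simp add: field_simps power2_eq_square power3_eq_cube)

text \<open>At a diagonal matrix the three invariants are stationary in off-diagonal directions, and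
  here the (2,2) and (3,3) directions enter symmetrically. The gradient is therefore again a Berger
  tensor.\<close>

lemma is_gradient_berger:
  assumes a: "a > 0" and b: "b > 0"
  shows "is_gradient \<alpha> (berger a b) (berger (grad1 a b) (grad2 a b))"
  unfolding is_gradient_def
proof (intro conjI allI impI)
  show "berger a b \<in> metrics 4 \<alpha>" by (rule metrics_berger[OF a b])
  show "sym_tensor (berger (grad1 a b) (grad2 a b))" by (rule sym_tensor_berger)
  show "Ck 0 (\<lambda>x. comps (berger (grad1 a b) (grad2 a b)) x $ i $ j)" for i j
    by (rule tensors_Ck[OF tensors_berger order_refl])
  fix \<gamma> \<eta> \<epsilon>
  assume "0 < \<epsilon> \<and> metric_path 4 \<alpha> {-\<epsilon><..<\<epsilon>} \<gamma> \<and> \<gamma> 0 = berger a b \<and> has_path_derivative 4 \<alpha> \<gamma> \<eta> 0"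
  then have path: "metric_path 4 \<alpha> {-\<epsilon><..<\<epsilon>} \<gamma>" "\<epsilon> > 0" and \<gamma>0: "\<gamma> 0 = berger a b"
    and der: "has_path_derivative 4 \<alpha> \<gamma> \<eta> 0" by auto
  have \<eta>: "\<eta> \<in> tensors 4 \<alpha>" using der by (simp add: has_path_derivative_def)
  let ?A = "dmat a b"
  have detA: "det ?A > 0" using a b by (simp add: det_dmat)
  obtain \<delta> where \<delta>: "\<delta> > 0" and reg: "regular (cball (const_jet ?A) \<delta>)"
    using regular_cball[OF detA] by blast
  let ?\<Omega> = "cball (const_jet ?A) \<delta>"
  \<comment> \<open>Only first derivatives are wanted here, so the distinguished direction of
    \<open>C11_dir\<close> is set to 0.\<close>
  obtain D where D: "C11_on ?\<Omega> dens_jet D"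
    using C11_dir_dens[OF reg, of 0] unfolding C11_dir_def by blast
  obtain E where E: "C11_on ?\<Omega> curv_jet E"
    using C11_dir_curv[OF reg, of 0] unfolding C11_dir_def by blast
  have J0: "jet (comps (\<gamma> 0)) x = const_jet ?A" if "x \<in> S3" for x
    using jet_berger[OF that] by (simp add: \<gamma>0)
  have lin: "linear (D (const_jet ?A))" "linear (E (const_jet ?A))"
    using D E \<delta> unfolding C11_on_def by auto
  have ck: "continuous_on S3 (jet (comps \<eta>))"
    by (intro continuous_on_jet tensors_Ck[OF \<eta>]) simp
  define M :: "real^3^3" where "M = (\<chi> i j. sphere_integral (\<lambda>x. comps \<eta> x $ i $ j))"
  \<comment> \<open>The closed formula for \<open>curv_jet\<close> is valid on symmetric matrices,
    so the line from \<open>?A\<close> in direction \<open>M\<close> must consist of such.\<close>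
  have Msym: "M $ i $ j = M $ j $ i" for i j
  proof -
    have "continuous_on S3 (\<lambda>x. comps \<eta> x $ i $ j)"
      using Ck_continuous[OF tensors_Ck[OF \<eta>], of 4 "[]"] by simp
    then show ?thesis
      unfolding M_def by (simp, intro sphere_integral_cong) (auto simp: comps_sym[OF \<eta>])
  qed
  have cont: "continuous_on S3 (\<lambda>x. l (jet (comps (\<gamma> 0)) x) (jet (comps \<eta>) x))"
    and int: "sphere_integral (\<lambda>x. l (jet (comps (\<gamma> 0)) x) (jet (comps \<eta>) x)) = l (const_jet ?A) (const_jet M)"
    if "linear (l (const_jet ?A))" for l :: "jet \<Rightarrow> jet \<Rightarrow> real"
  proof -
    have c: "continuous_on S3 (\<lambda>x. l (const_jet ?A) (jet (comps \<eta>) x))"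
      by (rule continuous_on_linear_comp[OF that ck])
    then show "continuous_on S3 (\<lambda>x. l (jet (comps (\<gamma> 0)) x) (jet (comps \<eta>) x))"
      by (rule continuous_on_eq) (simp add: J0)
    have "sphere_integral (\<lambda>x. l (jet (comps (\<gamma> 0)) x) (jet (comps \<eta>) x))
       = sphere_integral (\<lambda>x. l (const_jet ?A) (jet (comps \<eta>) x))"
      by (rule sphere_integral_cong[OF c, symmetric]) (simp add: J0)
    then show "sphere_integral (\<lambda>x. l (jet (comps (\<gamma> 0)) x) (jet (comps \<eta>) x)) = l (const_jet ?A) (const_jet M)"
      using sphere_integral_linear[OF ck that] jet_mean[OF \<eta>] by (simp add: M_def)
  qed
  have const: "sphere_integral (\<lambda>x. p (jet (comps (\<gamma> 0)) x)) = p (const_jet ?A) * sphere_area" for p :: "jet \<Rightarrow> real"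
  proof -
    have "sphere_integral (\<lambda>x. p (const_jet ?A)) = sphere_integral (\<lambda>x. p (jet (comps (\<gamma> 0)) x))"
      by (rule sphere_integral_cong[OF continuous_on_const]) (simp only: J0)
    then show ?thesis by (simp only: sphere_integral_const)
  qed
  define w where "w = sqrt (det ?A)"
  have w: "w > 0" "det ?A = w * w" using detA by (auto simp: w_def)
  define P where "P = (w * sphere_area) powr (1/3)"
  have Asym: "?A $ i $ j = ?A $ j $ i" for i j by simp
  have nz: "det ?A \<noteq> 0" using detA by simp
  let ?X = "var_poly (tr3 ?A) (minors3 ?A) (det ?A) (tr3 M) (minors_deriv ?A M) (det_deriv ?A M)"
  have "((\<lambda>t. F_third (\<gamma> t)) has_real_derivative P * w * inverse (det ?A) ^ 3 * ?X / 3) (at 0)"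
  proof (rule DERIV_cong[OF F_third_has_derivative[OF path der reg \<delta> _ D E cont[of D, OF lin(1)] cont[of E, OF lin(2)]]])
    show "cball (jet (comps (\<gamma> 0)) x) \<delta> \<subseteq> ?\<Omega>" if "x \<in> S3" for x using J0[OF that] by simp
    show "sphere_integral (\<lambda>x. dens_jet (jet (comps (\<gamma> 0)) x)) powr (1 / 3) *
      (sphere_integral (\<lambda>x. D (jet (comps (\<gamma> 0)) x) (jet (comps \<eta>) x)) *
       sphere_integral (\<lambda>x. curv_jet (jet (comps (\<gamma> 0)) x)) /
       (3 * sphere_integral (\<lambda>x. dens_jet (jet (comps (\<gamma> 0)) x))) +
       sphere_integral (\<lambda>x. E (jet (comps (\<gamma> 0)) x) (jet (comps \<eta>) x))) =
      P * w * inverse (det ?A) ^ 3 * ?X / 3"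
      unfolding const int[of D, OF lin(1)] int[of E, OF lin(2)] dens_const_jet curv_const_jet[OF Asym nz]
        dens_jet_deriv_const[OF \<delta> order_refl detA D] curv_jet_deriv_const[OF \<delta> order_refl detA E Asym Msym]
        w_def[symmetric] P_def[symmetric] var_poly_def
      by (rule first_variation_identity[OF w(1) sphere_area_pos w(2)])
  qed
  moreover have "integral_g (comps (berger a b)) (inner_g (comps (berger a b))
       (comps (berger (grad1 a b) (grad2 a b))) (comps \<eta>)) = P * w * inverse (det ?A) ^ 3 * ?X / 3"
  proof -
    let ?u = "grad1 a b / a\<^sup>2" and ?v = "grad2 a b / b\<^sup>2"
    have c: "continuous_on S3 (\<lambda>x. comps \<eta> x $ i $ j)" for i j
      using Ck_continuous[OF tensors_Ck[OF \<eta>], of 4 "[]"] by simp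
    have "integral_g (comps (berger a b)) (inner_g (comps (berger a b))
       (comps (berger (grad1 a b) (grad2 a b))) (comps \<eta>)) =
       sphere_integral (\<lambda>x. (w * ?u) * comps \<eta> x $ 1 $ 1 + ((w * ?v) * comps \<eta> x $ 2 $ 2 + (w * ?v) * comps \<eta> x $ 3 $ 3))"
      unfolding integral_g_def
    proof (rule sphere_integral_cong[symmetric])
      show "continuous_on S3 (\<lambda>x. (w * ?u) * comps \<eta> x $ 1 $ 1 + ((w * ?v) * comps \<eta> x $ 2 $ 2 + (w * ?v) * comps \<eta> x $ 3 $ 3))"
        by (intro continuous_on_add continuous_on_mult_left c)
      fix x :: "real^4" assume x: "x \<in> S3"
      note i = inner_g_dmat[where G = "comps (berger a b)" and T = "comps (berger (grad1 a b) (grad2 a b))" and x = x,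
          OF comps_berger[OF x] comps_berger[OF x]]
      show "(w * ?u) * comps \<eta> x $ 1 $ 1 + ((w * ?v) * comps \<eta> x $ 2 $ 2 + (w * ?v) * comps \<eta> x $ 3 $ 3) =
        inner_g (comps (berger a b)) (comps (berger (grad1 a b) (grad2 a b))) (comps \<eta>) x * sqrt (det (comps (berger a b) x))"
        using a b by (simp add: i comps_berger[OF x] w_def algebra_simps del: dmat_nth)
    qed
    also have "\<dots> = (w * ?u) * M $ 1 $ 1 + ((w * ?v) * M $ 2 $ 2 + (w * ?v) * M $ 3 $ 3)"
      by (simp only: sphere_integral_add[OF continuous_on_mult_left[OF c] continuous_on_add[OF continuous_on_mult_left[OF c] continuous_on_mult_left[OF c]]]
          sphere_integral_add[OF continuous_on_mult_left[OF c] continuous_on_mult_left[OF c]] sphere_integral_cmult)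
        (simp add: M_def)
    also have "\<dots> = w * (?u * M $ 1 $ 1 + ?v * (M $ 2 $ 2 + M $ 3 $ 3))"
      by (simp add: algebra_simps)
    also have "\<dots> = P * w * inverse (det ?A) ^ 3 * ?X / 3"
    proof -
      define K where "K = grad_factor a b"
      have K: "K = P * inverse (det ?A) ^ 3 / 3"
        by (simp add: K_def grad_factor_def P_def w_def det_dmat mult.commute)
      have X: "?X = var_poly (a + 2 * b) (2 * a * b + b\<^sup>2) (a * b\<^sup>2) 1 (2 * b) (b\<^sup>2) * M $ 1 $ 1
         + var_poly (a + 2 * b) (2 * a * b + b\<^sup>2) (a * b\<^sup>2) 1 (a + b) (a * b) * (M $ 2 $ 2 + M $ 3 $ 3)"
        unfolding var_poly_linear[symmetric]
        by (simp only: tr3_dmat minors3_dmat det_dmat det_deriv_dmat minors_deriv_dmat) (simp add: tr3_def add.assoc)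
      have "?u * M $ 1 $ 1 + ?v * (M $ 2 $ 2 + M $ 3 $ 3) = K * ?X"
        unfolding X using a b by (simp add: grad1_def grad2_def K_def[symmetric] distrib_left mult.assoc)
      then show ?thesis by (simp add: K)
    qed
    finally show ?thesis .
  qed
  ultimately show "((\<lambda>s. F_third (\<gamma> s)) has_real_derivative
      integral_g (comps (berger a b)) (inner_g (comps (berger a b)) (comps (berger (grad1 a b) (grad2 a b))) (comps \<eta>))) (at 0)"
    by (simp only:)
qed


section \<open>The infinitesimal deformation\<close>

lemma ginv_round: "x \<in> S3 \<Longrightarrow> ginv (comps round_metric) x = dmat 1 1"
  by (simp add: ginv_def round_metric_berger comps_berger matrix_inv_dmat)

lemma fderiv_zero: "(\<And>y. y \<in> S3 \<Longrightarrow> f y = 0) \<Longrightarrow> x \<in> S3 \<Longrightarrow> fderiv i f x = 0"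
  by (rule fderiv_const)

text \<open>The components are constant, and the Christoffel symbols of the round metric are half
  the structure constants, hence totally antisymmetric; their contractions with a diagonal matrix
  vanish.\<close>

lemma delta_g_berger:
  assumes x: "x \<in> S3"
  shows "delta_g (comps round_metric) (comps (berger a b)) x = 0"
proof -
  have f: "fderiv i (\<lambda>y. comps (berger a b) y $ j $ k) x = 0" for i j k
    by (rule fderiv_const[OF _ x, where c = "dmat a b $ j $ k"]) (simp only: comps_berger)
  show ?thesis
    by (simp add: vec_eq_iff forall_3 delta_g_def nabla2_def f ginv_round[OF x] comps_berger[OF x]
      christoffel_round[OF x] struct_coeff_values[OF x] sum_3)
qed

lemma tr_g_berger:
  assumes x: "x \<in> S3"
  shows "tr_g (comps round_metric) (comps (berger a b)) x = a + 2 * b"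
  by (simp add: tr_g_def ginv_round[OF x] comps_berger[OF x] sum_3)

lemma beta_g_zero:
  assumes "\<And>y. y \<in> S3 \<Longrightarrow> H y = 0" and x: "x \<in> S3"
  shows "beta_g G H x = 0"
proof -
  have "fderiv i (\<lambda>y. H y $ j $ k) x = 0" for i j k
    by (rule fderiv_zero[OF _ x]) (simp add: assms(1))
  moreover have "fderiv j (tr_g G H) x = 0" for j
    by (rule fderiv_zero[OF _ x]) (simp add: assms(1) tr_g_def)
  ultimately show ?thesis
    by (simp add: vec_eq_iff beta_g_def delta_g_def nabla2_def assms(1)[OF x])
qed

lemma killing_g_zero:
  assumes "\<And>y. y \<in> S3 \<Longrightarrow> \<omega> y = 0" and x: "x \<in> S3"
  shows "killing_g G \<omega> x = 0"
proof -
  have "fderiv i (\<lambda>y. \<omega> y $ j) x = 0" for i j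
    by (rule fderiv_zero[OF _ x]) (simp add: assms(1))
  then show ?thesis
    by (simp add: vec_eq_iff killing_g_def nabla1_def div_g_def assms(1)[OF x])
qed

text \<open>Stated for a cofactor that is merely continuous at 0, so that the fractional power in
  \<open>grad_factor\<close> is never differentiated.\<close>

lemma has_derivative_zero_square:
  fixes K :: "real \<Rightarrow> real"
  assumes "isCont K 0"
  shows "((\<lambda>s. s\<^sup>2 * K s) has_real_derivative 0) (at 0)"
proof (rule has_real_derivative_remainder)
  show "\<forall>\<^sub>F t in at 0. \<bar>t\<^sup>2 * K t - 0\<^sup>2 * K 0 - t * 0\<bar> \<le> \<bar>t\<bar> * \<bar>t * K t\<bar>"
    by (simp add: abs_mult power2_eq_square mult.assoc[symmetric])
  have "((\<lambda>t. \<bar>t * K t\<bar>) \<longlongrightarrow> \<bar>0 * K 0\<bar>) (at 0)"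
    using assms by (intro tendsto_intros) (simp add: isCont_def)
  then show "((\<lambda>t. \<bar>t * K t\<bar>) \<longlongrightarrow> 0) (at 0)" by simp
qed

lemma isCont_grad_factor: "isCont (\<lambda>s. grad_factor (1 - 2 * s) (1 + s)) 0"
  unfolding grad_factor_def isCont_def using sphere_area_pos by (intro tendsto_intros) auto

lemma grad_derivative_zero:
  "((\<lambda>s. grad1 (1 - 2 * s) (1 + s)) has_real_derivative 0) (at 0)"
  "((\<lambda>s. grad2 (1 - 2 * s) (1 + s)) has_real_derivative 0) (at 0)"
proof -
  \<comment> \<open>The quartic is the exact quotient of \<open>var_poly\<close> by
    \<open>s^2\<close> along this line; the one in \<open>e2\<close> arises in the same way for the
    other diagonal directions.\<close>
  have e1: "grad1 (1 - 2 * s) (1 + s) = s\<^sup>2 * ((1 - 2 * s)\<^sup>2 * (grad_factor (1 - 2 * s) (1 + s) *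
      (960 - 1920 * s - 2880 * s^2 + 3840 * s^3 + 3840 * s^4)))" for s
  proof -
    have "var_poly ((1 - 2 * s) + 2 * (1 + s)) (2 * (1 - 2 * s) * (1 + s) + (1 + s)\<^sup>2) ((1 - 2 * s) * (1 + s)\<^sup>2)
      1 (2 * (1 + s)) ((1 + s)\<^sup>2) = s\<^sup>2 * (960 - 1920 * s - 2880 * s^2 + 3840 * s^3 + 3840 * s^4)"
      unfolding var_poly_def curv_poly_deriv_def curv_poly_def by algebra
    then show ?thesis by (simp only: grad1_def mult.left_commute)
  qed
  have e2: "grad2 (1 - 2 * s) (1 + s) = s\<^sup>2 * ((1 + s)\<^sup>2 * (grad_factor (1 - 2 * s) (1 + s) *
      (- 480 + 2400 * s - 2880 * s^2 - 1920 * s^3 + 3840 * s^4)))" for s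
  proof -
    have "var_poly ((1 - 2 * s) + 2 * (1 + s)) (2 * (1 - 2 * s) * (1 + s) + (1 + s)\<^sup>2) ((1 - 2 * s) * (1 + s)\<^sup>2)
      1 ((1 - 2 * s) + (1 + s)) ((1 - 2 * s) * (1 + s)) = s\<^sup>2 * (- 480 + 2400 * s - 2880 * s^2 - 1920 * s^3 + 3840 * s^4)"
      unfolding var_poly_def curv_poly_deriv_def curv_poly_def by algebra
    then show ?thesis by (simp only: grad2_def mult.left_commute)
  qed
  show "((\<lambda>s. grad1 (1 - 2 * s) (1 + s)) has_real_derivative 0) (at 0)"
    unfolding e1 by (rule has_derivative_zero_square) (intro continuous_intros isCont_grad_factor)
  show "((\<lambda>s. grad2 (1 - 2 * s) (1 + s)) has_real_derivative 0) (at 0)"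
    unfolding e2 by (rule has_derivative_zero_square) (intro continuous_intros isCont_grad_factor)
qed

lemma transverse_traceless_berger: "transverse_traceless round_metric (berger (-2) 1)"
  by (simp add: transverse_traceless_def delta_g_berger tr_g_berger)

lemma berger_H1: "berger (-2) 1 \<in> H1_third \<alpha> round_metric"
proof -
  let ?h = "berger (-2) 1" and ?G = "comps round_metric"
  define L :: tensor2 where "L = (\<lambda>x v w. 0)"
  define T where "T s = berger (grad1 (1 - 2 * s) (1 + s)) (grad2 (1 - 2 * s) (1 + s))" for s
  have path: "(\<lambda>x v w. round_metric x v w + s * ?h x v w) = berger (1 - 2 * s) (1 + s)" for s
    by (simp add: fun_eq_iff round_metric_def berger_def algebra_simps)
  have "is_linearized_gradient \<alpha> round_metric ?h L"
    unfolding is_linearized_gradient_def path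
  proof (intro exI[of _ T] conjI ballI)
    \<comment> \<open>On this interval both weights \<open>1 - 2 * s\<close> and
      \<open>1 + s\<close> are positive, so the gradient formula for Berger metrics applies.\<close>
    have "\<forall>\<^sub>F s::real in nhds 0. s \<in> {-1/2<..<1/2}"
      by (rule eventually_nhds_in_open) auto
    then show "\<forall>\<^sub>F s in nhds 0. is_gradient \<alpha> (berger (1 - 2 * s) (1 + s)) (T s)"
      unfolding T_def by eventually_elim (intro is_gradient_berger, auto)
    show "((\<lambda>s. T s x v w) has_real_derivative L x v w) (at 0)" for x v w
      unfolding T_def L_def berger_def
      by (auto intro!: derivative_eq_intros grad_derivative_zero)
  qed
  moreover have "comps L x + (1/2) *\<^sub>R killing_g ?G (beta_g ?G (killing_g ?G (beta_g ?G (comps ?h)))) x = 0"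
    if x: "x \<in> S3" for x
  proof -
    have "beta_g ?G (comps ?h) y = 0" if "y \<in> S3" for y
    proof -
      have "fderiv j (tr_g ?G (comps ?h)) y = 0" for j
        by (rule fderiv_zero[OF _ that]) (simp add: tr_g_berger)
      then show ?thesis by (simp add: beta_g_def delta_g_berger[OF that] vec_eq_iff)
    qed
    then have "killing_g ?G (beta_g ?G (killing_g ?G (beta_g ?G (comps ?h)))) x = 0"
      by (rule killing_g_zero[OF beta_g_zero[OF killing_g_zero] x])
    then show ?thesis by (simp add: comps_def L_def vec_eq_iff)
  qed
  moreover have "integral_g ?G (tr_g ?G (comps ?h)) = 0"
    using sphere_integral_cong[of "\<lambda>x. 0" "\<lambda>x. tr_g ?G (comps ?h) x * sqrt (det (?G x))"]
    by (simp add: integral_g_def tr_g_berger sphere_integral_const)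
  ultimately show ?thesis
    unfolding H1_third_def using tensors_berger by blast
qed

lemma berger_nonzero: "\<not> tensor_zero (berger (-2) 1)"
proof
  assume "tensor_zero (berger (-2) 1)"
  then have "comps (berger (-2) 1) (axis 1 1) $ 2 $ 2 = 0"
    using S3_nonempty frame_tangent by (simp add: tensor_zero_def comps_def)
  then show False by (simp add: comps_berger[OF S3_nonempty])
qed

section \<open>A path along which the functional decreases\<close>

text \<open>The exponent 6 clears both roots: the density is \<open>a^3\<close>, and the cube root
  of the volume contributes a factor \<open>a\<close>.\<close>

lemma F_third_berger:
  assumes "a > 0"
  shows "F_third (berger (a^6) 1) = (8/3) * sphere_area powr (1/3) * sphere_area * (a^4 * (5 * a^12 - 16 * a^6 + 20))"
proof -
  let ?A = "dmat (a^6) 1"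
  have det: "det ?A = a^6" by (simp add: det_dmat)
  have reg: "regular {const_jet ?A}"
    unfolding regular_def using assms by (auto simp: det intro!: exI[of _ "a^6"])
  have int: "sphere_integral (\<lambda>x. p (jet (comps (berger (a^6) 1)) x)) = p (const_jet ?A) * sphere_area" for p :: "jet \<Rightarrow> real"
  proof -
    have "sphere_integral (\<lambda>x. p (const_jet ?A)) = sphere_integral (\<lambda>x. p (jet (comps (berger (a^6) 1)) x))"
      by (rule sphere_integral_cong[OF continuous_on_const]) (simp only: jet_berger)
    then show ?thesis by (simp only: sphere_integral_const)
  qed
  have s: "sqrt (a^6) = a^3"
    using assms real_sqrt_unique[of "a^3" "a^6"] by (simp add: power_mult[symmetric])
  have F: "F_third (berger (a^6) 1) = (dens_jet (const_jet ?A) * sphere_area) powr (1/3) * (curv_jet (const_jet ?A) * sphere_area)"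
    using F_third_jet[OF tensors_Ck[OF tensors_berger, of 2 2] reg] jet_berger int by simp
  have dens: "dens_jet (const_jet ?A) = a^3"
    by (simp only: dens_const_jet det s)
  have curv: "curv_jet (const_jet ?A) = (8/3) * (a^3 * (5 * a^12 - 16 * a^6 + 20))"
  proof -
    have "curv_jet (const_jet ?A) = curv_poly (a^6 + 2) (2 * a^6 + 1) (a^6) * (inverse (a^6))\<^sup>2 * a^3"
      using curv_const_jet[of ?A] assms by (simp add: det tr3_dmat minors3_dmat s)
    moreover have "curv_poly (a^6 + 2) (2 * a^6 + 1) (a^6) = (8/3) * ((5 * a^12 - 16 * a^6 + 20) * (a^6)\<^sup>2)"
      unfolding curv_poly_def by algebra
    moreover have k: "(a^6)\<^sup>2 * (inverse (a^6))\<^sup>2 = 1"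
      using assms by (simp only: power_mult_distrib[symmetric]) simp
    moreover have "(8/3) * (y * k) * i * c = (8/3) * (c * y)" if "k * i = 1" for y k i c :: real
    proof -
      have "(8/3) * (y * k) * i * c = (8/3) * (c * y) * (k * i)" by simp
      then show ?thesis by (simp only: that mult_1_right)
    qed
    ultimately show ?thesis by (simp only:)
  qed
  have "(a^3 * sphere_area) powr (1/3) = a * sphere_area powr (1/3)"
  proof -
    have "(a^3) powr (1/3) = a"
      using assms powr_powr[of a 3 "1/3"] by (simp add: powr_numeral)
    then show ?thesis using assms sphere_area_pos by (simp add: powr_mult)
  qed
  then show ?thesis unfolding F dens curv by (simp add: power_numeral_reduce)
qed

text \<open>The constant 9 is the value at \<open>a = 1\<close>. There the difference has a triple
  zero in \<open>a^2\<close>, reflecting a horizontal inflection of the energy, and the other factor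
  has only positive coefficients.\<close>

lemma berger_poly_less:
  fixes a :: real
  assumes "0 < a" "a < 1"
  shows "a^4 * (5 * a^12 - 16 * a^6 + 20) < 9"
proof -
  have "9 - a^4 * (5 * a^12 - 16 * a^6 + 20) =
     (1 - a\<^sup>2)^3 * (9 + 27 * a^2 + 34 * a^4 + 30 * a^6 + 15 * a^8 + 5 * a^10)"
    by algebra
  moreover have "(1 - a\<^sup>2)^3 > 0"
    using assms by (intro zero_less_power) (simp add: power_less_one_iff)
  moreover have "9 + 27 * a^2 + 34 * a^4 + 30 * a^6 + 15 * a^8 + 5 * a^10 > 0"
    using assms by (intro add_pos_pos) auto
  ultimately have "9 - a^4 * (5 * a^12 - 16 * a^6 + 20) > 0"
    by (simp only: mult_pos_pos)
  then show ?thesis by simp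
qed

text \<open>The sixth power makes the roots in the functional polynomial in \<open>s\<close>.\<close>

definition berger_path :: "real \<Rightarrow> tensor2" where
  "berger_path s = berger (((1 + s) / 2)^6) 1"

lemma berger_path_1: "berger_path 1 = round_metric"
  by (simp add: berger_path_def round_metric_berger)

text \<open>The squashing factor is at least \<open>(1/2)^6\<close> on the whole interval, so no
  metric degenerates. Differences along the path are Berger tensors, and their norm is the same for
  all \<open>k\<close>.\<close>

lemma metric_path_berger_path: "metric_path k \<alpha> {0..1} berger_path"
  unfolding metric_path_def
proof (intro ballI conjI)
  fix s :: real assume s: "s \<in> {0..1}"
  show "berger_path s \<in> metrics k \<alpha>"
    unfolding berger_path_def using s by (intro metrics_berger) auto
  have "(\<lambda>x v w. berger_path t x v w - berger_path s x v w) = berger (((1 + t) / 2)^6 - ((1 + s) / 2)^6) 0" for t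
    by (simp add: berger_path_def berger_def fun_eq_iff algebra_simps)
  then have "(\<lambda>t. tensor_norm k \<alpha> (\<lambda>x v w. berger_path t x v w - berger_path s x v w)) =
     (\<lambda>t. \<bar>((1 + t) / 2)^6 - ((1 + s) / 2)^6\<bar>)"
    by (simp add: tensor_norm_berger)
  moreover have "((\<lambda>t. \<bar>((1 + t) / 2)^6 - ((1 + s) / 2)^6\<bar>) \<longlongrightarrow> \<bar>((1 + s) / 2)^6 - ((1 + s) / 2)^6\<bar>) (at s within {0..1})"
    by (intro tendsto_intros) auto
  ultimately show "((\<lambda>t. tensor_norm k \<alpha> (\<lambda>x v w. berger_path t x v w - berger_path s x v w)) \<longlongrightarrow> 0) (at s within {0..1})"
    by simp
qed

lemma F_third_berger_path:
  assumes "s \<in> {0..<1}"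
  shows "F_third (berger_path s) < F_third round_metric"
proof -
  define c where "c = (8/3) * sphere_area powr (1/3) * sphere_area"
  have c: "c > 0" using sphere_area_pos by (simp add: c_def)
  have "F_third (berger_path s) = c * (((1 + s) / 2)^4 * (5 * ((1 + s) / 2)^12 - 16 * ((1 + s) / 2)^6 + 20))"
    unfolding berger_path_def c_def by (rule F_third_berger) (use assms in auto)
  also have "\<dots> < c * 9"
    using c berger_poly_less[of "(1 + s) / 2"] assms by (intro mult_strict_left_mono) auto
  also have "c * 9 = F_third round_metric"
    using F_third_berger[of 1] by (simp add: round_metric_berger c_def)
  finally show ?thesis .
qed

lemma not_local_minimizer_round: "\<not> local_minimizer \<alpha> round_metric"
proof
  assume "local_minimizer \<alpha> round_metric"
  then obtain \<epsilon> where \<epsilon>: "\<epsilon> > 0" "\<And>g. g \<in> metrics 2 \<alpha> \<Longrightarrow>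
      tensor_norm 2 \<alpha> (\<lambda>x v w. g x v w - round_metric x v w) < \<epsilon> \<Longrightarrow> F_third round_metric \<le> F_third g"
    unfolding local_minimizer_def by blast
  have path: "berger_path s \<in> metrics 2 \<alpha>" if "s \<in> {0..1}" for s
    using metric_path_berger_path[of 2 \<alpha>] that unfolding metric_path_def by blast
  have "((\<lambda>t. tensor_norm 2 \<alpha> (\<lambda>x v w. berger_path t x v w - berger_path 1 x v w)) \<longlongrightarrow> 0) (at 1 within {0..1})"
    using metric_path_berger_path[of 2 \<alpha>] unfolding metric_path_def by auto
  then have "\<forall>\<^sub>F t in at 1 within {0..1}. tensor_norm 2 \<alpha> (\<lambda>x v w. berger_path t x v w - round_metric x v w) < \<epsilon>"
    using \<epsilon>(1) unfolding berger_path_1 by (rule order_tendstoD(2))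
  then obtain d where d: "d > 0" "\<And>t. t \<in> {0..1} \<Longrightarrow> t \<noteq> 1 \<Longrightarrow> dist t 1 < d \<Longrightarrow>
      tensor_norm 2 \<alpha> (\<lambda>x v w. berger_path t x v w - round_metric x v w) < \<epsilon>"
    unfolding eventually_at by blast
  define t where "t = max 0 (1 - d / 2)"
  have t: "t \<in> {0..<1}" "dist t 1 < d" using d(1) by (auto simp: t_def dist_real_def)
  have "F_third round_metric \<le> F_third (berger_path t)"
    using t by (intro \<epsilon>(2) path d(2)) auto
  then show False using F_third_berger_path[OF t(1)] by simp
qed


section \<open>Obstruction to integrability\<close>

text \<open>The vector \<open>x\<close> and its three images under the frame are orthogonal of equal
  length. Expanding \<open>v\<close> in them is Euler's four-square identity, which is polynomial
  and holds for all \<open>x\<close> and \<open>v\<close>.\<close>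

lemma tangent_norm:
  assumes "x \<in> S3" "v \<in> tangent x"
  shows "v \<bullet> v = (\<Sum>i\<in>UNIV. (v \<bullet> frame i x)\<^sup>2)"
proof -
  have "(v \<bullet> v) * (x \<bullet> x) = (x \<bullet> v)\<^sup>2 + (\<Sum>i\<in>UNIV. (v \<bullet> frame i x)\<^sup>2)"
    by (simp add: sum_3 frame_def inner_vec_def sum_4 vector_def power2_eq_square algebra_simps)
  moreover have "x \<bullet> x = 1" using assms(1) by (simp add: mem_sphere_0 norm_eq_1)
  ultimately show ?thesis using assms(2) by (simp add: tangent_def)
qed

lemma tangent_expansion:
  assumes x: "x \<in> S3" and v: "v \<in> tangent x"
  shows "v = (\<Sum>i\<in>UNIV. (v \<bullet> frame i x) *\<^sub>R frame i x)"
proof -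
  define u where "u = v - (\<Sum>i\<in>UNIV. (v \<bullet> frame i x) *\<^sub>R frame i x)"
  have t: "x \<bullet> frame i x = 0" for i using frame_tangent by (simp add: tangent_def)
  have "u \<in> tangent x"
    using v t by (simp add: tangent_def u_def inner_diff_right sum_3 inner_add_right)
  moreover have "u \<bullet> frame j x = 0" for j
    using exhaust_3[of j]
    by (auto simp: u_def inner_diff_left sum_3 inner_add_left frame_orthonormal[OF x])
  ultimately have "u \<bullet> u = 0" using tangent_norm[OF x] by simp
  then show ?thesis by (simp add: u_def)
qed

lemma sym_tensor_expand:
  assumes g: "sym_tensor g" and x: "x \<in> S3" and v: "v \<in> tangent x"
  shows "g x v v = (\<Sum>i\<in>UNIV. \<Sum>j\<in>UNIV. (v \<bullet> frame i x) * (v \<bullet> frame j x) * comps g x $ i $ j)"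
proof -
  have lin: "g x (a *\<^sub>R u + b *\<^sub>R u') w = a * g x u w + b * g x u' w"
    and sym: "g x u w = g x w u" if "u \<in> tangent x" "u' \<in> tangent x" "w \<in> tangent x" for a b u u' w
    using g x that unfolding sym_tensor_def by blast+
  have comb: "a *\<^sub>R u + b *\<^sub>R u' \<in> tangent x" if "u \<in> tangent x" "u' \<in> tangent x" for a b u u'
    using that by (simp add: tangent_def inner_add_right)
  let ?c = "\<lambda>i. v \<bullet> frame i x"
  have e: "v = ?c 1 *\<^sub>R frame 1 x + 1 *\<^sub>R (?c 2 *\<^sub>R frame 2 x + ?c 3 *\<^sub>R frame 3 x)"
    using tangent_expansion[OF x v] by (simp add: sum_3 add.assoc)
  have ex: "g x v w = (\<Sum>i\<in>UNIV. ?c i * g x (frame i x) w)" if w: "w \<in> tangent x" for w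
    by (subst e) (simp only: lin[OF frame_tangent comb[OF frame_tangent frame_tangent] w]
        lin[OF frame_tangent frame_tangent w] sum_3 mult_1 add.assoc)
  have "g x v v = (\<Sum>i\<in>UNIV. ?c i * g x (frame i x) v)" by (rule ex[OF v])
  also have "\<dots> = (\<Sum>i\<in>UNIV. ?c i * (\<Sum>j\<in>UNIV. ?c j * g x (frame j x) (frame i x)))"
    using ex[OF frame_tangent] sym[OF frame_tangent frame_tangent v] by simp
  also have "\<dots> = (\<Sum>i\<in>UNIV. \<Sum>j\<in>UNIV. ?c i * ?c j * comps g x $ i $ j)"
    using sym[OF frame_tangent frame_tangent frame_tangent]
    by (simp add: comps_def sum_distrib_left mult.assoc)
  finally show ?thesis .
qed

text \<open>With \<open>c_i\<close> the frame coefficients of \<open>v\<close>, each of the nine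
  errors is at most \<open>(c_i^2 + c_j^2) / 12\<close>; together they amount to
  \<open>(v \<bullet> v) / 2\<close>. This fixes the tolerance \<open>1/6\<close>.\<close>

lemma near_round_bound:
  assumes g: "sym_tensor g" and x: "x \<in> S3" and v: "v \<in> tangent x"
    and near: "\<And>i j. \<bar>comps g x $ i $ j - dmat 1 1 $ i $ j\<bar> \<le> 1/6"
  shows "g x v v \<ge> (v \<bullet> v) / 2"
proof -
  let ?c = "\<lambda>i. v \<bullet> frame i x"
  have tm: "?c i * ?c j * comps g x $ i $ j \<ge> ?c i * ?c j * dmat 1 1 $ i $ j - ((?c i)\<^sup>2 + (?c j)\<^sup>2) / 12" for i j
  proof -
    have "\<bar>?c i * ?c j\<bar> \<le> ((?c i)\<^sup>2 + (?c j)\<^sup>2) / 2"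
      using sum_squares_bound[of "\<bar>?c i\<bar>" "\<bar>?c j\<bar>"] by (simp add: abs_mult)
    then have "\<bar>?c i * ?c j\<bar> * \<bar>comps g x $ i $ j - dmat 1 1 $ i $ j\<bar> \<le> ((?c i)\<^sup>2 + (?c j)\<^sup>2) / 2 * (1/6)"
      by (rule mult_mono[OF _ near]) auto
    then have "\<bar>?c i * ?c j * (comps g x $ i $ j - dmat 1 1 $ i $ j)\<bar> \<le> ((?c i)\<^sup>2 + (?c j)\<^sup>2) / 12"
      by (simp only: abs_mult)
    then show ?thesis unfolding right_diff_distrib abs_le_iff by linarith
  qed
  have "(v \<bullet> v) / 2 = (\<Sum>i\<in>UNIV. \<Sum>j\<in>UNIV. ?c i * ?c j * dmat 1 1 $ i $ j - ((?c i)\<^sup>2 + (?c j)\<^sup>2) / 12)"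
    by (simp add: tangent_norm[OF x v] sum_3 power2_eq_square field_simps)
  also have "\<dots> \<le> (\<Sum>i\<in>UNIV. \<Sum>j\<in>UNIV. ?c i * ?c j * comps g x $ i $ j)"
    by (intro sum_mono tm)
  finally show ?thesis by (simp only: sym_tensor_expand[OF g x v])
qed

text \<open>\<open>is_gradient\<close> speaks only about paths of metrics, so testing criticality in
  direction \<open>h\<close> requires an admissible path. As \<open>|h x v v|\<close> is at most
  \<open>2 * (v \<bullet> v)\<close>, times below \<open>1/8\<close> change the form by at most
  \<open>(v \<bullet> v) / 4\<close>, half of what \<open>near_round_bound\<close>
  guarantees.\<close>

lemma perturbed_path:
  assumes g: "g \<in> metrics 4 \<alpha>"
    and near: "\<And>x i j. x \<in> S3 \<Longrightarrow> \<bar>comps g x $ i $ j - dmat 1 1 $ i $ j\<bar> \<le> 1/6"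
  defines "\<gamma> \<equiv> (\<lambda>t x v w. g x v w + t * berger (-2) 1 x v w)"
  shows "metric_path 4 \<alpha> {-(1/8)<..<1/8} \<gamma>" and "\<gamma> 0 = g" and "has_path_derivative 4 \<alpha> \<gamma> (berger (-2) 1) 0"
proof -
  let ?h = "berger (-2) 1"
  have gt: "g \<in> tensors 4 \<alpha>" using g by (simp add: metrics_def)
  have tens: "\<gamma> t \<in> tensors 4 \<alpha>" for t
    using tensors_lincomb[OF gt tensors_berger, of 1 t "-2" 1] by (simp add: \<gamma>_def)
  have pos: "\<gamma> t x v v > 0" if x: "x \<in> S3" and v: "v \<in> tangent x" "v \<noteq> 0" and t: "\<bar>t\<bar> < 1/8" for t x v
  proof -
    define c where "c = v \<bullet> frame 1 x"
    have "c\<^sup>2 \<le> (v \<bullet> v) * (frame 1 x \<bullet> frame 1 x)"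
      unfolding c_def by (rule Cauchy_Schwarz_ineq)
    then have le: "c\<^sup>2 \<le> v \<bullet> v" using frame_orthonormal[OF x, of 1 1] by simp
    have "?h x v v = v \<bullet> v - 3 * c\<^sup>2"
      by (simp add: berger_def c_def power2_eq_square)
    then have "\<bar>?h x v v\<bar> \<le> 2 * (v \<bullet> v)"
      using le zero_le_power2[of c] unfolding abs_le_iff by linarith
    then have "\<bar>t\<bar> * \<bar>?h x v v\<bar> \<le> (1/8) * (2 * (v \<bullet> v))"
      using t by (intro mult_mono) auto
    then have "t * ?h x v v \<ge> - ((v \<bullet> v) / 4)"
      unfolding abs_mult[symmetric] abs_le_iff by linarith
    moreover have "g x v v \<ge> (v \<bullet> v) / 2"
      by (rule near_round_bound[OF _ x v(1) near[OF x]]) (use gt in \<open>simp add: tensors_def\<close>)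
    moreover have "v \<bullet> v > 0" using v(2) by simp
    ultimately show ?thesis unfolding \<gamma>_def by linarith
  qed
  have met: "\<gamma> t \<in> metrics 4 \<alpha>" if "t \<in> {-(1/8)<..<1/8}" for t
    using tens pos that by (auto simp: metrics_def abs_less_iff)
  have diff: "(\<lambda>x v w. \<gamma> t x v w - \<gamma> s x v w) = berger (-2 * (t - s)) (t - s)" for t s
    by (simp add: fun_eq_iff \<gamma>_def berger_def algebra_simps)
  show "metric_path 4 \<alpha> {-(1/8)<..<1/8} \<gamma>"
    unfolding metric_path_def diff tensor_norm_berger
  proof (intro ballI conjI met)
    fix s :: real assume "s \<in> {-(1/8)<..<1/8}"
    have "((\<lambda>t. \<bar>-2 * (t - s)\<bar> + 2 * \<bar>t - s\<bar>) \<longlongrightarrow> \<bar>-2 * (s - s)\<bar> + 2 * \<bar>s - s\<bar>) (at s within {-(1/8)<..<1/8})"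
      by (intro tendsto_intros)
    then show "((\<lambda>t. \<bar>-2 * (t - s)\<bar> + 2 * \<bar>t - s\<bar>) \<longlongrightarrow> 0) (at s within {-(1/8)<..<1/8})" by simp
  qed
  show "\<gamma> 0 = g" by (simp add: \<gamma>_def)
  show "has_path_derivative 4 \<alpha> \<gamma> ?h 0"
    unfolding has_path_derivative_def
  proof (intro conjI tensors_berger)
    have "\<forall>\<^sub>F t in at 0. tensor_norm 4 \<alpha> (\<lambda>x v w. (\<gamma> t x v w - \<gamma> 0 x v w) / (t - 0) - ?h x v w) = 0"
      using eventually_neq_at_within[of "0::real" 0 UNIV]
    proof eventually_elim
      case (elim t)
      then have "(\<lambda>x v w. (\<gamma> t x v w - \<gamma> 0 x v w) / (t - 0) - ?h x v w) = berger 0 0"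
        by (simp add: fun_eq_iff \<gamma>_def) (simp add: berger_def)
      then show ?case by (simp add: tensor_norm_berger)
    qed
    then show "((\<lambda>t. tensor_norm 4 \<alpha> (\<lambda>x v w. (\<gamma> t x v w - \<gamma> 0 x v w) / (t - 0) - ?h x v w)) \<longlongrightarrow> 0) (at 0)"
      by (rule tendsto_eventually)
  qed
qed

text \<open>With volume \<open>V\<close> and curvature integral \<open>A\<close>, the first
  variation \<open>V^(1/3) * (V' * A / (3 * V) + A')\<close> vanishes. Removing the positive factor
  \<open>V^(1/3) / (3 * V)\<close> leaves a relation bilinear in sphere integrals, in which each
  integral can later be replaced by its value at the mean. The direction has the constant jet
  \<open>K\<close>, so the bounds on \<open>D J K\<close> and \<open>E J K\<close> give the required
  continuity.\<close>

lemma critical_near_round: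
  fixes g :: tensor2
  defines "J \<equiv> jet (comps g)" and "K \<equiv> const_jet (dmat (-2) 1)"
  assumes crit: "critical \<alpha> g"
    and near: "\<And>x i j. x \<in> S3 \<Longrightarrow> \<bar>comps g x $ i $ j - dmat 1 1 $ i $ j\<bar> \<le> 1/6"
    and reg: "regular \<Omega>" and d: "d > 0" "\<And>x. x \<in> S3 \<Longrightarrow> cball (J x) d \<subseteq> \<Omega>"
    and D: "C11_on \<Omega> dens_jet D" "C11_on \<Omega> (\<lambda>J. D J K) D1"
    and E: "C11_on \<Omega> curv_jet E" "C11_on \<Omega> (\<lambda>J. E J K) E1"
  shows "sphere_integral (\<lambda>x. D (J x) K) * sphere_integral (\<lambda>x. curv_jet (J x)) +
     3 * (sphere_integral (\<lambda>x. dens_jet (J x)) * sphere_integral (\<lambda>x. E (J x) K)) = 0"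
proof -
  obtain T where T: "is_gradient \<alpha> g T" "tensor_zero T"
    using crit unfolding critical_def by blast
  have g: "g \<in> metrics 4 \<alpha>" using T(1) by (simp add: is_gradient_def)
  define \<gamma> where "\<gamma> = (\<lambda>t x v w. g x v w + t * berger (-2) 1 x v w)"
  have path: "metric_path 4 \<alpha> {-(1/8)<..<1/8} \<gamma>" and \<gamma>0: "\<gamma> 0 = g"
    and der: "has_path_derivative 4 \<alpha> \<gamma> (berger (-2) 1) 0"
    unfolding \<gamma>_def using perturbed_path[OF g near] by blast+
  have grad: "((\<lambda>t. F_third (\<gamma>' t)) has_real_derivative
      integral_g (comps g) (inner_g (comps g) (comps T) (comps h))) (at 0)"
    if "\<epsilon> > 0" "metric_path 4 \<alpha> {-\<epsilon><..<\<epsilon>} \<gamma>'" "\<gamma>' 0 = g" "has_path_derivative 4 \<alpha> \<gamma>' h 0" for \<gamma>' h \<epsilon>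
    using T(1) that unfolding is_gradient_def by blast
  have cJ: "continuous_on S3 J"
    unfolding J_def using g by (intro continuous_on_jet tensors_Ck[of _ 4 \<alpha>]) (auto simp: metrics_def)
  have J\<Omega>: "J x \<in> \<Omega>" if "x \<in> S3" for x using d(2)[OF that] d(1) by auto
  have h: "jet (comps (berger (-2) 1)) x = K" if "x \<in> S3" for x
    using jet_berger[OF that] by (simp add: K_def)
  have c: "continuous_on S3 (\<lambda>x. l (J x) K)" if "C11_on \<Omega> (\<lambda>J. l J K) l'" for l :: "jet \<Rightarrow> jet \<Rightarrow> real" and l'
    by (rule continuous_on_compose2[OF C11_on_continuous[OF that] cJ]) (use J\<Omega> in auto)
  have c': "continuous_on S3 (\<lambda>x. l (jet (comps (\<gamma> 0)) x) (jet (comps (berger (-2) 1)) x))"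
    and i: "sphere_integral (\<lambda>x. l (jet (comps (\<gamma> 0)) x) (jet (comps (berger (-2) 1)) x)) = sphere_integral (\<lambda>x. l (J x) K)"
    if "C11_on \<Omega> (\<lambda>J. l J K) l'" for l :: "jet \<Rightarrow> jet \<Rightarrow> real" and l'
    by (rule continuous_on_eq[OF c[of l, OF that]], simp add: h \<gamma>0 J_def)
      (rule sphere_integral_cong[OF c[of l, OF that], symmetric], simp add: h \<gamma>0 J_def)
  have V: "sphere_integral (\<lambda>x. dens_jet (J x)) > 0"
    by (rule sphere_integral_dens_pos[OF reg cJ J\<Omega>])
  have "((\<lambda>t. F_third (\<gamma> t)) has_real_derivative
     sphere_integral (\<lambda>x. dens_jet (J x)) powr (1/3) *
       (sphere_integral (\<lambda>x. D (J x) K) * sphere_integral (\<lambda>x. curv_jet (J x)) /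
        (3 * sphere_integral (\<lambda>x. dens_jet (J x))) + sphere_integral (\<lambda>x. E (J x) K))) (at 0)"
    using F_third_has_derivative[OF path _ der reg d(1) _ D(1) E(1) c'[of D, OF D(2)] c'[of E, OF E(2)]]
      d(2) unfolding i[of D, OF D(2)] i[of E, OF E(2)] by (simp add: \<gamma>0 J_def)
  moreover have "((\<lambda>t. F_third (\<gamma> t)) has_real_derivative
      integral_g (comps g) (inner_g (comps g) (comps T) (comps (berger (-2) 1)))) (at 0)"
    by (rule grad[OF _ path \<gamma>0 der]) simp
  moreover have "integral_g (comps g) (inner_g (comps g) (comps T) (comps (berger (-2) 1))) = 0"
  proof -
    have "comps T x = 0" if "x \<in> S3" for x
      using T(2) that frame_tangent by (simp add: tensor_zero_def comps_def vec_eq_iff)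
    then have z: "inner_g (comps g) (comps T) (comps (berger (-2) 1)) x = 0" if "x \<in> S3" for x
      using that by (simp add: inner_g_def)
    have "sphere_integral (\<lambda>x. 0) = integral_g (comps g) (inner_g (comps g) (comps T) (comps (berger (-2) 1)))"
      unfolding integral_g_def by (rule sphere_integral_cong[OF continuous_on_const]) (simp add: z)
    then show ?thesis by (simp add: sphere_integral_const)
  qed
  ultimately have "sphere_integral (\<lambda>x. dens_jet (J x)) powr (1/3) *
       (sphere_integral (\<lambda>x. D (J x) K) * sphere_integral (\<lambda>x. curv_jet (J x)) /
        (3 * sphere_integral (\<lambda>x. dens_jet (J x))) + sphere_integral (\<lambda>x. E (J x) K)) = 0"
    using DERIV_unique by metis
  then have "sphere_integral (\<lambda>x. D (J x) K) * sphere_integral (\<lambda>x. curv_jet (J x)) /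
        (3 * sphere_integral (\<lambda>x. dens_jet (J x))) + sphere_integral (\<lambda>x. E (J x) K) = 0"
    using V by simp
  then show ?thesis using V by (simp add: field_simps)
qed


text \<open>Only the tangent of \<open>M\<close> at 0 is prescribed; this determines the limit
  because the linear part of the variation vanishes at the identity. The value is the one on the
  Berger line, where the leading coefficients 960 and -480 of the gradient pair with
  \<open>diag (-2, 1, 1)\<close> to \<open>-2 * 960 + 2 * (-480)\<close>.\<close>

lemma var_poly_second_order:
  fixes M :: "real \<Rightarrow> real^3^3"
  defines "H \<equiv> dmat (-2) 1"
  assumes M0: "M 0 = dmat 1 1" and dM: "\<And>i j. ((\<lambda>s. M s $ i $ j) has_real_derivative H $ i $ j) (at 0)"
  shows "((\<lambda>s. var_poly (tr3 (M s)) (minors3 (M s)) (det (M s)) (tr3 H) (minors_deriv (M s) H)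
     (det_deriv (M s) H) / s\<^sup>2) \<longlongrightarrow> - 2880) (at 0)"
proof -
  let ?s = "\<lambda>s. tr3 (M s)" and ?q = "\<lambda>s. minors3 (M s)" and ?p = "\<lambda>s. det (M s)"
  let ?q' = "\<lambda>s. minors_deriv (M s) H" and ?p' = "\<lambda>s. det_deriv (M s) H"
  have ds: "(?s has_real_derivative 0) (at 0)"
    unfolding tr3_def by (auto intro!: derivative_eq_intros dM simp: H_def)
  have dq: "(?q has_real_derivative 0) (at 0)"
    unfolding minors3_def by (auto intro!: derivative_eq_intros dM simp: H_def M0)
  have dp: "(?p has_real_derivative 0) (at 0)"
    unfolding det_3 by (auto intro!: derivative_eq_intros dM simp: H_def M0)
  have v: "?s 0 = 3" "?q 0 = 3" "?p 0 = 1" by (simp_all add: M0 tr3_dmat minors3_dmat det_dmat)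
  define B where "B = (\<lambda>s. curv_poly (?s s) (?q s) (?p s))"
  have dB: "(B has_real_derivative 0) (at 0)"
    using curv_poly_has_derivative[OF ds dq dp] by (simp add: B_def curv_poly_deriv_def)
  have B0: "B 0 = 24" by (simp add: B_def v curv_poly_def)
  \<comment> \<open>As \<open>tr3 H = 0\<close>, \<open>var_poly\<close> is linear in
    \<open>?q'\<close> and \<open>?p'\<close> alone. \<open>U\<close> is the coefficient of
    \<open>?p'\<close> and \<open>T\<close> the sum of both coefficients, so \<open>var_poly\<close>
    equals \<open>T * ?q' + U * (?p' - ?q')\<close>. That \<open>T\<close> vanishes at 0 is the
    degeneracy of the round metric in direction \<open>H\<close>.\<close>
  define U where "U = (\<lambda>s. 192 * ?p s * ?s s - 4 * B s)"
  define T where "T = (\<lambda>s. 3 * ?p s * ((128/3) * (4 * ?q s - (?s s)\<^sup>2) - 32 * (?s s)\<^sup>2) + U s)"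
  have dU: "(U has_real_derivative 0) (at 0)"
    unfolding U_def by (auto intro!: derivative_eq_intros ds dp dB)
  have dT: "(T has_real_derivative 0) (at 0)"
    unfolding T_def by (auto intro!: derivative_eq_intros ds dq dp dU)
  have "T 0 = 0" by (simp add: T_def U_def v B0)
  then have T: "((\<lambda>s. T s / s) \<longlongrightarrow> 0) (at 0)"
    using dT by (simp add: has_field_derivative_iff)
  have U: "(U \<longlongrightarrow> 480) (at 0)"
    using DERIV_isCont[OF dU] by (simp add: isCont_def U_def v B0)
  have "(?q' has_real_derivative - 6) (at 0)"
    unfolding minors_deriv_def tr3_def sum_3 by (auto intro!: derivative_eq_intros dM simp: H_def)
  moreover have "?q' 0 = 0" by (simp add: minors_deriv_def M0 tr3_def sum_3 H_def)
  ultimately have Q: "((\<lambda>s. ?q' s / s) \<longlongrightarrow> - 6) (at 0)"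
    by (simp add: has_field_derivative_iff)
  define X where "X i j s = (M s $ i $ j - dmat 1 1 $ i $ j) / s" for i j s
  have X: "(X i j \<longlongrightarrow> H $ i $ j) (at 0)" for i j
    using dM[of i j] unfolding has_field_derivative_iff X_def by (simp add: M0)
  have "((\<lambda>s. -2 * (X 2 2 s * X 3 3 s - X 2 3 s * X 3 2 s) + (X 1 1 s * X 3 3 s - X 1 3 s * X 3 1 s)
      + (X 1 1 s * X 2 2 s - X 1 2 s * X 2 1 s)) \<longlongrightarrow>
     -2 * (H $ 2 $ 2 * H $ 3 $ 3 - H $ 2 $ 3 * H $ 3 $ 2) + (H $ 1 $ 1 * H $ 3 $ 3 - H $ 1 $ 3 * H $ 3 $ 1)
      + (H $ 1 $ 1 * H $ 2 $ 2 - H $ 1 $ 2 * H $ 2 $ 1)) (at 0)"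
    by (intro tendsto_intros X)
  then have Z: "((\<lambda>s. -2 * (X 2 2 s * X 3 3 s - X 2 3 s * X 3 2 s) + (X 1 1 s * X 3 3 s - X 1 3 s * X 3 1 s)
      + (X 1 1 s * X 2 2 s - X 1 2 s * X 2 1 s)) \<longlongrightarrow> - 6) (at 0)"
    by (simp add: H_def)
  \<comment> \<open>Write \<open>M = 1 + s X\<close> with the difference quotients \<open>X\<close>.
    Up to first order in \<open>s\<close>, both \<open>?p'\<close> and \<open>?q'\<close> are
    \<open>- s * tr (X H)\<close>; what remains is \<open>s^2 * tr (adj X H)\<close>, whose
    coefficient tends to \<open>3 * det H = - 6\<close>.\<close>
  have e: "(?p' s - ?q' s) / s\<^sup>2 = -2 * (X 2 2 s * X 3 3 s - X 2 3 s * X 3 2 s) + (X 1 1 s * X 3 3 s - X 1 3 s * X 3 1 s)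
      + (X 1 1 s * X 2 2 s - X 1 2 s * X 2 1 s)" if "s \<noteq> 0" for s
  proof -
    have m: "M s $ i $ j = dmat 1 1 $ i $ j + s * X i j s" for i j using that by (simp add: X_def)
    have "?p' s - ?q' s = s\<^sup>2 * (-2 * (X 2 2 s * X 3 3 s - X 2 3 s * X 3 2 s) + (X 1 1 s * X 3 3 s - X 1 3 s * X 3 1 s)
      + (X 1 1 s * X 2 2 s - X 1 2 s * X 2 1 s))"
      unfolding det_deriv_def minors_deriv_def sum_3 adj3_values tr3_def m
      by (simp add: H_def power2_eq_square algebra_simps)
    then show ?thesis using that by simp
  qed
  have "((\<lambda>s. (?p' s - ?q' s) / s\<^sup>2) \<longlongrightarrow> - 6) (at 0)"
    by (rule Lim_transform_eventually[OF Z])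
      (use e in \<open>auto simp: eventually_at intro!: exI[of _ 1]\<close>)
  then have "((\<lambda>s. (T s / s) * (?q' s / s) + U s * ((?p' s - ?q' s) / s\<^sup>2)) \<longlongrightarrow> 0 * (- 6) + 480 * (- 6)) (at 0)"
    by (intro tendsto_intros T U Q)
  moreover have "var_poly (?s s) (?q s) (?p s) (tr3 H) (?q' s) (?p' s) / s\<^sup>2 =
     (T s / s) * (?q' s / s) + U s * ((?p' s - ?q' s) / s\<^sup>2)" for s
  proof -
    have "var_poly (?s s) (?q s) (?p s) (tr3 H) (?q' s) (?p' s) = T s * ?q' s + U s * (?p' s - ?q' s)"
      unfolding var_poly_def curv_poly_deriv_def T_def U_def B_def H_def tr3_dmat
      by (simp add: algebra_simps power2_eq_square)
    then show ?thesis by (simp add: add_divide_distrib power2_eq_square)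
  qed
  ultimately show ?thesis by simp
qed

section \<open>Comparison of a critical metric with its mean\<close>

lemma norm_mean_le:
  fixes J :: "real^4 \<Rightarrow> real^'n"
  assumes J: "continuous_on S3 J" and mean: "\<And>c. sphere_integral (\<lambda>x. J x $ c) = sphere_area * m $ c"
    and le: "\<And>x. x \<in> S3 \<Longrightarrow> norm (J x - a) \<le> \<rho>"
  shows "norm (m - a) \<le> of_nat CARD('n) * \<rho>"
proof (rule norm_vec_le_card)
  fix c
  have cJ: "continuous_on S3 (\<lambda>x. J x $ c)" by (intro continuous_intros J)
  have "\<bar>sphere_integral (\<lambda>x. J x $ c - a $ c)\<bar> \<le> \<rho> * sphere_area"
  proof (rule sphere_integral_abs_le)
    fix x :: "real^4" assume "x \<in> S3"
    then show "\<bar>J x $ c - a $ c\<bar> \<le> \<rho>"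
      using component_le_norm_cart[of "J x - a" c] le by fastforce
  qed (intro continuous_intros J)
  moreover have "sphere_integral (\<lambda>x. J x $ c - a $ c) = sphere_area * (m $ c - a $ c)"
    using sphere_integral_diff[OF cJ continuous_on_const[of _ "a $ c"]]
    by (simp add: mean sphere_integral_const algebra_simps)
  ultimately have "sphere_area * \<bar>m $ c - a $ c\<bar> \<le> sphere_area * \<rho>"
    using sphere_area_pos by (simp add: abs_mult mult.commute)
  then show "\<bar>(m - a) $ c\<bar> \<le> \<rho>" using sphere_area_pos by simp
qed

lemma variation_const:
  fixes w p B B' d :: real
  assumes "w > 0" "p = w * w"
  shows "d / (2 * w) * (B * (inverse p)\<^sup>2 * w) + 3 * (w * (w * inverse p ^ 3 * (p * B' - (3/2) * B * d)))
    = (inverse p)\<^sup>2 * (3 * p * B' - 4 * B * d)"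
  using assms(1) unfolding assms(2) by (simp add: field_simps power2_eq_square power3_eq_cube)

lemma not_integrable_berger: "\<not> integrable_deformation \<alpha> round_metric (berger (-2) 1)"
proof
  assume "integrable_deformation \<alpha> round_metric (berger (-2) 1)"
  then obtain \<gamma> \<epsilon> where \<epsilon>: "\<epsilon> > 0" and path: "metric_path 4 \<alpha> {-\<epsilon><..<\<epsilon>} \<gamma>"
    and crit: "\<And>s. s \<in> {-\<epsilon><..<\<epsilon>} \<Longrightarrow> critical \<alpha> (\<gamma> s)" and \<gamma>0: "\<gamma> 0 = round_metric"
    and der: "has_path_derivative 4 \<alpha> \<gamma> (berger (-2) 1) 0"
    unfolding integrable_deformation_def by blast
  define A where "A = dmat 1 1"
  define H where "H = dmat (-2) 1"
  define J where "J s = jet (comps (\<gamma> s))" for s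
  define J0 where "J0 = const_jet A"
  define K where "K = const_jet H"
  have detA: "det A = 1" by (simp add: A_def det_dmat)
  obtain \<delta> where \<delta>: "\<delta> > 0" and reg: "regular (cball J0 \<delta>)"
    using regular_cball[of A] detA unfolding J0_def by auto
  let ?\<Omega> = "cball J0 \<delta>"
  \<comment> \<open>The critical equation averages the derivatives in direction \<open>K\<close> as
    well, so these too must belong to the class to which the mean value estimate applies.\<close>
  obtain D D1 where D: "C11_on ?\<Omega> dens_jet D" "C11_on ?\<Omega> (\<lambda>J. D J K) D1"
    using C11_dir_dens[OF reg, of K] unfolding C11_dir_def by blast
  obtain E E1 where E: "C11_on ?\<Omega> curv_jet E" "C11_on ?\<Omega> (\<lambda>J. E J K) E1"
    using C11_dir_curv[OF reg, of K] unfolding C11_dir_def by blast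
  have \<gamma>: "\<gamma> s \<in> tensors 4 \<alpha>" if "\<bar>s\<bar> < \<epsilon>" for s
    using path that by (auto simp: metric_path_def metrics_def abs_less_iff)
  have cJ: "continuous_on S3 (J s)" if "\<bar>s\<bar> < \<epsilon>" for s
    unfolding J_def by (intro continuous_on_jet tensors_Ck[OF \<gamma>[OF that]]) simp
  obtain r where r: "(r \<longlongrightarrow> 0) (at 0)"
    "\<And>s x. \<bar>s\<bar> < \<epsilon> \<Longrightarrow> s \<noteq> 0 \<Longrightarrow> x \<in> S3 \<Longrightarrow> norm (J s x - (J0 + s *\<^sub>R K)) \<le> \<bar>s\<bar> * r s"
    using path_jet[OF path \<epsilon> _ der] unfolding \<gamma>0 round_metric_berger
    by (auto simp: jet_berger J_def J0_def A_def K_def H_def diff_diff_eq)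
  define M :: "real \<Rightarrow> real^3^3" where "M s = (\<chi> i j. sphere_integral (\<lambda>x. comps (\<gamma> s) x $ i $ j) / sphere_area)" for s
  define m where "m s = const_jet (M s)" for s
  have mean: "sphere_integral (\<lambda>x. J s x $ c) = sphere_area * m s $ c" if "\<bar>s\<bar> < \<epsilon>" for s c
  proof -
    have "sphere_integral (\<lambda>x. J s x $ c) = const_jet (\<chi> i j. sphere_integral (\<lambda>x. comps (\<gamma> s) x $ i $ j)) $ c"
      using jet_mean[OF \<gamma>[OF that]] by (simp add: J_def vec_eq_iff)
    also have "\<dots> = sphere_area * m s $ c"
      using sphere_area_pos by (auto simp: m_def M_def const_jet_def split: sum.split)
    finally show ?thesis .
  qed
  have m_near: "norm (m s - (J0 + s *\<^sub>R K)) \<le> jet_dim * (\<bar>s\<bar> * r s)" if "\<bar>s\<bar> < \<epsilon>" "s \<noteq> 0" for s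
    by (rule norm_mean_le[OF cJ[OF that(1)] mean[OF that(1)] r(2)[OF that]])
  define \<rho> where "\<rho> s = \<bar>s\<bar> * (jet_dim * r s + norm K)" for s
  have \<rho>: "(\<rho> \<longlongrightarrow> 0) (at 0)"
  proof -
    have "(\<rho> \<longlongrightarrow> \<bar>0\<bar> * (jet_dim * 0 + norm K)) (at 0)"
      unfolding \<rho>_def by (intro tendsto_intros r(1))
    then show ?thesis by simp
  qed
  have near_J0: "norm (y - J0) \<le> \<rho> s" if "norm (y - (J0 + s *\<^sub>R K)) \<le> jet_dim * (\<bar>s\<bar> * r s)" for y s
  proof -
    have "norm (y - J0) \<le> norm (y - (J0 + s *\<^sub>R K)) + norm (s *\<^sub>R K)"
      using norm_triangle_ineq[of "y - (J0 + s *\<^sub>R K)" "s *\<^sub>R K"] by simp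
    then show ?thesis using that by (simp add: \<rho>_def algebra_simps)
  qed
  \<comment> \<open>As \<open>jet_dim\<close> is at least 1, the weaker bound of the mean also holds
    for the jets; from here on both are treated alike.\<close>
  have J_near: "norm (J s x - (J0 + s *\<^sub>R K)) \<le> jet_dim * (\<bar>s\<bar> * r s)" if "\<bar>s\<bar> < \<epsilon>" "s \<noteq> 0" "x \<in> S3" for s x
  proof -
    have "0 \<le> \<bar>s\<bar> * r s" using r(2)[OF that] norm_ge_zero order_trans by blast
    then have "1 * (\<bar>s\<bar> * r s) \<le> jet_dim * (\<bar>s\<bar> * r s)" by (intro mult_right_mono) simp_all
    then show ?thesis using r(2)[OF that] by simp
  qed
  \<comment> \<open>The bound \<open>\<delta> / 2\<close> leaves room for a ball of radius
    \<open>\<delta> / 2\<close> inside \<open>?\<Omega>\<close> around each jet and around the mean;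
    \<open>1/6\<close> is the tolerance of \<open>near_round_bound\<close>.\<close>
  define good where "good s \<longleftrightarrow> \<bar>s\<bar> < \<epsilon> \<and> s \<noteq> 0 \<and> \<rho> s < \<delta> / 2 \<and> \<rho> s < 1/6" for s
  have good: "\<forall>\<^sub>F s in at 0. good s"
  proof -
    have "\<forall>\<^sub>F s in at 0. \<bar>s\<bar> < \<epsilon>"
      unfolding eventually_at using \<epsilon> by (auto simp: dist_real_def)
    moreover have "\<forall>\<^sub>F s::real in at 0. s \<noteq> 0" by (rule eventually_neq_at_within)
    moreover have "\<forall>\<^sub>F s in at 0. \<rho> s < \<delta> / 2" "\<forall>\<^sub>F s in at 0. \<rho> s < 1/6"
      by (rule order_tendstoD(2)[OF \<rho>], use \<delta> in simp)+
    ultimately show ?thesis unfolding good_def by eventually_elim blast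
  qed
  have sub: "cball y (\<delta> / 2) \<subseteq> ?\<Omega>" if "norm (y - J0) < \<delta> / 2" for y
  proof
    fix z assume "z \<in> cball y (\<delta> / 2)"
    then show "z \<in> ?\<Omega>"
      using that dist_triangle[of J0 z y] by (simp add: dist_norm norm_minus_commute)
  qed
  have J_sub: "cball (J s x) (\<delta> / 2) \<subseteq> ?\<Omega>" if "good s" "x \<in> S3" for s x
    using sub near_J0[OF J_near, of s x] that by (auto simp: good_def)
  have m_sub: "cball (m s) (\<delta> / 2) \<subseteq> ?\<Omega>" if "good s" for s
    using sub near_J0[OF m_near, of s] that by (auto simp: good_def)
  have J\<Omega>: "J s x \<in> ?\<Omega>" if "good s" "x \<in> S3" for s x
    by (rule subsetD[OF J_sub[OF that]]) (use \<delta> in simp)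
  have m\<Omega>: "m s \<in> ?\<Omega>" if "good s" for s
    by (rule subsetD[OF m_sub[OF that]]) (use \<delta> in simp)
  \<comment> \<open>The error is quadratic in the deviation from the mean, which is bounded by a
    multiple of \<open>|s| * r s\<close>; division by \<open>s^2\<close> leaves a multiple of
    \<open>(r s)^2\<close>.\<close>
  have mv: "((\<lambda>s. (sphere_integral (\<lambda>x. p (J s x)) - sphere_area * p (m s)) / s\<^sup>2) \<longlongrightarrow> 0) (at 0)"
    and pm: "((\<lambda>s. p (m s)) \<longlongrightarrow> p J0) (at 0)" if p: "C11_on ?\<Omega> p Dp" for p Dp
  proof -
    obtain C where C: "C \<ge> 0" "\<And>J m \<rho>. continuous_on S3 J \<Longrightarrow> (\<And>x. x \<in> S3 \<Longrightarrow> J x \<in> ?\<Omega>) \<Longrightarrow> m \<in> ?\<Omega> \<Longrightarrow>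
     (\<And>c. sphere_integral (\<lambda>x. J x $ c) = sphere_area * m $ c) \<Longrightarrow>
     (\<And>x. x \<in> S3 \<Longrightarrow> norm (J x - m) \<le> \<rho>) \<Longrightarrow>
     \<bar>sphere_integral (\<lambda>x. p (J x)) - sphere_area * p m\<bar> \<le> C * \<rho>\<^sup>2"
      using sphere_integral_mean_value[OF p] by blast
    have "\<forall>\<^sub>F s in at 0. norm ((sphere_integral (\<lambda>x. p (J s x)) - sphere_area * p (m s)) / s\<^sup>2) \<le> C * (2 * jet_dim * r s)\<^sup>2"
      using good
    proof eventually_elim
      case (elim s)
      then have s: "\<bar>s\<bar> < \<epsilon>" "s \<noteq> 0" by (auto simp: good_def)
      have "norm (J s x - m s) \<le> 2 * jet_dim * (\<bar>s\<bar> * r s)" if "x \<in> S3" for x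
      proof -
        have "norm (J s x - m s) \<le> norm (J s x - (J0 + s *\<^sub>R K)) + norm (m s - (J0 + s *\<^sub>R K))"
          using norm_triangle_ineq4[of "J s x - (J0 + s *\<^sub>R K)" "m s - (J0 + s *\<^sub>R K)"] by simp
        then show ?thesis using J_near[OF s that] m_near[OF s] by simp
      qed
      then have "\<bar>sphere_integral (\<lambda>x. p (J s x)) - sphere_area * p (m s)\<bar> \<le> C * (2 * jet_dim * (\<bar>s\<bar> * r s))\<^sup>2"
        by (intro C(2) cJ s J\<Omega> m\<Omega> elim mean)
      also have "\<dots> = C * (2 * jet_dim * r s)\<^sup>2 * s\<^sup>2"
        by (simp add: power_mult_distrib mult_ac)
      finally show ?case using s by (simp add: abs_divide divide_le_eq)
    qed
    moreover have "((\<lambda>s. C * (2 * jet_dim * r s)\<^sup>2) \<longlongrightarrow> C * (2 * jet_dim * 0)\<^sup>2) (at 0)"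
      by (intro tendsto_intros r(1))
    ultimately show "((\<lambda>s. (sphere_integral (\<lambda>x. p (J s x)) - sphere_area * p (m s)) / s\<^sup>2) \<longlongrightarrow> 0) (at 0)"
      by (auto intro: Lim_null_comparison)
    obtain C' where C': "C' \<ge> 0" "\<And>x y. x \<in> ?\<Omega> \<Longrightarrow> y \<in> ?\<Omega> \<Longrightarrow> \<bar>p y - p x\<bar> \<le> C' * norm (y - x)"
      using C11_onE[OF p] by metis
    have "\<forall>\<^sub>F s in at 0. norm (p (m s) - p J0) \<le> C' * \<rho> s"
      using good
    proof eventually_elim
      case (elim s)
      then have "\<bar>p (m s) - p J0\<bar> \<le> C' * norm (m s - J0)" using m\<Omega> \<delta> by (intro C'(2)) auto
      also have "\<dots> \<le> C' * \<rho> s"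
        using elim by (intro mult_left_mono C'(1) near_J0 m_near) (auto simp: good_def)
      finally show ?case by simp
    qed
    moreover have "((\<lambda>s. C' * \<rho> s) \<longlongrightarrow> 0) (at 0)" by (rule tendsto_mult_right_zero[OF \<rho>])
    ultimately have "((\<lambda>s. p (m s) - p J0) \<longlongrightarrow> 0) (at 0)" by (rule Lim_null_comparison)
    then show "((\<lambda>s. p (m s)) \<longlongrightarrow> p J0) (at 0)" by (simp add: LIM_zero_iff)
  qed
  have conv: "((\<lambda>s. sphere_integral (\<lambda>x. p (J s x))) \<longlongrightarrow> sphere_area * p J0) (at 0)" if p: "C11_on ?\<Omega> p Dp" for p Dp
  proof -
    have "((\<lambda>s. s\<^sup>2 * ((sphere_integral (\<lambda>x. p (J s x)) - sphere_area * p (m s)) / s\<^sup>2) + sphere_area * p (m s))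
      \<longlongrightarrow> 0\<^sup>2 * 0 + sphere_area * p J0) (at 0)"
      by (intro tendsto_intros mv[OF p] pm[OF p])
    then have "((\<lambda>s. s\<^sup>2 * ((sphere_integral (\<lambda>x. p (J s x)) - sphere_area * p (m s)) / s\<^sup>2) + sphere_area * p (m s))
      \<longlongrightarrow> sphere_area * p J0) (at 0)" by simp
    then show ?thesis
      by (rule Lim_transform_eventually)
        (use eventually_neq_at_within[of "0::real" 0 UNIV] in eventually_elim, simp)
  qed
  let ?I = "\<lambda>p s. sphere_integral (\<lambda>x. p (J s x))"
  let ?e = "\<lambda>p s. (?I p s - sphere_area * p (m s)) / s\<^sup>2"
  let ?DK = "\<lambda>J. D J K" and ?EK = "\<lambda>J. E J K"
  let ?Q = "\<lambda>s. ?DK (m s) * curv_jet (m s) + 3 * (dens_jet (m s) * ?EK (m s))"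
  have crit_eq: "?I ?DK s * ?I curv_jet s + 3 * (?I dens_jet s * ?I ?EK s) = 0" if "good s" for s
  proof -
    have s: "\<bar>s\<bar> < \<epsilon>" "s \<noteq> 0" using that by (auto simp: good_def)
    have near: "\<bar>comps (\<gamma> s) x $ i $ j - dmat 1 1 $ i $ j\<bar> \<le> 1/6" if x: "x \<in> S3" for x i j
    proof -
      have "\<bar>(J s x - J0) $ Inl (i, j)\<bar> \<le> \<rho> s"
        using component_le_norm_cart near_J0[OF J_near[OF s x]] by (rule order_trans)
      then show ?thesis using \<open>good s\<close> by (simp add: J_def jet_def J0_def A_def good_def)
    qed
    have "critical \<alpha> (\<gamma> s)" using crit s by (simp add: abs_less_iff)
    from critical_near_round[OF this near reg, where d = "\<delta> / 2" and D = D and E = E] D E J_sub[OF that] \<delta>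
    show ?thesis by (simp add: J_def K_def H_def)
  qed
  \<comment> \<open>Products of integrals pass to products of mean values by
    \<open>u f - S^2 u' f' = (u - S u') f + S u' (f - S f')\<close>. Each resulting term has a
    factor \<open>?e\<close>, which tends to 0, and convergent factors besides. The sign is negative
    because the critical equation cancels the products of integrals themselves.\<close>
  have "((\<lambda>s. - (?e ?DK s * ?I curv_jet s + sphere_area * ?DK (m s) * ?e curv_jet s
      + 3 * (?e dens_jet s * ?I ?EK s + sphere_area * dens_jet (m s) * ?e ?EK s))) \<longlongrightarrow>
     - (0 * (sphere_area * curv_jet J0) + sphere_area * ?DK J0 * 0
      + 3 * (0 * (sphere_area * ?EK J0) + sphere_area * dens_jet J0 * 0))) (at 0)"
    by (intro tendsto_intros mv[OF D(1)] mv[OF D(2)] mv[OF E(1)] mv[OF E(2)] pm[OF D(1)] pm[OF D(2)]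
        conv[OF E(1)] conv[OF E(2)])
  then have Q0: "((\<lambda>s. - (?e ?DK s * ?I curv_jet s + sphere_area * ?DK (m s) * ?e curv_jet s
      + 3 * (?e dens_jet s * ?I ?EK s + sphere_area * dens_jet (m s) * ?e ?EK s))) \<longlongrightarrow> 0) (at 0)"
    by simp
  have "((\<lambda>s. sphere_area\<^sup>2 * ?Q s / s\<^sup>2) \<longlongrightarrow> 0) (at 0)"
  proof (rule Lim_transform_eventually[OF Q0])
    have alg: "- ((u - S * u') / z * f + S * u' * ((f - S * f') / z) + 3 * ((v - S * v') / z * g + S * v' * ((g - S * g') / z)))
       = S\<^sup>2 * (u' * f' + 3 * (v' * g')) / z" if "u * f + 3 * (v * g) = 0" "z \<noteq> 0" for u u' f f' v v' g g' z S :: real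
    proof -
      have "- ((u - S * u') / z * f + S * u' * ((f - S * f') / z) + 3 * ((v - S * v') / z * g + S * v' * ((g - S * g') / z)))
       = (S\<^sup>2 * (u' * f' + 3 * (v' * g')) - (u * f + 3 * (v * g))) / z"
        using that(2) by (simp add: field_simps power2_eq_square)
      then show ?thesis using that(1) by simp
    qed
    show "\<forall>\<^sub>F s in at 0. - (?e ?DK s * ?I curv_jet s + sphere_area * ?DK (m s) * ?e curv_jet s
      + 3 * (?e dens_jet s * ?I ?EK s + sphere_area * dens_jet (m s) * ?e ?EK s)) = sphere_area\<^sup>2 * ?Q s / s\<^sup>2"
      using good
    proof eventually_elim
      case (elim s)
      then show ?case by (intro alg crit_eq) (simp_all add: good_def)
    qed
  qed
  note Q = this
  have M0: "M 0 = dmat 1 1"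
  proof -
    have "sphere_integral (\<lambda>x. dmat 1 1 $ i $ j) = sphere_integral (\<lambda>x. comps (\<gamma> 0) x $ i $ j)" for i j
      by (rule sphere_integral_cong[OF continuous_on_const]) (simp only: \<gamma>0 round_metric_berger comps_berger)
    then have "sphere_integral (\<lambda>x. comps (\<gamma> 0) x $ i $ j) = dmat 1 1 $ i $ j * sphere_area" for i j
      by (simp only: sphere_integral_const)
    then show ?thesis using sphere_area_pos by (simp add: M_def vec_eq_iff)
  qed
  have dM: "((\<lambda>s. M s $ i $ j) has_real_derivative dmat (-2) 1 $ i $ j) (at 0)" for i j
  proof (rule has_real_derivative_remainder)
    show "\<forall>\<^sub>F s in at 0. \<bar>M s $ i $ j - M 0 $ i $ j - s * dmat (-2) 1 $ i $ j\<bar> \<le> \<bar>s\<bar> * (jet_dim * r s)"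
      using good
    proof eventually_elim
      case (elim s)
      then have "\<bar>(m s - (J0 + s *\<^sub>R K)) $ Inl (i, j)\<bar> \<le> jet_dim * (\<bar>s\<bar> * r s)"
        by (intro order_trans[OF component_le_norm_cart m_near]) (auto simp: good_def)
      moreover have "(m s - (J0 + s *\<^sub>R K)) $ Inl (i, j) = M s $ i $ j - M 0 $ i $ j - s * dmat (-2) 1 $ i $ j"
        by (simp add: m_def J0_def K_def A_def H_def M0 del: dmat_nth)
      ultimately show ?case by (simp only: mult.left_commute)
    qed
    show "((\<lambda>s. jet_dim * r s) \<longlongrightarrow> 0) (at 0)" by (rule tendsto_mult_right_zero[OF r(1)])
  qed
  have Mlim: "((\<lambda>s. M s $ i $ j) \<longlongrightarrow> M 0 $ i $ j) (at 0)" for i j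
    using DERIV_isCont[OF dM[of i j]] by (simp only: isCont_def)
  have "((\<lambda>s. det (M s)) \<longlongrightarrow> det (M 0)) (at 0)"
    unfolding det_3 by (intro tendsto_add tendsto_diff tendsto_mult Mlim)
  then have detM: "((\<lambda>s. det (M s)) \<longlongrightarrow> 1) (at 0)" by (simp add: M0 det_dmat)
  let ?v = "\<lambda>s. var_poly (tr3 (M s)) (minors3 (M s)) (det (M s)) (tr3 H) (minors_deriv (M s) H) (det_deriv (M s) H)"
  \<comment> \<open>\<open>?Q\<close> is the critical expression evaluated at the left-invariant
    metric \<open>M s\<close>; the closed formulas turn it into a positive multiple of the variation
    of the energy in direction \<open>H\<close>.\<close>
  have Qv: "?Q s = (inverse (det (M s)))\<^sup>2 * ?v s" and detpos: "det (M s) > 0" if s: "good s" for s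
  proof -
    have s': "\<bar>s\<bar> < \<epsilon>" using s by (simp add: good_def)
    have sub: "cball (const_jet (M s)) (\<delta> / 2) \<subseteq> ?\<Omega>" using m_sub[OF s] by (simp only: m_def)
    show pos: "det (M s) > 0"
      using reg m\<Omega>[OF s] unfolding regular_def m_def by (metis jmat_const_jet order_less_le_trans)
    have c: "continuous_on S3 (\<lambda>x. comps (\<gamma> s) x $ i $ j)" for i j
      using Ck_continuous[OF tensors_Ck[OF \<gamma>[OF s']], of 4 "[]"] by simp
    have Msym: "M s $ i $ j = M s $ j $ i" for i j
      using sphere_integral_cong[OF c, of i j, OF comps_sym[OF \<gamma>[OF s']]] by (simp add: M_def)
    have Hsym: "H $ i $ j = H $ j $ i" for i j by (simp add: H_def)
    have d2: "\<delta> / 2 > 0" using \<delta> by simp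
    define w where "w = sqrt (det (M s))"
    have w: "w > 0" "det (M s) = w * w" using pos by (auto simp: w_def)
    have nz: "det (M s) \<noteq> 0" using pos by simp
    show "?Q s = (inverse (det (M s)))\<^sup>2 * ?v s"
      unfolding m_def K_def dens_const_jet curv_const_jet[OF Msym nz] dens_jet_deriv_const[OF d2 sub pos D(1)]
        curv_jet_deriv_const[OF d2 sub pos E(1) Msym Hsym] w_def[symmetric] var_poly_def
      by (rule variation_const[OF w])
  qed
  have "((\<lambda>s. (det (M s))\<^sup>2 * (sphere_area\<^sup>2 * ?Q s / s\<^sup>2) / sphere_area\<^sup>2) \<longlongrightarrow> 1\<^sup>2 * 0 / sphere_area\<^sup>2) (at 0)"
    using sphere_area_pos by (intro tendsto_intros detM Q) simp
  then have "((\<lambda>s. (det (M s))\<^sup>2 * (sphere_area\<^sup>2 * ?Q s / s\<^sup>2) / sphere_area\<^sup>2) \<longlongrightarrow> 0) (at 0)"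
    by simp
  moreover have "\<forall>\<^sub>F s in at 0. (det (M s))\<^sup>2 * (sphere_area\<^sup>2 * ?Q s / s\<^sup>2) / sphere_area\<^sup>2 = ?v s / s\<^sup>2"
    using good
  proof eventually_elim
    case (elim s)
    have "(det (M s))\<^sup>2 * ((inverse (det (M s)))\<^sup>2 * ?v s) = ?v s"
      using detpos[OF elim] by (simp add: power_inverse)
    then have e: "(det (M s))\<^sup>2 * ?Q s = ?v s" by (simp only: Qv[OF elim])
    have "p * (z * q / t) / z = p * q / t" if "z \<noteq> 0" for p q t z :: real
      using that by simp
    from this[of "sphere_area\<^sup>2" "(det (M s))\<^sup>2" "?Q s" "s\<^sup>2"] show ?case
      unfolding e using sphere_area_pos by simp
  qed
  ultimately have "((\<lambda>s. ?v s / s\<^sup>2) \<longlongrightarrow> 0) (at 0)"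
    by (rule Lim_transform_eventually)
  moreover have "((\<lambda>s. ?v s / s\<^sup>2) \<longlongrightarrow> - 2880) (at 0)"
    unfolding H_def by (rule var_poly_second_order[OF M0 dM])
  ultimately have "(0::real) = - 2880"
    by (rule tendsto_unique[OF trivial_limit_at])
  then show False by simp
qed

theorem theorem1p8:
  fixes \<alpha> :: real
  assumes "0 < \<alpha>" and "\<alpha> < 1"
  shows "\<not> local_minimizer \<alpha> round_metric \<and>
    (\<exists>\<gamma>. (\<forall>k. metric_path k \<alpha> {0..1} \<gamma>) \<and> \<gamma> 1 = round_metric \<and>
      (\<forall>s\<in>{0..<1}. F_third (\<gamma> s) < F_third round_metric)) \<and>
    (\<exists>h\<in>H1_third \<alpha> round_metric.
      \<not> tensor_zero h \<and> transverse_traceless round_metric h \<and>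
      \<not> integrable_deformation \<alpha> round_metric h)"
  using not_local_minimizer_round metric_path_berger_path berger_path_1 F_third_berger_path
    berger_H1 berger_nonzero transverse_traceless_berger not_integrable_berger
  by blast

end
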